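(* Let $(b_n)_{n\ge1}$ be a sequence of positive reals satisfying $b_n=1-\frac{\mathrm{w}}{n^2}+\mathcal{O}(n^{-2-\zeta})$ as $n\to\infty$ for some $1\ge\zeta>0$, with $-3/8<\mathrm{w}<1/8$, and suppose that the matrix $R$ is $1$-transient. Let $\theta=1-\frac{\sqrt{1-8\mathrm{w}}}{2}$. Then the density of returns to the origin $m(b_0)$ obeys $$m(b_0)\approx (b_0^c-b_0)^{\theta/(1-\theta)}\quad\text{as } b_0\nearrow b_0^c .$$
   Context: The notation $f\approx g$ means that $f/g$ converges to a finite non-zero constant. The numbers $b_n>0$, $n\ge1$, are fixed and $b_0>0$ is a parameter. SOS model: for $N\ge1$, configurations are $(X_0,\dots,X_N)$ with $X_0=0$, $X_i\in\mathbb{Z}_+$, $|X_{i+1}-X_i|=1$, with probability $\mathbf{P}^{\mathrm{SOS}}(X_1,\dots,X_N)=Z_N^{-1}\,2^{-N}\prod_{n=0}^{N}b_{X_n}^{-1}$, $Z_N$ being the normalization. The density of returns $m(b_0)$, $b_0<b_0^c$, is the common value of the (existing) limits $\lim_{N\to\infty}\frac{1}{2N-1}\sum_{l=1}^{2N-1}\mathbf{P}^{\mathrm{SOS}}(X_l=0\mid X_{2N}=0)$ and $\lim_{N\to\infty}\frac1N\sum_{l=1}^N\mathbf{P}^{\mathrm{SOS}}(X_l=0)$ (lengths $2N$ and $N$ respectively). Matrix $R$: for sequences $w=(w_p)_{p\ge1}$, $(Rw)_1=\frac{w_2}{2\sqrt{b_1b_2}}$ and $(Rw)_p=\frac{w_{p+1}}{2\sqrt{b_pb_{p+1}}}+\frac{w_{p-1}}{2\sqrt{b_pb_{p-1}}}$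 for $p>1$. $R$ is $1$-transient if $Rw=w-\mathbf{1}_{p=1}$ has a solution with all $w_p>0$. Put $\rho_*(R)=\lim_{n\to\infty}(R^{2n}_{i,j})^{1/(2n)}$ ($i-j$ even), $\mathfrak{w}_1(\rho)=\inf\{w_1: w_p>0\ \forall p\ge 1,\ Rw=\rho w-\mathbf{1}_{p=1}\}$ (with $\inf\emptyset=\infty$) and $b_0^c=\lim_{\rho\searrow\rho_*(R)}\frac{\mathfrak{w}_1(\rho)}{4b_1\rho}$ (finite under the present hypotheses). *)

theory Defs
  imports "HOL-Probability.Probability" "HOL-Library.Landau_Symbols"
begin

definition approx_const :: "(real \<Rightarrow> real) \<Rightarrow> (real \<Rightarrow> real) \<Rightarrow> real filter \<Rightarrow> bool" where
  "approx_const f g F \<longleftrightarrow> (\<exists>c. c \<noteq> 0 \<and> ((\<lambda>x. f x / g x) \<longlongrightarrow> c) F)"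

definition sos_paths :: "nat \<Rightarrow> nat list set" where
  "sos_paths N = {X. length X = Suc N \<and> X ! 0 = 0 \<and>
     (\<forall>i<N. \<bar>int (X ! Suc i) - int (X ! i)\<bar> = 1)}"

definition sos_weight :: "(nat \<Rightarrow> real) \<Rightarrow> nat \<Rightarrow> nat list \<Rightarrow> real" where
  "sos_weight b N X = (1 / 2) ^ N * (\<Prod>n=0..N. inverse (b (X ! n)))"

definition sos_Z :: "(nat \<Rightarrow> real) \<Rightarrow> nat \<Rightarrow> real" where
  "sos_Z b N = (\<Sum>X\<in>sos_paths N. sos_weight b N X)"

definition sos_measure :: "(nat \<Rightarrow> real) \<Rightarrow> nat \<Rightarrow> nat list measure" where
  "sos_measure b N =
     point_measure (sos_paths N) (\<lambda>X. ennreal (sos_weight b N X / sos_Z b N))"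

definition pinned_return_freq :: "(nat \<Rightarrow> real) \<Rightarrow> nat \<Rightarrow> real" where
  "pinned_return_freq b N =
     (\<Sum>l=1..2*N-1. \<P>(X in sos_measure b (2*N). X ! l = 0 \<bar> X ! (2*N) = 0)) / real (2*N-1)"

definition free_return_freq :: "(nat \<Rightarrow> real) \<Rightarrow> nat \<Rightarrow> real" where
  "free_return_freq b N =
     (\<Sum>l=1..N. \<P>(X in sos_measure b N. X ! l = 0)) / real N"

text \<open>The value \<open>b 0\<close> of the given sequence is never used: the parameter \<open>b0\<close> takes its place.\<close>

definition return_density :: "(nat \<Rightarrow> real) \<Rightarrow> real \<Rightarrow> real" where
  "return_density b b0 = (THE m.
     pinned_return_freq (b(0 := b0)) \<longlonglongrightarrow> m \<and> free_return_freq (b(0 := b0)) \<longlonglongrightarrow> m)"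

text \<open>Sequences indexed by \<open>p \<ge> 1\<close> are functions on \<open>nat\<close> whose value at \<open>0\<close> is irrelevant.\<close>

definition R_op :: "(nat \<Rightarrow> real) \<Rightarrow> (nat \<Rightarrow> real) \<Rightarrow> nat \<Rightarrow> real" where
  "R_op b w p =
     (if p = 0 then 0
      else if p = 1 then w 2 / (2 * sqrt (b 1 * b 2))
      else w (p + 1) / (2 * sqrt (b p * b (p + 1))) + w (p - 1) / (2 * sqrt (b p * b (p - 1))))"

text \<open>The \<open>(i, j)\<close> entry of the matrix power \<open>R\<^sup>n\<close> is the \<open>i\<close>-th component of
  \<open>R\<^sup>n\<close> applied to the \<open>j\<close>-th unit vector.\<close>

definition R_pow_entry :: "(nat \<Rightarrow> real) \<Rightarrow> nat \<Rightarrow> nat \<Rightarrow> nat \<Rightarrow> real" where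
  "R_pow_entry b n i j = (R_op b ^^ n) (\<lambda>p. if p = j then 1 else 0) i"

definition positive_resolvent_solution :: "(nat \<Rightarrow> real) \<Rightarrow> real \<Rightarrow> (nat \<Rightarrow> real) \<Rightarrow> bool" where
  "positive_resolvent_solution b \<rho> w \<longleftrightarrow>
     (\<forall>p\<ge>1. w p > 0) \<and> (\<forall>p\<ge>1. R_op b w p = \<rho> * w p - (if p = 1 then 1 else 0))"

definition one_transient :: "(nat \<Rightarrow> real) \<Rightarrow> bool" where
  "one_transient b \<longleftrightarrow> (\<exists>w. positive_resolvent_solution b 1 w)"

text \<open>The limit does not depend on \<open>i\<close> and \<open>j\<close>.\<close>

definition rho_star :: "(nat \<Rightarrow> real) \<Rightarrow> real" where
  "rho_star b = (THE \<rho>. \<forall>i\<ge>1. \<forall>j\<ge>1. even (i + j) \<longrightarrow>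
     (\<lambda>n. R_pow_entry b (2*n) i j powr (1 / real (2*n))) \<longlonglongrightarrow> \<rho>)"

text \<open>The infimum is taken in the extended reals, so that it is \<open>\<infinity>\<close> when there is no solution.\<close>

definition w1_inf :: "(nat \<Rightarrow> real) \<Rightarrow> real \<Rightarrow> ereal" where
  "w1_inf b \<rho> = Inf {ereal (w 1) | w. positive_resolvent_solution b \<rho> w}"

definition b0_crit :: "(nat \<Rightarrow> real) \<Rightarrow> ereal" where
  "b0_crit b = Lim (at_right (rho_star b)) (\<lambda>\<rho>. w1_inf b \<rho> / ereal (4 * b 1 * \<rho>))"

end

theory Submission
  imports Defs "HOL-Real_Asymp.Real_Asymp"
begin

text \<open>Write \<open>x = 1 / \<rho>\<close>. The minimal solution of \<open>R w = \<rho> w - \<delta>\<^sub>1\<close> is the Green function \<open>G\<^sub>x\<close>, and the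
  parameter \<open>b0\<close> has free energy \<open>- ln x\<close>, where \<open>b0 = f x = x G\<^sub>x(1) / (4 b\<^sub>1)\<close>; extending \<open>G\<^sub>x\<close> to the
  origin gives the corresponding Perron eigenvector of the transfer operator. Convexity of the free energy in
  \<open>ln b0\<close> turns this into \<open>m(b0) = f x / (x f' x)\<close>, so everything is governed by \<open>f 1 - f x\<close> as \<open>x \<rightarrow> 1\<close>.

  With \<open>\<alpha> = 1 - \<theta>\<close>, barriers \<open>p\<^bsup>1/2 - \<alpha>\<^esup> \<plusminus> p\<^bsup>1/2 - \<alpha> - \<zeta>/2\<^esup>\<close> show that \<open>h = G\<^sub>1\<close> is asymptotic to a multiple of
  \<open>p\<^bsup>1/2 - \<alpha>\<^esup>\<close>. After the \<open>h\<close>-transform, \<open>h\<^sub>1 - G\<^sub>x(1)\<close> is essentially the minimum \<open>e(\<mu>)\<close>, \<open>\<mu> = \<rho> - 1\<close>, of the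
  Dirichlet energy \<open>\<Sum>p. C\<^sub>p (\<phi>\<^sub>p - \<phi>\<^sub>p\<^sub>+\<^sub>1)\<^sup>2 + \<mu> m\<^sub>p \<phi>\<^sub>p\<^sup>2\<close> over \<open>\<phi>\<^sub>1 = 1\<close>, with \<open>C\<^sub>p\<close> and \<open>m\<^sub>p\<close> of order \<open>p\<^bsup>1 - 2\<alpha>\<^esup>\<close>.
  Stretching the minimiser for \<open>\<mu>\<close> by an integer factor \<open>l\<close> gives a competitor for \<open>\<mu> / l\<^sup>2\<close>, so that
  \<open>e(\<mu>) / \<mu>\<^sup>\<alpha>\<close> is almost monotone and converges to a positive limit. No Bessel function or Tauberian
  theorem is needed; the derivative \<open>f'\<close> follows because it is monotone.\<close>

section \<open>Jacobi operators with zero diagonal\<close>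

text \<open>The hypotheses fix the coefficients only up to \<open>O(n^(-2-\<zeta>))\<close> and
  leave finitely many of them arbitrary, so no exact solution is at hand. Inserting
  \<open>p^\<gamma>\<close> in \<open>R\<close> leaves the relative defect
  \<open>((\<gamma> - 1/2)^2 - \<alpha>^2) / (2 p^2)\<close> with
  \<open>\<alpha> = sqrt (1 - 8 w) / 2\<close>: the critical exponents are
  \<open>1/2 +- \<alpha>\<close>, and minimality selects the smaller one. The window
  \<open>-3/8 < w < 1/8\<close> is \<open>0 < \<alpha> < 1\<close>. Balancing mass against
  resistance at length \<open>\<mu>^(-1/2)\<close> gives an energy of order
  \<open>\<mu>^\<alpha>\<close>; against it the errors from the uncontrolled initial sites, linear
  in \<mu> or quadratic in the energy, are negligible. So \<open>f 1 - f x\<close> is of order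
  \<open>(1 - x)^\<alpha>\<close>, \<open>f'\<close> of order \<open>(1 - x)^(\<alpha> - 1)\<close>,
  and the density of order \<open>(f 1 - f x)^((1 - \<alpha>) / \<alpha>)\<close>. The formula for
  \<open>f\<close> is a renewal equation: an excursion from the origin is a loop of \<open>R\<close>
  at 1 with weight \<open>1 / (4 b0 b1)\<close> for its first and last steps, and
  \<open>b0 = f x\<close> says that the generating function of excursions equals 1 at
  \<open>x\<close>.\<close>

definition jac :: "(nat \<Rightarrow> real) \<Rightarrow> (nat \<Rightarrow> real) \<Rightarrow> nat \<Rightarrow> real" where
  "jac c f p = c p * f (Suc p) + (case p of 0 \<Rightarrow> 0 | Suc q \<Rightarrow> c q * f q)"

definition unit_vec :: "nat \<Rightarrow> nat \<Rightarrow> real" where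
  "unit_vec j p = (if p = j then 1 else 0)"

lemma jac_0: "jac c f 0 = c 0 * f 1"
  and jac_Suc: "jac c f (Suc q) = c (Suc q) * f (Suc (Suc q)) + c q * f q"
  by (simp_all add: jac_def)

lemma jac_scale: "jac c (\<lambda>p. a * f p) = (\<lambda>p. a * jac c f p)"
  by (rule ext) (simp add: jac_def algebra_simps split: nat.split)

lemma jac_add: "jac c (\<lambda>p. f p + g p) = (\<lambda>p. jac c f p + jac c g p)"
  by (rule ext) (simp add: jac_def algebra_simps split: nat.split)

lemma jac_diff: "jac c (\<lambda>p. f p - g p) = (\<lambda>p. jac c f p - jac c g p)"
  by (rule ext) (simp add: jac_def algebra_simps split: nat.split)

lemma jac_pow_scale: "(jac c ^^ n) (\<lambda>p. a * f p) = (\<lambda>p. a * (jac c ^^ n) f p)"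
  by (induction n) (simp_all add: jac_scale)

lemma jac_mono_at:
  assumes "\<And>q. c q \<ge> 0" "f (Suc p) \<le> g (Suc p)" "\<And>q. p = Suc q \<Longrightarrow> f q \<le> g q"
  shows "jac c f p \<le> jac c g p"
  using assms by (auto simp: jac_def intro!: add_mono mult_left_mono split: nat.split)

lemma jac_pow_mono:
  assumes "\<And>q. c q \<ge> 0" "\<And>q. f q \<le> g q"
  shows "(jac c ^^ n) f p \<le> (jac c ^^ n) g p"
  by (induction n arbitrary: p) (auto intro!: jac_mono_at assms)

lemma jac_pow_nonneg:
  assumes "\<And>q. c q \<ge> 0" "\<And>q. f q \<ge> 0"
  shows "(jac c ^^ n) f p \<ge> 0"
proof -
  have "(jac c ^^ n) (\<lambda>q. 0 * f q) p \<le> (jac c ^^ n) f p"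
    by (rule jac_pow_mono) (use assms in auto)
  thus ?thesis unfolding jac_pow_scale by simp
qed

lemma jac_pow_unit_nonneg: "(\<And>q. c q \<ge> 0) \<Longrightarrow> (jac c ^^ n) (unit_vec j) p \<ge> 0"
  by (rule jac_pow_nonneg) (auto simp: unit_vec_def)

lemma jac_pow_unit_support: "p > j + n \<Longrightarrow> (jac c ^^ n) (unit_vec j) p = 0"
proof (induction n arbitrary: p)
  case (Suc n)
  then show ?case by (cases p) (auto simp: jac_def)
qed (auto simp: unit_vec_def)

text \<open>Discrete Green identity: by symmetry the summands telescope, leaving the Wronskian at
  the cut-off \<open>M\<close>.\<close>

lemma jac_lagrange:
  "(\<Sum>p\<le>M. jac c f p * g p - f p * jac c g p) = c M * (f (Suc M) * g M - f M * g (Suc M))"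
  by (induction M) (simp_all add: jac_def algebra_simps)

text \<open>Finite propagation replaces summability: \<open>(jac c ^^ n) (unit_vec j)\<close>
  vanishes beyond \<open>j + n\<close>, so the boundary term of the Green identity is zero and the
  operator can be moved onto an arbitrary \<open>g\<close>.\<close>

lemma jac_pow_pairing:
  assumes "M \<ge> j + n"
  shows "(\<Sum>p\<le>M. (jac c ^^ n) (unit_vec j) p * g p) = (jac c ^^ n) g j"
  using assms
proof (induction n arbitrary: g)
  case 0
  have "(\<Sum>p\<le>M. unit_vec j p * g p) = (\<Sum>p\<in>{j}. unit_vec j p * g p)"
    by (rule sum.mono_neutral_right) (use 0 in \<open>auto simp: unit_vec_def\<close>)
  then show ?case by (simp add: unit_vec_def)
next
  case (Suc n)
  let ?f = "(jac c ^^ n) (unit_vec j)"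
  have "?f M = 0" "?f (Suc M) = 0"
    using Suc.prems by (auto intro!: jac_pow_unit_support)
  with jac_lagrange[of c ?f g M]
  have "(\<Sum>p\<le>M. jac c ?f p * g p) = (\<Sum>p\<le>M. ?f p * jac c g p)"
    by (simp add: sum_subtractf)
  also have "\<dots> = (jac c ^^ n) (jac c g) j"
    using Suc by simp
  finally show ?case by (simp add: funpow_swap1)
qed

lemma jac_pow_unit_sym: "(jac c ^^ n) (unit_vec j) i = (jac c ^^ n) (unit_vec i) j"
proof -
  have "(jac c ^^ n) (unit_vec i) j = (\<Sum>p\<le>j + n + i. (jac c ^^ n) (unit_vec j) p * unit_vec i p)"
    by (rule jac_pow_pairing[symmetric]) simp
  also have "\<dots> = (\<Sum>p\<in>{i}. (jac c ^^ n) (unit_vec j) p * unit_vec i p)"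
    by (rule sum.mono_neutral_right) (auto simp: unit_vec_def)
  finally show ?thesis by (simp add: unit_vec_def)
qed

text \<open>For the symmetric operator \<open>T\<close> the entry \<open><e_i, T^(2n) e_i>\<close>
  is the squared norm of \<open>T^n e_i\<close>.\<close>

lemma jac_pow_diag: "(jac c ^^ (2 * n)) (unit_vec i) i = (\<Sum>p\<le>i + n. ((jac c ^^ n) (unit_vec i) p)\<^sup>2)"
  using jac_pow_pairing[of i n "i + n" c "(jac c ^^ n) (unit_vec i)"]
  by (simp add: power2_eq_square mult_2 funpow_add)

text \<open>Cauchy--Schwarz applied to \<open>\<langle>T\<^sup>n e\<^sub>i, v\<rangle> = (T\<^sup>n v) i\<close>, for the symmetric operator \<open>T\<close>.\<close>

lemma jac_pow_diag_lower:
  assumes c: "\<And>q. c q \<ge> 0" and l: "l \<ge> 0" and v: "\<And>p. jac c v p \<ge> l * v p" "v i \<ge> 0"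
  shows "(l ^ n * v i)\<^sup>2 \<le> (jac c ^^ (2 * n)) (unit_vec i) i * (\<Sum>p\<le>i + n. (v p)\<^sup>2)"
proof -
  have "l ^ n * v p \<le> (jac c ^^ n) v p" for p
  proof (induction n arbitrary: p)
    case (Suc n)
    have "l ^ Suc n * v p \<le> l ^ n * jac c v p"
      using mult_left_mono[OF v(1)[of p], of "l ^ n"] l by (simp add: mult_ac)
    also have "\<dots> = jac c (\<lambda>p. l ^ n * v p) p" by (simp add: jac_scale)
    also have "\<dots> \<le> jac c ((jac c ^^ n) v) p" by (intro jac_mono_at c Suc)
    finally show ?case by simp
  qed simp
  hence "l ^ n * v i \<le> (\<Sum>p\<le>i + n. (jac c ^^ n) (unit_vec i) p * v p)"
    by (simp add: jac_pow_pairing)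
  hence "(l ^ n * v i)\<^sup>2 \<le> (\<Sum>p\<le>i + n. (jac c ^^ n) (unit_vec i) p * v p)\<^sup>2"
    by (rule power_mono) (use l v in auto)
  also have "\<dots> \<le> (\<Sum>p\<le>i + n. ((jac c ^^ n) (unit_vec i) p)\<^sup>2) * (\<Sum>p\<le>i + n. (v p)\<^sup>2)"
    by (rule Cauchy_Schwarz_ineq_sum)
  finally show ?thesis by (simp add: jac_pow_diag)
qed

text \<open>Entries of powers are sums over paths; only the paths that sit at \<open>k\<close> at
  the intermediate time are kept.\<close>

lemma jac_pow_compose_lower:
  assumes c: "\<And>q. c q \<ge> 0"
  shows "(jac c ^^ m) (unit_vec k) i * (jac c ^^ n) (unit_vec j) k \<le> (jac c ^^ (m + n)) (unit_vec j) i"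
proof -
  let ?a = "(jac c ^^ n) (unit_vec j) k"
  have "(jac c ^^ m) (\<lambda>p. ?a * unit_vec k p) i \<le> (jac c ^^ m) ((jac c ^^ n) (unit_vec j)) i"
    by (rule jac_pow_mono[OF c]) (auto simp: unit_vec_def jac_pow_unit_nonneg c)
  thus ?thesis unfolding jac_pow_scale by (simp add: funpow_add mult.commute)
qed

lemma jac_pow_unit_pos:
  assumes c: "\<And>q. c q \<ge> 0" and pos: "\<And>q. q \<ge> 1 \<Longrightarrow> c q > 0" and "j \<ge> 1"
  shows "(jac c ^^ n) (unit_vec j) (j + n) > 0"
proof (induction n)
  case (Suc n)
  have "0 < c (j + n) * (jac c ^^ n) (unit_vec j) (j + n)"
    using Suc pos \<open>j \<ge> 1\<close> by simp
  also have "\<dots> \<le> jac c ((jac c ^^ n) (unit_vec j)) (j + Suc n)"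
    using c jac_pow_unit_nonneg[of c, OF c] by (simp add: jac_Suc)
  finally show ?case by simp
qed (simp add: unit_vec_def)

lemma jac_pow_unit_pos':
  assumes c: "\<And>q. c q \<ge> 0" and pos: "\<And>q. q \<ge> 1 \<Longrightarrow> c q > 0" and "i \<ge> 1" "i \<le> k"
  shows "(jac c ^^ (k - i)) (unit_vec k) i > 0" "(jac c ^^ (k - i)) (unit_vec i) k > 0"
  using jac_pow_unit_pos[of c i "k - i", OF assms(1,2,3)] assms by (auto simp: jac_pow_unit_sym[of _ c k i])

text \<open>A zero coupling between 0 and 1 detaches the site 0, so the same \<open>jac\<close>
  serves for \<open>R\<close> on \<open>p \<ge> 1\<close> and, with a positive coupling, for the SOS
  transfer operator on \<open>p \<ge> 0\<close>. The value 0 of \<open>R_op\<close> at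
  \<open>p = 0\<close> makes the equality hold there too.\<close>

lemma R_op_eq_jac:
  "R_op b = jac (\<lambda>p. if p = 0 then 0 else 1 / (2 * sqrt (b p * b (Suc p))))"
proof (intro ext)
  fix f p show "R_op b f p = jac (\<lambda>p. if p = 0 then 0 else 1 / (2 * sqrt (b p * b (Suc p)))) f p"
    by (cases p) (auto simp: R_op_def jac_def numeral_2_eq_2 mult.commute)
qed

lemma R_pow_entry_eq_jac:
  "R_pow_entry b n i j = (jac (\<lambda>p. if p = 0 then 0 else 1 / (2 * sqrt (b p * b (Suc p)))) ^^ n) (unit_vec j) i"
  by (simp add: R_pow_entry_def R_op_eq_jac unit_vec_def[abs_def])

section \<open>The Green function of a transient operator\<close>

locale transient_jacobi =
  fixes c :: "nat \<Rightarrow> real"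
  assumes c_0: "c 0 = 0" and c_pos: "p \<ge> 1 \<Longrightarrow> c p > 0"
    and transient: "\<exists>v. (\<forall>p\<ge>1. v p > 0) \<and> (\<forall>p\<ge>1. jac c v p = v p - unit_vec 1 p)"
begin

lemma c_nonneg: "c p \<ge> 0"
  using c_0 c_pos[of p] by (cases p) auto

abbreviation R where "R \<equiv> jac c"

text \<open>Neumann series of \<open>(1/x - R)^(-1)\<close> applied to
  \<open>unit_vec 1\<close>.\<close>

definition green :: "real \<Rightarrow> nat \<Rightarrow> real" where
  "green x p = (\<Sum>n. (R ^^ n) (unit_vec 1) p * x ^ Suc n)"

lemma R_pow_at_0: "j \<ge> 1 \<Longrightarrow> (R ^^ n) (unit_vec j) 0 = 0"
  by (induction n) (auto simp: unit_vec_def jac_0 c_0)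

lemma R_pow_nonneg: "(R ^^ n) (unit_vec j) p \<ge> 0"
  by (rule jac_pow_unit_nonneg[OF c_nonneg])

lemma R_mono: "(\<And>q. q \<ge> 1 \<Longrightarrow> f q \<le> g q) \<Longrightarrow> R f p \<le> R g p"
proof (cases p)
  case (Suc q)
  moreover assume *: "\<And>q. q \<ge> 1 \<Longrightarrow> f q \<le> g q"
  moreover have "c q * f q \<le> c q * g q"
    using *[of q] c_nonneg[of q] c_0 by (cases "q = 0") (auto intro: mult_left_mono)
  ultimately show ?thesis by (auto simp: jac_Suc intro!: add_mono mult_left_mono c_nonneg)
qed (simp add: jac_0 c_0)

text \<open>The partial sums obey \<open>s_(N+1) = x (R s_N + e_1)\<close>, so monotonicity of
  \<open>R\<close> keeps them below every nonnegative supersolution. This yields both the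
  convergence of the series, from the transience witness, and the minimality of its sum.\<close>

lemma partial_green_le:
  assumes v: "\<And>p. p \<ge> 1 \<Longrightarrow> v p \<ge> 0" "\<And>p. p \<ge> 1 \<Longrightarrow> x * (R v p + unit_vec 1 p) \<le> v p"
    and x: "x \<ge> 0" and "p \<ge> 1"
  shows "(\<Sum>n<N. (R ^^ n) (unit_vec 1) p * x ^ Suc n) \<le> v p"
  using \<open>p \<ge> 1\<close>
proof (induction N arbitrary: p)
  case 0
  then show ?case using v by simp
next
  case (Suc N)
  let ?s = "\<lambda>p. \<Sum>n<N. (R ^^ n) (unit_vec 1) p * x ^ Suc n"
  have R_s: "R ?s p = (\<Sum>n<N. (R ^^ Suc n) (unit_vec 1) p * x ^ Suc n)" for p
    by (cases p) (simp_all add: jac_def sum_distrib_left sum.distrib[symmetric] algebra_simps)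
  have "(\<Sum>n<Suc N. (R ^^ n) (unit_vec 1) p * x ^ Suc n) = x * (R ?s p + unit_vec 1 p)"
    unfolding R_s sum.lessThan_Suc_shift by (simp add: sum_distrib_left algebra_simps)
  also have "R ?s p \<le> R v p"
    by (rule R_mono) (use Suc.IH in auto)
  hence "x * (R ?s p + unit_vec 1 p) \<le> x * (R v p + unit_vec 1 p)"
    using x by (simp add: mult_left_mono)
  also have "\<dots> \<le> v p" using v(2)[OF Suc.prems] .
  finally show ?case .
qed

lemma summable_R_pow: "summable (\<lambda>n. (R ^^ n) (unit_vec 1) p)"
proof (cases "p = 0")
  case True
  thus ?thesis by (simp add: R_pow_at_0)
next
  case False
  obtain v where v: "\<forall>p\<ge>1. v p > 0" "\<forall>p\<ge>1. R v p = v p - unit_vec 1 p"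
    using transient by blast
  have "(\<Sum>n<N. (R ^^ n) (unit_vec 1) p * 1 ^ Suc n) \<le> v p" for N
    by (rule partial_green_le) (use v False in \<open>auto intro: less_imp_le\<close>)
  thus ?thesis
    by (intro summableI_nonneg_bounded[of _ "v p"]) (auto intro: R_pow_nonneg)
qed

lemma summable_green:
  assumes "0 \<le> x" "x \<le> 1"
  shows "summable (\<lambda>n. (R ^^ n) (unit_vec 1) p * x ^ Suc n)"
  by (rule summable_comparison_test'[OF summable_R_pow[of p], of 0])
    (use assms in \<open>auto simp: abs_mult R_pow_nonneg power_le_one mult_left_le simp del: power_Suc\<close>)

lemma green_le_supersolution:
  assumes "\<And>p. p \<ge> 1 \<Longrightarrow> v p \<ge> 0" "\<And>p. p \<ge> 1 \<Longrightarrow> x * (R v p + unit_vec 1 p) \<le> v p"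
    and "0 \<le> x" "x \<le> 1" and "p \<ge> 1"
  shows "green x p \<le> v p"
  unfolding green_def
  by (rule suminf_le_const[OF summable_green]) (use partial_green_le[OF assms(1,2,3,5)] assms in auto)

lemma green_at_0: "green x 0 = 0"
  by (simp add: green_def R_pow_at_0)

lemma green_mono: "\<lbrakk>0 \<le> x; x \<le> y; y \<le> 1\<rbrakk> \<Longrightarrow> green x p \<le> green y p"
  unfolding green_def
  by (intro suminf_le summable_green mult_left_mono power_mono) (auto simp: R_pow_nonneg)

lemma green_pos:
  assumes "0 < x" "x \<le> 1" "p \<ge> 1"
  shows "green x p > 0"
proof -
  have "(R ^^ (p - 1)) (unit_vec 1) p > 0"
    using jac_pow_unit_pos'(2)[of c 1 p, OF c_nonneg c_pos] assms by simp
  thus ?thesis unfolding green_def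
    by (intro suminf_pos2[where i = "p - 1"] summable_green) (use assms in \<open>auto simp: R_pow_nonneg\<close>)
qed

lemma green_eq:
  assumes "0 < x" "x \<le> 1"
  shows "R (green x) p = green x p / x - unit_vec 1 p"
proof -
  let ?t = "\<lambda>p n. (R ^^ n) (unit_vec 1) p * x ^ Suc n"
  have S: "summable (?t p)" for p by (rule summable_green) (use assms in auto)
  have shift: "(\<Sum>n. (R ^^ Suc n) (unit_vec 1) p * x ^ Suc n) = green x p / x - unit_vec 1 p" for p
  proof -
    have "(\<Sum>n. ?t p (Suc n)) = green x p - x * unit_vec 1 p"
      using suminf_split_head[OF S[of p]] by (simp add: green_def)
    moreover have "(\<Sum>n. ?t p (Suc n)) = (\<Sum>n. x * ((R ^^ Suc n) (unit_vec 1) p * x ^ Suc n))"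
      by (simp add: mult_ac)
    moreover have "\<dots> = x * (\<Sum>n. (R ^^ Suc n) (unit_vec 1) p * x ^ Suc n)"
    proof (rule suminf_mult)
      have "summable (\<lambda>n. inverse x * ?t p (Suc n))"
        by (intro summable_mult summable_Suc_iff[THEN iffD2] S)
      thus "summable (\<lambda>n. (R ^^ Suc n) (unit_vec 1) p * x ^ Suc n)"
        using assms by (simp add: field_simps)
    qed
    ultimately show ?thesis using assms by (simp add: field_simps)
  qed
  have "R (green x) p = (\<Sum>n. R (\<lambda>q. ?t q n) p)"
  proof (cases p)
    case 0
    thus ?thesis using S by (simp add: jac_def green_def suminf_mult c_0)
  next
    case (Suc q)
    have "R (green x) p = (\<Sum>n. c (Suc q) * ?t (Suc (Suc q)) n) + (\<Sum>n. c q * ?t q n)"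
      using S by (simp add: jac_def green_def suminf_mult Suc del: power_Suc)
    also have "\<dots> = (\<Sum>n. c (Suc q) * ?t (Suc (Suc q)) n + c q * ?t q n)"
      by (intro suminf_add summable_mult S)
    finally show ?thesis by (simp add: jac_def Suc)
  qed
  also have "\<dots> = (\<Sum>n. (R ^^ Suc n) (unit_vec 1) p * x ^ Suc n)"
    using jac_scale[of c] by (simp add: mult.commute[of _ "x ^ Suc _"] del: power_Suc)
  finally show ?thesis using shift by simp
qed

text \<open>By transience the nonnegative series converges at \<open>x = 1\<close>; its terms
  without the power of \<open>x\<close> are then a majorant on the whole closed interval, endpoint
  included.\<close>

lemma continuous_on_green: "continuous_on {0..1} (\<lambda>x. green x p)"
proof -
  have "uniform_limit {0..1} (\<lambda>N x. \<Sum>n<N. (R ^^ n) (unit_vec 1) p * x ^ Suc n) (\<lambda>x. green x p) sequentially"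
    unfolding green_def
    by (rule Weierstrass_m_test[OF _ summable_R_pow[of p]])
      (auto simp: abs_mult R_pow_nonneg power_le_one mult_left_le simp del: power_Suc)
  thus ?thesis
    by (rule uniform_limit_theorem[rotated]) (auto intro!: continuous_intros always_eventually)
qed

lemma green_tendsto_1: "((\<lambda>x. green x p) \<longlongrightarrow> green 1 p) (at_left 1)"
proof -
  have "((\<lambda>x. green x p) \<longlongrightarrow> green 1 p) (at 1 within {0..1})"
    using continuous_on_green by (simp add: continuous_on)
  moreover have "at_left (1::real) = at 1 within {0..1}"
    by (rule at_within_nhd[of _ "{0<..}"]) auto
  ultimately show ?thesis by simp
qed

end

section \<open>Asymptotics of the critical Green function\<close>

text \<open>Taylor expansions leave remainders of order \<open>p^(-3)\<close>;
  \<open>\<zeta> \<le> 1\<close> lets them be absorbed in the error allowed by the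
  hypothesis.\<close>

lemma powr_minus_3_bigo:
  assumes "\<zeta> \<le> 1"
  shows "(\<lambda>p. real p powr - 3) \<in> O(\<lambda>p. real p powr (- 2 - \<zeta>))"
  by (rule landau_o.big_mono, rule eventually_mono[OF eventually_ge_at_top[of 1]])
    (use assms in \<open>auto intro!: powr_mono\<close>)

text \<open>The constant \<open>(1 - 4 \<alpha>^2) / 16\<close> is \<open>w / 2\<close> rewritten so
  that the exponents of the approximately harmonic powers are
  \<open>1/2 +- \<alpha>\<close>.\<close>

locale critical_jacobi = transient_jacobi +
  fixes \<alpha> \<zeta> :: real
  assumes \<alpha>: "0 < \<alpha>" "\<alpha> < 1" and \<zeta>: "0 < \<zeta>" "\<zeta> \<le> 1"
    and c_asymp: "(\<lambda>p. c p - (1 / 2 + (1 - 4 * \<alpha>\<^sup>2) / 16 / (real p)\<^sup>2)) \<in> O(\<lambda>p. real p powr (- 2 - \<zeta>))"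
begin

lemma c_pred_asymp:
  "(\<lambda>p. c (p - 1) - (1 / 2 + (1 - 4 * \<alpha>\<^sup>2) / 16 / (real p)\<^sup>2)) \<in> O(\<lambda>p. real p powr (- 2 - \<zeta>))"
proof -
  define k where "k = (1 - 4 * \<alpha>\<^sup>2) / 16"
  have "(\<lambda>p. c (p - 1) - (1 / 2 + k / (real (p - 1))\<^sup>2)) \<in> O(\<lambda>p. real (p - 1) powr (- 2 - \<zeta>))"
    using landau_o.big.compose[OF c_asymp, of "\<lambda>p. p - 1" at_top] filterlim_minus_const_nat_at_top[of 1]
    by (simp add: k_def)
  also have "(\<lambda>p::nat. real (p - 1) powr (- 2 - \<zeta>)) \<in> O(\<lambda>p. real p powr (- 2 - \<zeta>))"
    by real_asymp
  finally have A: "(\<lambda>p. c (p - 1) - (1 / 2 + k / (real (p - 1))\<^sup>2)) \<in> O(\<lambda>p. real p powr (- 2 - \<zeta>))" .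
  have "(\<lambda>p::nat. 1 / (real (p - 1))\<^sup>2 - 1 / (real p)\<^sup>2) \<in> O(\<lambda>p. real p powr - 3)"
    by real_asymp
  also note powr_minus_3_bigo[OF \<zeta>(2)]
  finally have "(\<lambda>p. k * (1 / (real (p - 1))\<^sup>2 - 1 / (real p)\<^sup>2)) \<in> O(\<lambda>p. real p powr (- 2 - \<zeta>))"
    by simp
  note sum_in_bigo(1)[OF A this]
  also have "(\<lambda>p. c (p - 1) - (1 / 2 + k / (real (p - 1))\<^sup>2) + k * (1 / (real (p - 1))\<^sup>2 - 1 / (real p)\<^sup>2))
      = (\<lambda>p. c (p - 1) - (1 / 2 + k / (real p)\<^sup>2))"
    by (simp add: fun_eq_iff right_diff_distrib)
  finally show ?thesis by (simp add: k_def)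
qed

text \<open>Relative to \<open>p^\<gamma>\<close> the neighbours contribute
  \<open>(1 +- 1/p)^\<gamma>\<close>. The terms \<open>+-\<gamma>/p\<close> cancel because
  \<open>c p\<close> and \<open>c (p - 1)\<close> have the same expansion up to the error; at order
  \<open>1/p^2\<close> the sum of \<open>\<gamma> (\<gamma> - 1) / 2\<close> and \<open>2 k\<close>
  is half of \<open>(\<gamma> - 1/2)^2 - \<alpha>^2\<close>.\<close>

lemma powr_defect:
  "(\<lambda>p. jac c (\<lambda>q. real q powr \<gamma>) p / real p powr \<gamma> - (1 + ((\<gamma> - 1/2)\<^sup>2 - \<alpha>\<^sup>2) / 2 / (real p)\<^sup>2))
     \<in> O(\<lambda>p. real p powr (- 2 - \<zeta>))"
proof -
  define k g where "k = (1 - 4 * \<alpha>\<^sup>2) / 16" and "g = \<gamma> * (\<gamma> - 1) / 2"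
  let ?u = "\<lambda>p. real p powr (- 2 - \<zeta>)"
  define A B where "A p = (1 + 1 / real p) powr \<gamma>" and "B p = (1 - 1 / real p) powr \<gamma>" for p :: nat
  define r s where "r p = A p - (1 + \<gamma> / real p + g / (real p)\<^sup>2)"
    and "s p = B p - (1 - \<gamma> / real p + g / (real p)\<^sup>2)" for p :: nat
  define e e' where "e p = c p - (1 / 2 + k / (real p)\<^sup>2)"
    and "e' p = c (p - 1) - (1 / 2 + k / (real p)\<^sup>2)" for p
  note le = powr_minus_3_bigo[OF \<zeta>(2)]
  have r: "r \<in> O(\<lambda>p. real p powr - 3)" unfolding r_def[abs_def] A_def g_def by real_asymp
  have s: "s \<in> O(\<lambda>p. real p powr - 3)" unfolding s_def[abs_def] B_def g_def by real_asymp
  have A: "A \<in> O(\<lambda>_. 1)" and B: "B \<in> O(\<lambda>_. 1)" unfolding A_def[abs_def] B_def[abs_def] by real_asymp+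
  have e: "e \<in> O(?u)" "e' \<in> O(?u)"
    using c_asymp c_pred_asymp by (simp_all add: e_def[abs_def] e'_def[abs_def] k_def)
  have k: "(\<lambda>p::nat. 1 / 2 + k / (real p)\<^sup>2) \<in> O(\<lambda>_. 1)" by real_asymp
  have "(\<lambda>p::nat. 2 * k * g / (real p)\<^sup>2 / (real p)\<^sup>2) \<in> O(\<lambda>p. real p powr - 3)" by real_asymp
  note t1 = landau_o.big_trans[OF this le]
  have "r \<in> O(?u)" "s \<in> O(?u)" using landau_o.big_trans[OF r le] landau_o.big_trans[OF s le] by auto
  hence "(\<lambda>p. r p + s p) \<in> O(?u)" by (rule sum_in_bigo)
  from landau_o.big.mult[OF k this]
  have t2: "(\<lambda>p. (1 / 2 + k / (real p)\<^sup>2) * (r p + s p)) \<in> O(?u)" by simp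
  have t3: "(\<lambda>p. e p * A p + e' p * B p) \<in> O(?u)"
    using landau_o.big.mult[OF e(1) A] landau_o.big.mult[OF e(2) B] by (intro sum_in_bigo) simp_all
  have "(\<lambda>p. 2 * k * g / (real p)\<^sup>2 / (real p)\<^sup>2 + (1 / 2 + k / (real p)\<^sup>2) * (r p + s p)
           + (e p * A p + e' p * B p)) \<in> O(?u)"
    by (intro sum_in_bigo t1 t2 t3)
  also have "?this \<longleftrightarrow> ?thesis"
  proof (rule landau_o.big.in_cong, rule eventually_mono[OF eventually_ge_at_top[of 2]])
    fix p :: nat assume "p \<ge> 2"
    then obtain q where q: "p = Suc q" "q \<ge> 1" by (cases p) auto
    have "real (Suc p) = real p * (1 + 1 / real p)" "real q = real p * (1 - 1 / real p)"
      using q by (simp_all add: field_simps)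
    hence "real (Suc p) powr \<gamma> = real p powr \<gamma> * A p" "real q powr \<gamma> = real p powr \<gamma> * B p"
      using q by (simp_all add: A_def B_def powr_mult[symmetric] del: of_nat_Suc)
    hence "jac c (\<lambda>q. real q powr \<gamma>) p / real p powr \<gamma> = c p * A p + c (p - 1) * B p"
      using q by (simp add: jac_def field_simps del: of_nat_Suc)
    also have "c p = 1 / 2 + k / (real p)\<^sup>2 + e p" by (simp add: e_def)
    also have "c (p - 1) = 1 / 2 + k / (real p)\<^sup>2 + e' p" by (simp add: e'_def)
    finally have *: "jac c (\<lambda>q. real q powr \<gamma>) p / real p powr \<gamma> =
      (1 / 2 + k / (real p)\<^sup>2) * (A p + B p) + (e p * A p + e' p * B p)"
      by (simp only: ring_distribs ac_simps)
    have "A p + B p = 2 + 2 * g / (real p)\<^sup>2 + (r p + s p)"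
      by (simp add: r_def s_def)
    moreover have "(\<gamma> - 1/2)\<^sup>2 - \<alpha>\<^sup>2 = 4 * k + 2 * g"
      by (simp add: k_def g_def power2_eq_square field_simps)
    ultimately show "2 * k * g / (real p)\<^sup>2 / (real p)\<^sup>2 + (1 / 2 + k / (real p)\<^sup>2) * (r p + s p)
           + (e p * A p + e' p * B p) = jac c (\<lambda>q. real q powr \<gamma>) p / real p powr \<gamma> -
           (1 + ((\<gamma> - 1/2)\<^sup>2 - \<alpha>\<^sup>2) / 2 / (real p)\<^sup>2)"
      unfolding * by (simp add: algebra_simps add_divide_distrib)
  qed
  finally show ?thesis .
qed

text \<open>Used in two ways: \<open>\<delta> = 0\<close> identifies the sign of the defect of a
  general power, while \<open>\<delta> = \<zeta>/2\<close> with \<open>a = 0\<close> shows that the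
  defect of the critical power \<open>p^(1/2 - \<alpha>)\<close> is smaller than that of the
  correction term in the barriers.\<close>

lemma powr_defect_limit:
  assumes "\<delta> < \<zeta>" and a: "a = ((\<gamma> - 1/2)\<^sup>2 - \<alpha>\<^sup>2) / 2"
  shows "(\<lambda>p. (jac c (\<lambda>q. real q powr \<gamma>) p - real p powr \<gamma>) * real p powr (2 + \<delta> - \<gamma>) - a * real p powr \<delta>) \<longlonglongrightarrow> 0"
proof -
  let ?d = "\<lambda>p. jac c (\<lambda>q. real q powr \<gamma>) p / real p powr \<gamma> - (1 + a / (real p)\<^sup>2)"
  have "(\<lambda>p. real p powr (2 + \<delta>) * ?d p) \<in> O(\<lambda>p. real p powr (2 + \<delta>) * real p powr (- 2 - \<zeta>))"
    unfolding a by (intro landau_o.big.mult powr_defect) simp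
  also have "(\<lambda>p. real p powr (2 + \<delta>) * real p powr (- 2 - \<zeta>)) = (\<lambda>p. real p powr (\<delta> - \<zeta>))"
    by (simp add: powr_add[symmetric])
  also have "(\<lambda>p. real p powr (\<delta> - \<zeta>)) \<in> o(\<lambda>_. 1)"
    by (rule smalloI_tendsto)
      (use assms(1) tendsto_neg_powr[OF _ filterlim_real_sequentially] in auto)
  finally have "(\<lambda>p. real p powr (2 + \<delta>) * ?d p) \<longlonglongrightarrow> 0" by (auto dest: smalloD_tendsto)
  thus ?thesis
  proof (rule Lim_transform_eventually, intro eventually_mono[OF eventually_gt_at_top[of 0]])
    fix p :: nat assume "p > 0"
    have "n * t * (y / g - (1 + a / n)) = (y - g) * (n * t / g) - a * t" if "n > 0" "g > 0" for n t y g :: real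
      using that by (simp add: field_simps)
    from this[of "(real p)\<^sup>2" "real p powr \<gamma>" "real p powr \<delta>"] \<open>p > 0\<close>
    show "real p powr (2 + \<delta>) * ?d p
        = (jac c (\<lambda>q. real q powr \<gamma>) p - real p powr \<gamma>) * real p powr (2 + \<delta> - \<gamma>) - a * real p powr \<delta>"
      by (simp add: powr_diff powr_add)
  qed
qed

section \<open>Barriers and comparison for the critical Green function\<close>

definition super :: "nat \<Rightarrow> real" where
  "super p = real p powr (1/2 - \<alpha>) - real p powr (1/2 - \<alpha> - \<zeta>/2)"

definition sub :: "nat \<Rightarrow> real" where
  "sub p = real p powr (1/2 - \<alpha>) + real p powr (1/2 - \<alpha> - \<zeta>/2)"

text \<open>The correction exponent \<open>\<gamma> = 1/2 - \<alpha> - \<zeta>/2\<close> has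
  \<open>(\<gamma> - 1/2)^2 > \<alpha>^2\<close>, hence a strictly positive defect of order
  \<open>p^(\<gamma> - 2)\<close>. The unknown defect of the leading power is of smaller order, so
  the sign of the correction decides. The exponent \<open>1/2\<close> minimises
  \<open>(\<gamma> - 1/2)^2 - \<alpha>^2\<close>, with negative value, which makes the square root a
  strict supersolution.\<close>

lemma barriers:
  "\<forall>\<^sub>F p in sequentially. super p > 0 \<and> sub p > 0 \<and> R super p \<le> super p \<and> R sub p \<ge> sub p
     \<and> R (\<lambda>q. real q powr (1/2)) p < real p powr (1/2)"
proof -
  define \<gamma> where "\<gamma> = 1/2 - \<alpha> - \<zeta>/2"
  define a where "a = ((\<gamma> - 1/2)\<^sup>2 - \<alpha>\<^sup>2) / 2"
  define X where "X p = (jac c (\<lambda>q. real q powr (1/2 - \<alpha>)) p - real p powr (1/2 - \<alpha>)) * real p powr (2 - \<gamma>)" for p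
  define Y where "Y p = (jac c (\<lambda>q. real q powr \<gamma>) p - real p powr \<gamma>) * real p powr (2 - \<gamma>)" for p
  define H where "H p = (jac c (\<lambda>q. real q powr (1/2)) p - real p powr (1/2)) * real p powr (2 - 1/2)" for p
  \<comment> \<open>Since \<open>2 - \<gamma> = 2 + \<zeta>/2 - (1/2 - \<alpha>)\<close>, the weight
    that gives \<open>Y\<close> a finite limit is the refined weight for the leading power.\<close>
  have "(\<lambda>p. X p - 0 * real p powr (\<zeta>/2)) \<longlonglongrightarrow> 0"
    using powr_defect_limit[of "\<zeta>/2" 0 "1/2 - \<alpha>"] \<zeta> by (simp add: X_def \<gamma>_def algebra_simps)
  hence X: "X \<longlonglongrightarrow> 0" by simp
  have lim: "(\<lambda>p. (jac c (\<lambda>q. real q powr g) p - real p powr g) * real p powr (2 - g)) \<longlonglongrightarrow> l"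
    if "l = ((g - 1/2)\<^sup>2 - \<alpha>\<^sup>2) / 2" for g l
  proof -
    have "\<forall>\<^sub>F p in sequentially. l * real p powr 0 = l"
      by (rule eventually_mono[OF eventually_gt_at_top[of 0]]) simp
    hence "(\<lambda>p. l * real p powr 0) \<longlonglongrightarrow> l" by (rule tendsto_eventually)
    from tendsto_add[OF powr_defect_limit[OF \<zeta>(1) that] this] show ?thesis by simp
  qed
  have Y: "Y \<longlonglongrightarrow> a" unfolding Y_def by (rule lim) (simp add: a_def)
  have H: "H \<longlonglongrightarrow> - \<alpha>\<^sup>2 / 2" unfolding H_def by (rule lim) simp
  have "a = (\<zeta>\<^sup>2 / 4 + \<alpha> * \<zeta>) / 2"
    by (simp add: a_def \<gamma>_def power2_eq_square field_simps)
  moreover have "\<zeta>\<^sup>2 / 4 + \<alpha> * \<zeta> > 0" using \<alpha> \<zeta> by (intro add_pos_pos) auto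
  ultimately have a: "a > 0" by simp
  have "(\<lambda>p. X p - Y p) \<longlonglongrightarrow> 0 - a" "(\<lambda>p. X p + Y p) \<longlonglongrightarrow> 0 + a" by (intro tendsto_intros X Y)+
  hence "\<forall>\<^sub>F p in sequentially. X p - Y p < 0" "\<forall>\<^sub>F p in sequentially. X p + Y p > 0"
    using a order_tendstoD(2)[of "\<lambda>p. X p - Y p" "0 - a" sequentially 0]
      order_tendstoD(1)[of "\<lambda>p. X p + Y p" "0 + a" sequentially 0] by simp_all
  moreover have "\<forall>\<^sub>F p in sequentially. H p < 0"
    using H \<alpha> by (auto dest: order_tendstoD(2)[of _ _ _ 0])
  ultimately show ?thesis using eventually_gt_at_top[of 1]
  proof eventually_elim
    case (elim p)
    hence p: "real p > 1" by simp
    have sgn: "u * real p powr s < 0 \<longleftrightarrow> u < 0" "u * real p powr s > 0 \<longleftrightarrow> u > 0" for u s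
      using p by (simp_all add: mult_less_0_iff zero_less_mult_iff)
    have "X p - Y p = (R super p - super p) * real p powr (2 - \<gamma>)"
      by (simp add: X_def Y_def super_def[abs_def] \<gamma>_def jac_diff algebra_simps)
    moreover have "X p + Y p = (R sub p - sub p) * real p powr (2 - \<gamma>)"
      by (simp add: X_def Y_def sub_def[abs_def] \<gamma>_def jac_add algebra_simps)
    moreover have "super p > 0"
      using \<zeta> p by (simp add: super_def powr_less_mono)
    moreover have "sub p > 0" using p by (simp add: sub_def add_pos_pos)
    ultimately show ?case using elim by (simp add: sgn H_def)
  qed
qed

lemma super_asymp: "(\<lambda>p. super p / real p powr (1/2 - \<alpha>)) \<longlonglongrightarrow> 1"
  and sub_asymp: "(\<lambda>p. sub p / real p powr (1/2 - \<alpha>)) \<longlonglongrightarrow> 1"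
proof -
  have "(\<lambda>p::nat. real p powr (- (\<zeta>/2))) \<longlonglongrightarrow> 0"
    using tendsto_neg_powr[OF _ filterlim_real_sequentially] \<zeta> by simp
  hence *: "(\<lambda>p. 1 - real p powr (- (\<zeta>/2))) \<longlonglongrightarrow> 1 - 0" "(\<lambda>p. 1 + real p powr (- (\<zeta>/2))) \<longlonglongrightarrow> 1 + 0"
    by (intro tendsto_intros; assumption)+
  have e: "real p powr (1/2 - \<alpha> - \<zeta>/2) = real p powr (1/2 - \<alpha>) * real p powr (- (\<zeta>/2))" for p
    by (simp add: powr_add[symmetric])
  show "(\<lambda>p. super p / real p powr (1/2 - \<alpha>)) \<longlonglongrightarrow> 1"
    by (rule Lim_transform_eventually[OF *(1)[simplified]], rule eventually_mono[OF eventually_gt_at_top[of 0]])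
      (simp add: super_def e diff_divide_distrib)
  show "(\<lambda>p. sub p / real p powr (1/2 - \<alpha>)) \<longlonglongrightarrow> 1"
    by (rule Lim_transform_eventually[OF *(2)[simplified]], rule eventually_mono[OF eventually_gt_at_top[of 0]])
      (simp add: sub_def e add_divide_distrib)
qed

abbreviation h where "h \<equiv> green 1"

lemma h_pos: "p \<ge> 1 \<Longrightarrow> h p > 0" and h_0: "h 0 = 0" and h_eq: "R h p = h p - unit_vec 1 p"
  using green_pos green_at_0 green_eq[of 1] by simp_all

text \<open>Gluing: beyond \<open>Q\<close>, replacing \<open>h\<close> by the minimum of
  \<open>h\<close> and \<open>A * super\<close> keeps a supersolution of the equation with source.
  As \<open>h\<close> is the least one, it lies below \<open>A * super\<close> there.\<close>

lemma h_super_antimono: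
  assumes Q: "Q \<ge> 1" and S: "\<And>p. p \<ge> Q \<Longrightarrow> super p > 0 \<and> R super p \<le> super p" and "p \<ge> Q"
  shows "h p / super p \<le> h Q / super Q"
proof -
  define A where "A = h Q / super Q"
  have A: "A > 0" "A * super Q = h Q" using h_pos[OF Q] S[of Q] by (simp_all add: A_def)
  define v where "v q = (if q \<le> Q then h q else min (h q) (A * super q))" for q
  have v_h: "v q \<le> h q" for q by (simp add: v_def)
  \<comment> \<open>The bound must include \<open>Q\<close> itself, because the site
    \<open>Q + 1\<close> looks back at its neighbour \<open>Q\<close>, where \<open>v\<close> is
    \<open>h\<close>; the choice of \<open>A\<close> makes the two functions meet at that
    point.\<close>
  have v_s: "v q \<le> A * super q" if "q \<ge> Q" for q using that A by (auto simp: v_def)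
  have "h p \<le> v p"
  proof (rule green_le_supersolution)
    fix q :: nat assume "q \<ge> 1"
    show "v q \<ge> 0" using h_pos[OF \<open>q \<ge> 1\<close>] A S[of q] by (auto simp: v_def)
    have 1: "R v q + unit_vec 1 q \<le> h q"
      using R_mono[of v h q] v_h h_eq[of q] by simp
    show "1 * (R v q + unit_vec 1 q) \<le> v q"
    proof (cases "q \<le> Q")
      case False
      then obtain r where r: "q = Suc r" "r \<ge> Q" by (cases q) auto
      have "R v q \<le> R (\<lambda>q. A * super q) q"
        by (rule jac_mono_at) (use v_s r in \<open>auto simp: c_nonneg\<close>)
      also have "\<dots> = A * R super q" by (simp add: jac_scale)
      also have "\<dots> \<le> A * super q" using A S[of q] False by (simp add: mult_left_mono)
      finally show ?thesis using 1 False Q by (simp add: v_def unit_vec_def)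
    qed (use 1 in \<open>simp add: v_def\<close>)
  qed (use assms in auto)
  also have "v p \<le> A * super p" using v_s assms by simp
  finally show ?thesis using S[OF \<open>p \<ge> Q\<close>] by (simp add: A_def field_simps)
qed

text \<open>Maximum principle: \<open>sub - A h\<close> grows slower than the strict supersolution \<open>p \<mapsto> \<surd>p\<close>.\<close>

lemma h_sub_lower:
  assumes Q: "Q \<ge> 1" and S: "\<And>p. p \<ge> Q \<Longrightarrow> sub p > 0 \<and> R sub p \<ge> sub p \<and> R (\<lambda>q. real q powr (1/2)) p < real p powr (1/2)"
    and "p \<ge> Q"
  shows "h Q * sub p \<le> sub Q * h p"
proof (rule ccontr)
  assume neg: "\<not> ?thesis"
  define d where "d p = h Q * sub p - sub Q * h p" for p
  define r where "r p = d p / real p powr (1/2)" for p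
  have hQ: "h Q > 0" using h_pos Q by simp
  have dp: "d p > 0" using neg by (simp add: d_def)
  have rp: "r p > 0" using dp \<open>p \<ge> Q\<close> Q by (simp add: r_def)
  \<comment> \<open>\<open>sub\<close> divided by the square root is of order
    \<open>p^(-\<alpha>)\<close> and tends to 0, so a positive value of \<open>r\<close> forces its
    supremum over \<open>p \<ge> Q\<close> to be attained in a finite window.\<close>
  have "(\<lambda>p. sub p / real p powr (1/2 - \<alpha>) * (h Q * real p powr (- \<alpha>))) \<longlonglongrightarrow> 1 * (h Q * 0)"
    using \<alpha> by (intro tendsto_intros sub_asymp tendsto_neg_powr[OF _ filterlim_real_sequentially]) auto
  hence "\<forall>\<^sub>F n in sequentially. sub n / real n powr (1/2 - \<alpha>) * (h Q * real n powr (- \<alpha>)) < r p"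
    using rp by (auto dest: order_tendstoD(2))
  then obtain N where N: "\<And>n. n \<ge> N \<Longrightarrow> sub n / real n powr (1/2 - \<alpha>) * (h Q * real n powr (- \<alpha>)) < r p"
    by (auto simp: eventually_at_top_linorder)
  have r_far: "r n < r p" if "n \<ge> N" "n \<ge> Q" for n
  proof -
    have n: "real n > 0" using that Q by simp
    have "r n \<le> h Q * sub n / real n powr (1/2)"
      using h_pos[of n] S[of Q] that Q n by (auto simp: r_def d_def intro!: divide_right_mono)
    also have "\<dots> = sub n / real n powr (1/2 - \<alpha>) * (h Q * real n powr (- \<alpha>))"
      using n powr_add[of "real n" "1/2 - \<alpha>" \<alpha>] by (simp add: powr_minus divide_simps)
    finally show ?thesis using N[OF that(1)] by simp
  qed
  define M where "M = Max (r ` {Q..max N p})"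
  have fin: "finite (r ` {Q..max N p})" "r ` {Q..max N p} \<noteq> {}" using \<open>p \<ge> Q\<close> by auto
  obtain q where q: "q \<ge> Q" "r q = M" using Max_in[OF fin] by (auto simp: M_def)
  have rpM: "r p \<le> M" unfolding M_def using fin \<open>p \<ge> Q\<close> by (intro Max_ge) auto
  have rM: "r n \<le> M" if "n \<ge> Q" for n
  proof (cases "n \<le> max N p")
    case True
    thus ?thesis unfolding M_def using fin that by (intro Max_ge) auto
  next
    case False
    thus ?thesis using r_far[of n] that rpM by linarith
  qed
  have M: "M > 0" using rp rpM by simp
  have dM: "d n \<le> M * real n powr (1/2)" if "n \<ge> Q" for n
    using rM[OF that] that Q by (simp add: r_def divide_le_eq)
  have dq: "d q = M * real q powr (1/2)" using q Q by (simp add: r_def field_simps)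
  \<comment> \<open>\<open>d\<close> vanishes at \<open>Q\<close>, so both neighbours of the
    maximiser lie in the region where \<open>d\<close> is below \<open>M\<close> times the square
    root.\<close>
  have "q \<noteq> Q"
  proof
    assume "q = Q"
    hence "d q = 0" by (simp add: d_def)
    thus False using dq M q Q by simp
  qed
  then obtain q' where q': "q = Suc q'" "q' \<ge> Q" using q by (cases q) auto
  have "R d q = h Q * R sub q - sub Q * R h q"
    by (simp add: d_def[abs_def] jac_diff jac_scale)
  moreover have "R h q = h q" using q' Q by (simp add: h_eq unit_vec_def)
  moreover have "h Q * sub q \<le> h Q * R sub q" using S[of q] q hQ by simp
  ultimately have "d q \<le> R d q" by (simp add: d_def)
  also have "\<dots> \<le> R (\<lambda>q. M * real q powr (1/2)) q"
    by (rule jac_mono_at) (use dM q' in \<open>auto simp: c_nonneg simp del: of_nat_Suc\<close>)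
  also have "\<dots> = M * R (\<lambda>q. real q powr (1/2)) q" by (simp add: jac_scale)
  also have "\<dots> < M * real q powr (1/2)" using S[of q] q M by simp
  finally show False using dq by simp
qed

text \<open>The upper barrier gives the existence of the limit, since \<open>h / super\<close> is
  decreasing; the lower barrier excludes the limit 0.\<close>

theorem h_asymp: "\<exists>\<kappa>>0. (\<lambda>p. h p / real p powr (1/2 - \<alpha>)) \<longlonglongrightarrow> \<kappa>"
proof -
  obtain P0 where P0: "\<And>p. p \<ge> P0 \<Longrightarrow> super p > 0 \<and> sub p > 0 \<and> R super p \<le> super p \<and> R sub p \<ge> sub p
     \<and> R (\<lambda>q. real q powr (1/2)) p < real p powr (1/2)"
    using barriers by (auto simp: eventually_at_top_linorder)
  define P where "P = max 1 P0"
  have P: "P \<ge> 1" "\<And>p. p \<ge> P \<Longrightarrow> super p > 0 \<and> sub p > 0 \<and> R super p \<le> super p \<and> R sub p \<ge> sub p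
     \<and> R (\<lambda>q. real q powr (1/2)) p < real p powr (1/2)"
    using P0 by (simp_all add: P_def)
  have dec: "decseq (\<lambda>n. h (n + P) / super (n + P))"
    by (rule decseq_SucI, rule h_super_antimono) (use P in auto)
  have nn: "h (n + P) / super (n + P) \<ge> 0" for n
    using h_pos[of "n + P"] P(1) P(2)[of "n + P"] by simp
  obtain L where L: "(\<lambda>n. h (n + P) / super (n + P)) \<longlonglongrightarrow> L"
    using decseq_convergent[OF dec, of 0] nn by blast
  hence "(\<lambda>n. h n / super n) \<longlonglongrightarrow> L" by (rule LIMSEQ_offset)
  hence "(\<lambda>n. h n / super n * (super n / real n powr (1/2 - \<alpha>))) \<longlonglongrightarrow> L * 1"
    by (intro tendsto_mult super_asymp)
  moreover have "\<forall>\<^sub>F n in sequentially. h n / super n * (super n / real n powr (1/2 - \<alpha>)) = h n / real n powr (1/2 - \<alpha>)"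
    by (rule eventually_mono[OF eventually_ge_at_top[of P]]) (use P(2) in force)
  ultimately have lim: "(\<lambda>n. h n / real n powr (1/2 - \<alpha>)) \<longlonglongrightarrow> L"
    by (simp only: mult_1_right) (rule Lim_transform_eventually)
  have "h P / sub P * 1 \<le> L"
  proof (rule tendsto_le[OF _ lim])
    show "(\<lambda>n. h P / sub P * (sub n / real n powr (1/2 - \<alpha>))) \<longlonglongrightarrow> h P / sub P * 1"
      by (intro tendsto_intros sub_asymp)
    show "\<forall>\<^sub>F n in sequentially. h P / sub P * (sub n / real n powr (1/2 - \<alpha>)) \<le> h n / real n powr (1/2 - \<alpha>)"
    proof (rule eventually_mono[OF eventually_ge_at_top[of P]])
      fix n assume "n \<ge> P"
      from h_sub_lower[OF P(1) _ this] P(2) have "h P * sub n \<le> sub P * h n" by blast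
      hence "h P / sub P * sub n \<le> h n" using P(2)[of P] by (simp add: field_simps)
      thus "h P / sub P * (sub n / real n powr (1/2 - \<alpha>)) \<le> h n / real n powr (1/2 - \<alpha>)"
        using divide_right_mono[of _ _ "real n powr (1/2 - \<alpha>)"] by fastforce
    qed
  qed auto
  moreover have "h P / sub P > 0" using h_pos[OF P(1)] P(2)[of P] by simp
  ultimately show ?thesis using lim by (intro exI[of _ L]) auto
qed

end

section \<open>Scaling of the energy on a network with power-law coefficients\<close>

lemma sum_powr_le:
  fixes s :: real
  assumes "s > - 1"
  shows "\<exists>M>0. \<forall>n. (\<Sum>p=1..n. real p powr s) \<le> M * real n powr (s + 1)"
proof (cases "s \<ge> 0")
  case True
  have "(\<Sum>p=1..n. real p powr s) \<le> 1 * real n powr (s + 1)" for n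
  proof -
    have "(\<Sum>p=1..n. real p powr s) \<le> (\<Sum>p=1..n. real n powr s)"
      by (intro sum_mono powr_mono2) (use True in auto)
    also have "\<dots> = real n powr (s + 1)" by (cases "n = 0") (simp_all add: powr_add)
    finally show ?thesis by simp
  qed
  thus ?thesis by (intro exI[of _ 1]) auto
next
  case False
  have step: "(s + 1) * real p powr s \<le> real p powr (s + 1) - real (p - 1) powr (s + 1)" if "p \<ge> 1" for p
  proof (cases "p = 1")
    case False
    hence lt: "real (p - 1) < real p" and p0: "real (p - 1) > 0" using that by auto
    have "\<exists>z>real (p - 1). z < real p \<and>
      real p powr (s + 1) - real (p - 1) powr (s + 1) = (real p - real (p - 1)) * ((s + 1) * z powr s)"
      by (rule MVT2[OF lt]) (use p0 in \<open>auto intro!: derivative_eq_intros\<close>)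
    then obtain z where z: "z > real (p - 1)" "z < real p"
      "real p powr (s + 1) - real (p - 1) powr (s + 1) = (real p - real (p - 1)) * ((s + 1) * z powr s)"
      by blast
    have "real p - real (p - 1) = 1" using that by (simp add: of_nat_diff)
    have "real p powr s \<le> z powr s" using z \<open>\<not> s \<ge> 0\<close> p0 by (intro powr_mono2') auto
    thus ?thesis unfolding z(3) \<open>real p - real (p - 1) = 1\<close> using assms by (simp add: mult_left_mono)
  qed (use \<open>\<not> s \<ge> 0\<close> in simp)
  have "(s + 1) * (\<Sum>p=1..n. real p powr s) \<le> real n powr (s + 1)" for n
  proof (induction n)
    case (Suc n)
    thus ?case using step[of "Suc n"] by (simp add: distrib_left del: of_nat_Suc)
  qed simp
  thus ?thesis using assms by (intro exI[of _ "1 / (s + 1)"]) (auto simp: field_simps)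
qed

text \<open>Cauchy--Schwarz for the constant products \<open>p^(s/2) * p^(-s/2) = 1\<close> turns
  the upper bound for the exponent \<open>-s\<close> into the lower bound for
  \<open>s\<close>.\<close>

lemma sum_powr_ge:
  fixes s :: real
  assumes "- 1 < s" "s < 1"
  shows "\<exists>k>0. \<forall>n\<ge>1. k * real n powr (s + 1) \<le> (\<Sum>p=1..n. real p powr s)"
proof -
  obtain M where M: "M > 0" "\<And>n. (\<Sum>p=1..n. real p powr (- s)) \<le> M * real n powr (1 - s)"
    using sum_powr_le[of "- s"] assms by auto
  have "1 / M * real n powr (s + 1) \<le> (\<Sum>p=1..n. real p powr s)" if "n \<ge> 1" for n
  proof -
    have "real n * real n = (\<Sum>p=1..n. real p powr (s/2) * real p powr (- s/2))\<^sup>2"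
      by (simp add: powr_add[symmetric] power2_eq_square)
    also have "\<dots> \<le> (\<Sum>p=1..n. (real p powr (s/2))\<^sup>2) * (\<Sum>p=1..n. (real p powr (- s/2))\<^sup>2)"
      by (rule Cauchy_Schwarz_ineq_sum)
    also have "\<dots> = (\<Sum>p=1..n. real p powr s) * (\<Sum>p=1..n. real p powr (- s))"
      by (simp add: power2_eq_square powr_add[symmetric])
    also have "\<dots> \<le> (\<Sum>p=1..n. real p powr s) * (M * real n powr (1 - s))"
      by (intro mult_left_mono M sum_nonneg) auto
    finally have "real n * real n / real n powr (1 - s) \<le> M * (\<Sum>p=1..n. real p powr s)"
      using that by (simp add: field_simps)
    moreover have "real n * real n = real n powr (s + 1) * real n powr (1 - s)"
      using powr_add[of "real n" "s + 1" "1 - s"] that by (simp add: power2_eq_square)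
    hence "real n * real n / real n powr (1 - s) = real n powr (s + 1)"
      using that by simp
    ultimately show ?thesis using M by (simp add: field_simps)
  qed
  thus ?thesis using M(1) by (intro exI[of _ "1 / M"]) auto
qed

lemma powr_asymp_bounds:
  fixes f :: "nat \<Rightarrow> real"
  assumes "\<And>p. p \<ge> 1 \<Longrightarrow> f p > 0" "A > 0" "(\<lambda>p. f p / real p powr s) \<longlonglongrightarrow> A"
  shows "\<exists>M>0. \<forall>p\<ge>1. f p \<le> M * real p powr s \<and> real p powr s \<le> M * f p"
proof -
  have "(\<lambda>p. inverse (f p / real p powr s)) \<longlonglongrightarrow> inverse A"
    using assms by (intro tendsto_inverse) auto
  from convergent_imp_Bseq[OF convergentI[OF this]] obtain M2
    where M2: "M2 > 0" "\<And>p. \<bar>inverse (f p / real p powr s)\<bar> \<le> M2" by (auto simp: Bseq_def)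
  from convergent_imp_Bseq[OF convergentI[OF assms(3)]] obtain M1
    where M1: "M1 > 0" "\<And>p. \<bar>f p / real p powr s\<bar> \<le> M1" by (auto simp: Bseq_def)
  have "f p \<le> max M1 M2 * real p powr s \<and> real p powr s \<le> max M1 M2 * f p" if "p \<ge> 1" for p
  proof -
    have p: "real p powr s > 0" "f p > 0" using that assms(1) by auto
    have "f p \<le> M1 * real p powr s" "real p powr s \<le> M2 * f p"
      using M1(2)[of p] M2(2)[of p] p by (simp_all add: field_simps)
    thus ?thesis using p
      by (meson max.cobounded1 max.cobounded2 mult_right_mono order.trans less_imp_le)
  qed
  thus ?thesis using M1(1) by (intro exI[of _ "max M1 M2"]) auto
qed

text \<open>The threshold \<open>K\<close> depends on \<eta> alone: the estimate is uniform in the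
  factor \<open>l\<close> and in the position \<open>r\<close> inside the dilated cell. Since
  \<open>s \<le> 1\<close>, moving inside a cell costs at most the factor
  \<open>1 + 1/k\<close>.\<close>

lemma powr_asymp_dilation:
  fixes f :: "nat \<Rightarrow> real"
  assumes f: "\<And>p. p \<ge> 1 \<Longrightarrow> f p > 0" "A > 0" "(\<lambda>p. f p / real p powr s) \<longlonglongrightarrow> A"
    and s: "s \<le> 1" and \<eta>: "0 < \<eta>" "\<eta> \<le> 1"
  shows "\<exists>K\<ge>1. \<forall>k\<ge>K. \<forall>l\<ge>1. \<forall>r<l. f (l * k + r) \<le> (1 + \<eta>) * real l powr s * f k"
proof -
  \<comment> \<open>This choice gives
    \<open>(1 + \<delta>)^2 \<le> (1 + \<eta>) (1 - \<delta>)\<close>: one factor for the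
    asymptotics at the image, one for the position in the cell, and \<open>1 - \<delta>\<close> for
    the asymptotics at \<open>k\<close>.\<close>
  define \<delta> where "\<delta> = \<eta> / 8"
  have \<delta>: "0 < \<delta>" "\<delta> < 1" using \<eta> by (simp_all add: \<delta>_def)
  have "\<eta> * \<eta> \<le> \<eta> * 1" using \<eta> by (intro mult_left_mono) auto
  hence \<delta>2: "(1 + \<delta>) * (1 + \<delta>) \<le> (1 + \<eta>) * (1 - \<delta>)"
    using \<eta> by (simp add: \<delta>_def field_simps)
  have "A * (1 - \<delta>) < A" "A < A * (1 + \<delta>)" using f(2) \<delta> by (auto simp: algebra_simps)
  with f(3) have "\<forall>\<^sub>F p in sequentially. A * (1 - \<delta>) < f p / real p powr s \<and> f p / real p powr s < A * (1 + \<delta>)"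
    by (intro eventually_conj order_tendstoD)
  then obtain K0 where K0: "\<And>p. p \<ge> K0 \<Longrightarrow> A * (1 - \<delta>) < f p / real p powr s \<and> f p / real p powr s < A * (1 + \<delta>)"
    by (auto simp: eventually_at_top_linorder)
  have upper: "f n \<le> A * (1 + \<delta>) * real n powr s" if "n \<ge> K0" "n \<ge> 1" for n
    using K0[OF that(1)] that(2) by (simp add: divide_less_eq less_imp_le)
  define K where "K = max K0 (nat \<lceil>1 / \<delta>\<rceil> + 1)"
  have "f (l * k + r) \<le> (1 + \<eta>) * real l powr s * f k" if "k \<ge> K" "l \<ge> 1" "r < l" for k l r
  proof -
    have "real k \<ge> 1 / \<delta>" using that(1) unfolding K_def by linarith
    have k: "k \<ge> K0" "k \<ge> 1" "1 / real k \<le> \<delta>"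
      using that(1) \<open>real k \<ge> 1 / \<delta>\<close> \<delta> by (auto simp: K_def field_simps)
    have q: "l * k + r \<ge> k" using that k by (simp add: trans_le_add1)
    define \<tau> where "\<tau> = real (l * k + r) / (real l * real k)"
    have lk: "real l > 0" "real k > 0" using that k by auto
    have \<tau>: "\<tau> \<ge> 1" "\<tau> \<le> 1 + \<delta>"
    proof -
      show "\<tau> \<ge> 1" using lk by (simp add: \<tau>_def field_simps)
      have "real r * 1 \<le> real l * 1" using that by simp
      hence "\<tau> \<le> 1 + 1 / real k" using lk by (simp add: \<tau>_def field_simps)
      thus "\<tau> \<le> 1 + \<delta>" using k by simp
    qed
    have "\<tau> powr s \<le> \<tau> powr 1" using \<tau> s by (intro powr_mono) auto
    hence \<tau>s: "\<tau> powr s \<le> 1 + \<delta>" using \<tau> by simp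
    have e: "real (l * k + r) = real l * real k * \<tau>" using lk by (simp add: \<tau>_def)
    have "f (l * k + r) \<le> A * (1 + \<delta>) * real (l * k + r) powr s"
      using upper[of "l * k + r"] k q by simp
    also have "real (l * k + r) powr s = real l powr s * real k powr s * \<tau> powr s"
      unfolding e using lk \<tau> by (simp add: powr_mult)
    also have "A * (1 + \<delta>) * (real l powr s * real k powr s * \<tau> powr s)
        \<le> A * (1 + \<delta>) * (real l powr s * real k powr s * (1 + \<delta>))"
      using \<tau>s f(2) \<delta> by (intro mult_left_mono) auto
    also have "\<dots> = (A * (real l powr s * real k powr s)) * ((1 + \<delta>) * (1 + \<delta>))" by (simp add: mult_ac)
    also have "\<dots> \<le> (A * (real l powr s * real k powr s)) * ((1 + \<eta>) * (1 - \<delta>))"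
      using \<delta>2 f(2) by (intro mult_left_mono) auto
    also have "\<dots> = (1 + \<eta>) * real l powr s * (A * (1 - \<delta>) * real k powr s)" by (simp add: mult_ac)
    also have "\<dots> \<le> (1 + \<eta>) * real l powr s * f k"
    proof (rule mult_left_mono)
      show "A * (1 - \<delta>) * real k powr s \<le> f k"
        using K0[OF k(1)] lk by (simp add: less_divide_eq split: if_splits)
    qed (use \<eta> in auto)
    finally show ?thesis .
  qed
  thus ?thesis by (intro exI[of _ K]) (auto simp: K_def)
qed

text \<open>Crude substitute in the finitely many cells \<open>k < K\<close> where the asymptotics
  is not yet sharp: the right growth in \<open>l\<close>, with a constant that may be large.\<close>

lemma powr_bound_dilation:
  fixes f :: "nat \<Rightarrow> real"
  assumes "\<And>p. p \<ge> 1 \<Longrightarrow> f p \<le> M * real p powr s" "M > 0" "s \<le> 1"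
    and "1 \<le> k" "k < K" "r < l"
  shows "f (l * k + r) \<le> M * real K * real l powr s"
proof -
  define \<tau> where "\<tau> = real (l * k + r) / real l"
  have l: "real l > 0" using assms by simp
  have "l \<le> l * k" using assms by (cases k) auto
  hence "l \<le> l * k + r" by (rule trans_le_add1)
  moreover have "l * Suc k \<le> l * K" using assms by (intro mult_left_mono) auto
  hence "l * k + r \<le> l * K" using assms(6) by simp
  ultimately
have "real l \<le> real (l * k + r)" "real (l * k + r) \<le> real l * real K"
    by (simp_all only: of_nat_le_iff of_nat_mult[symmetric])
  hence \<tau>: "\<tau> \<ge> 1" "\<tau> \<le> real K" using l by (simp_all add: \<tau>_def field_simps)
  have "\<tau> powr s \<le> \<tau> powr 1" using \<tau> assms by (intro powr_mono) auto
  hence \<tau>s: "\<tau> powr s \<le> real K" using \<tau> by simp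
  have "f (l * k + r) \<le> M * real (l * k + r) powr s" using \<open>l \<le> l * k + r\<close> l by (intro assms) auto
  also have "real (l * k + r) = real l * \<tau>" using l by (simp add: \<tau>_def)
  also have "M * (real l * \<tau>) powr s = M * real l powr s * \<tau> powr s" using l \<tau> by (simp add: powr_mult)
  also have "\<dots> \<le> M * real l powr s * real K" using \<tau>s assms by (intro mult_left_mono) auto
  finally show ?thesis by (simp add: mult_ac)
qed

text \<open>Limsup in \<open>t\<close> at fixed \<mu>, then liminf in \<mu>, bounds the limsup by
  \<open>1 + \<eta>\<close> times the liminf for every \<eta>. The inequality at a single \<mu>
  makes the limsup finite, and the lower bound \<open>k\<close> keeps the limit positive.\<close>

lemma almost_monotone_tendsto:
  fixes q :: "real \<Rightarrow> real"
  assumes k: "k > 0" "\<forall>\<^sub>F t in at_right 0. k \<le> q t"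
    and q: "\<And>\<eta>. 0 < \<eta> \<Longrightarrow> \<eta> \<le> 1 \<Longrightarrow>
      \<exists>\<delta>>0. \<forall>\<mu>. 0 < \<mu> \<longrightarrow> \<mu> < \<delta> \<longrightarrow> (\<forall>\<^sub>F t in at_right 0. q t \<le> (1 + \<eta>) * q \<mu>)"
  shows "\<exists>\<kappa>>0. (q \<longlongrightarrow> \<kappa>) (at_right 0)"
proof -
  define U L where "U = Limsup (at_right 0) (\<lambda>t. ereal (q t))" and "L = Liminf (at_right 0) (\<lambda>t. ereal (q t))"
  have kL: "ereal k \<le> L" unfolding L_def by (rule Liminf_bounded) (use k in \<open>auto elim: eventually_mono\<close>)
  have LU: "L \<le> U" unfolding L_def U_def by (rule Liminf_le_Limsup) simp
  have UL: "\<exists>\<delta>>0. \<forall>\<mu>. 0 < \<mu> \<longrightarrow> \<mu> < \<delta> \<longrightarrow> U \<le> ereal ((1 + \<eta>) * q \<mu>)" if \<eta>: "0 < \<eta>" "\<eta> \<le> 1" for \<eta>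
  proof -
    obtain \<delta> where \<delta>: "\<delta> > 0" "\<And>\<mu>. 0 < \<mu> \<Longrightarrow> \<mu> < \<delta> \<Longrightarrow> \<forall>\<^sub>F t in at_right 0. q t \<le> (1 + \<eta>) * q \<mu>"
      using q[OF \<eta>] by blast
    have "U \<le> ereal ((1 + \<eta>) * q \<mu>)" if "0 < \<mu>" "\<mu> < \<delta>" for \<mu>
      unfolding U_def by (rule Limsup_bounded) (use \<delta>(2)[OF that] in \<open>auto elim: eventually_mono\<close>)
    thus ?thesis using \<delta>(1) by blast
  qed
  obtain \<mu>0 where "U \<le> ereal (2 * q \<mu>0)"
  proof -
    obtain \<delta> where "\<delta> > 0" "\<forall>\<mu>. 0 < \<mu> \<longrightarrow> \<mu> < \<delta> \<longrightarrow> U \<le> ereal ((1 + 1) * q \<mu>)" using UL[of 1] by auto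
    hence "U \<le> ereal ((1 + 1) * q (\<delta> / 2))" by auto
    thus thesis using that by simp
  qed
  then obtain u l where u: "U = ereal u" and l: "L = ereal l"
    using kL LU by (cases U; cases L) auto
  have lk: "l \<ge> k" "l \<le> u" using kL LU u l by auto
  have "u \<le> (1 + \<eta>) * l" if \<eta>: "0 < \<eta>" "\<eta> \<le> 1" for \<eta>
  proof -
    obtain \<delta> where \<delta>: "\<delta> > 0" "\<And>\<mu>. 0 < \<mu> \<Longrightarrow> \<mu> < \<delta> \<Longrightarrow> u \<le> (1 + \<eta>) * q \<mu>"
      using UL[OF \<eta>] u by auto
    have "ereal (u / (1 + \<eta>)) \<le> L" unfolding L_def
    proof (rule Liminf_bounded)
      show "\<forall>\<^sub>F t in at_right 0. ereal (u / (1 + \<eta>)) \<le> ereal (q t)"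
        unfolding eventually_at_right_field using \<delta> \<eta> by (auto simp: field_simps intro!: exI[of _ \<delta>])
    qed
    thus ?thesis using l \<eta> by (simp add: field_simps)
  qed
  hence "u \<le> l + \<eta>" if "0 < \<eta>" for \<eta>
  proof -
    have l0: "l > 0" using lk k by simp
    define \<nu> where "\<nu> = min 1 (\<eta> / l)"
    have "0 < \<nu>" "\<nu> \<le> 1" using l0 that by (simp_all add: \<nu>_def)
    moreover have "\<nu> * l \<le> \<eta>" using l0 mult_right_mono[of \<nu> "\<eta> / l" l] by (simp add: \<nu>_def)
    ultimately show ?thesis using \<open>\<And>\<eta>. \<lbrakk>0 < \<eta>; \<eta> \<le> 1\<rbrakk> \<Longrightarrow> u \<le> (1 + \<eta>) * l\<close>[of \<nu>] by (simp add: algebra_simps)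
  qed
  hence "u \<le> l" by (rule field_le_epsilon)
  hence "U = L" using lk u l by simp
  hence "((\<lambda>t. ereal (q t)) \<longlongrightarrow> ereal l) (at_right 0)"
    using l unfolding U_def L_def by (subst tendsto_iff_Liminf_eq_Limsup) auto
  thus ?thesis using lk k by (intro exI[of _ l]) auto
qed

section \<open>Minimal energy on a network and the Dirichlet principle\<close>

locale power_network =
  fixes C m :: "nat \<Rightarrow> real" and A B s :: real
  assumes s: "- 1 < s" "s < 1" and C_0: "C 0 = 0" and m_0: "m 0 = 0"
    and C_pos: "p \<ge> 1 \<Longrightarrow> C p > 0" and m_pos: "p \<ge> 1 \<Longrightarrow> m p > 0"
    and A: "A > 0" and B: "B > 0"
    and C_asymp: "(\<lambda>p. C p / real p powr s) \<longlonglongrightarrow> A" and m_asymp: "(\<lambda>p. m p / real p powr s) \<longlonglongrightarrow> B"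
begin

lemma C_nonneg: "C p \<ge> 0" and m_nonneg: "m p \<ge> 0"
  using C_pos[of p] m_pos[of p] C_0 m_0 by (cases p; simp)+

text \<open>\<open>\<phi>\<close> minimises the energy \<open>\<Sum>p. C p * (\<phi> p - \<phi> (p+1))\<^sup>2 + \<mu> * m p * (\<phi> p)\<^sup>2\<close> subject to \<open>\<phi> 1 = 1\<close>,
  \<open>J\<close> is its flux and \<open>J 0\<close> its energy.\<close>

definition flux_solution :: "real \<Rightarrow> (nat \<Rightarrow> real) \<Rightarrow> (nat \<Rightarrow> real) \<Rightarrow> bool" where
  "flux_solution \<mu> \<phi> J \<longleftrightarrow> \<phi> 1 = 1 \<and> (\<forall>p\<ge>1. \<phi> p \<ge> 0) \<and> (\<forall>p\<ge>1. C p * (\<phi> p - \<phi> (p + 1)) = J p)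
     \<and> (\<forall>p\<ge>1. J (p - 1) - J p = \<mu> * m p * \<phi> p) \<and> J \<longlonglongrightarrow> 0"

text \<open>Truncated at \<open>N\<close> so that no summability is presupposed; bounds uniform in
  \<open>N\<close> stand for bounds on the total energy.\<close>

definition energy :: "real \<Rightarrow> (nat \<Rightarrow> real) \<Rightarrow> nat \<Rightarrow> real" where
  "energy \<mu> \<psi> N = (\<Sum>p=1..N. C p * (\<psi> p - \<psi> (p + 1))\<^sup>2 + \<mu> * m p * (\<psi> p)\<^sup>2)"

text \<open>A flux that decreases to 0 is nonnegative, and then \<phi> drops across each
  bond.\<close>

lemma flux_solution_facts:
  assumes "flux_solution \<mu> \<phi> J" "\<mu> \<ge> 0"
  shows "J p \<ge> 0" "J p \<le> J 0" "p \<ge> 1 \<Longrightarrow> \<phi> (p + 1) \<le> \<phi> p" "1 \<le> p \<Longrightarrow> p \<le> q \<Longrightarrow> \<phi> q \<le> \<phi> p"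
    "p \<ge> 1 \<Longrightarrow> \<phi> p \<le> 1"
proof -
  note d = assms(1)[unfolded flux_solution_def]
  have dec: "decseq J"
  proof (rule decseq_SucI)
    fix n
    have "J n - J (Suc n) = \<mu> * m (Suc n) * \<phi> (Suc n)" using d by force
    moreover have "\<dots> \<ge> 0" using d assms(2) m_nonneg by (intro mult_nonneg_nonneg) auto
    ultimately show "J (Suc n) \<le> J n" by linarith
  qed
  show J: "J p \<ge> 0" for p using decseq_ge[OF dec] d by blast
  show "J p \<le> J 0" using dec by (simp add: decseq_def)
  show step: "\<phi> (p + 1) \<le> \<phi> p" if "p \<ge> 1" for p
  proof -
    have "C p * (\<phi> p - \<phi> (p + 1)) \<ge> 0" using d J[of p] that by simp
    thus ?thesis using C_pos[OF that] by (simp add: zero_le_mult_iff)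
  qed
  show mono: "\<phi> q \<le> \<phi> p" if "1 \<le> p" "p \<le> q" for p q
    using that(2)
  proof (induction q rule: dec_induct)
    case (step n)
    thus ?case using \<open>\<And>p. p \<ge> 1 \<Longrightarrow> \<phi> (p + 1) \<le> \<phi> p\<close>[of n] that(1) by simp
  qed simp
  show "\<phi> p \<le> 1" if "p \<ge> 1" using mono[of 1 p] that d by simp
qed

text \<open>Summation by parts: the weak form of the equation against a test function
  \<psi>.\<close>

lemma flux_telescope:
  assumes "\<forall>p\<ge>1. J (p - 1) - J p = \<mu> * m p * \<phi> p"
  shows "(\<Sum>p=1..N. J p * (\<psi> p - \<psi> (p + 1)) + \<mu> * m p * \<phi> p * \<psi> p) = J 0 * \<psi> 1 - J N * \<psi> (N + 1)"
proof (induction N)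
  case (Suc N)
  have "J N - J (Suc N) = \<mu> * m (Suc N) * \<phi> (Suc N)" using assms by force
  with Suc show ?case by (simp add: algebra_simps)
qed simp

lemma flux_energy_le:
  assumes "flux_solution \<mu> \<phi> J" "\<mu> \<ge> 0"
  shows "energy \<mu> \<phi> N \<le> J 0"
proof -
  note d = assms(1)[unfolded flux_solution_def]
  have "energy \<mu> \<phi> N = (\<Sum>p=1..N. J p * (\<phi> p - \<phi> (p + 1)) + \<mu> * m p * \<phi> p * \<phi> p)"
    unfolding energy_def by (rule sum.cong) (use d in \<open>auto simp: power2_eq_square mult.assoc\<close>)
  also have "\<dots> = J 0 * \<phi> 1 - J N * \<phi> (N + 1)" by (rule flux_telescope) (use d in auto)
  also have "\<dots> \<le> J 0" using d flux_solution_facts(1)[OF assms] by simp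
  finally show ?thesis .
qed

text \<open>Dirichlet principle: testing the equation for \<phi> with \<psi> expresses
  \<open>J 0\<close> as the mixed energy of \<phi> and \<psi>, up to a boundary term that vanishes
  because \<psi> is bounded and the flux tends to 0. The arithmetic-geometric mean inequality then
  gives \<open>J 0 \<le> J 0 / 2 + b / 2\<close> in the limit.\<close>

lemma flux_le_energy:
  assumes "flux_solution \<mu> \<phi> J" "\<mu> \<ge> 0" and \<psi>: "\<psi> 1 = 1" "\<And>p. p \<ge> 1 \<Longrightarrow> \<bar>\<psi> p\<bar> \<le> 1"
    and bound: "\<And>N. energy \<mu> \<psi> N \<le> b"
  shows "J 0 \<le> b"
proof -
  note d = assms(1)[unfolded flux_solution_def]
  have "J 0 - 2 * J N \<le> b" for N
  proof -
    have "J 0 * \<psi> 1 - J N * \<psi> (N + 1) = (\<Sum>p=1..N. J p * (\<psi> p - \<psi> (p + 1)) + \<mu> * m p * \<phi> p * \<psi> p)"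
      by (rule flux_telescope[symmetric]) (use d in auto)
    also have "\<dots> \<le> (\<Sum>p=1..N. (C p * (\<phi> p - \<phi> (p + 1))\<^sup>2 + \<mu> * m p * (\<phi> p)\<^sup>2) / 2
          + (C p * (\<psi> p - \<psi> (p + 1))\<^sup>2 + \<mu> * m p * (\<psi> p)\<^sup>2) / 2)"
    proof (rule sum_mono)
      fix p assume "p \<in> {1..N}"
      have am: "k * (x * y) \<le> (k * x\<^sup>2 + k * y\<^sup>2) / 2" if "k \<ge> 0" for k x y :: real
      proof -
        have "0 \<le> k * (x - y)\<^sup>2" using that by simp
        thus ?thesis by (simp add: power2_eq_square algebra_simps)
      qed
      have "J p * (\<psi> p - \<psi> (p + 1)) = C p * ((\<phi> p - \<phi> (p + 1)) * (\<psi> p - \<psi> (p + 1)))"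
        using d \<open>p \<in> _\<close> by (simp add: mult.assoc[symmetric])
      moreover have "\<mu> * m p * \<phi> p * \<psi> p = \<mu> * m p * (\<phi> p * \<psi> p)" by simp
      moreover have em: "\<mu> * m p \<ge> 0" using m_nonneg assms(2) by simp
      ultimately show "J p * (\<psi> p - \<psi> (p + 1)) + \<mu> * m p * \<phi> p * \<psi> p \<le> (C p * (\<phi> p - \<phi> (p + 1))\<^sup>2 + \<mu> * m p * (\<phi> p)\<^sup>2) / 2
          + (C p * (\<psi> p - \<psi> (p + 1))\<^sup>2 + \<mu> * m p * (\<psi> p)\<^sup>2) / 2"
        using am[OF C_nonneg[of p], of "\<phi> p - \<phi> (p + 1)" "\<psi> p - \<psi> (p + 1)"] am[OF em, of "\<phi> p" "\<psi> p"]
        by (simp only: add_divide_distrib)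
    qed
    also have "\<dots> = energy \<mu> \<phi> N / 2 + energy \<mu> \<psi> N / 2"
      by (simp add: energy_def sum.distrib sum_divide_distrib[symmetric])
    also have "\<dots> \<le> J 0 / 2 + b / 2" using flux_energy_le[OF assms(1,2), of N] bound[of N] by simp
    finally have "J 0 - 2 * (J N * \<psi> (N + 1)) \<le> b" using \<psi> by simp
    moreover have "J N * \<psi> (N + 1) \<le> J N * 1"
      using flux_solution_facts(1)[OF assms(1,2)] \<psi>(2)[of "N + 1"] by (intro mult_left_mono) auto
    ultimately show ?thesis by simp
  qed
  moreover have "(\<lambda>N. J 0 - 2 * J N) \<longlonglongrightarrow> J 0 - 2 * 0" using d by (intro tendsto_intros) auto
  ultimately show ?thesis using LIMSEQ_le_const2 by fastforce
qed

text \<open>The minimiser for the larger parameter is a competitor for the smaller one, where it has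
  no more energy.\<close>

lemma flux_mono:
  assumes "flux_solution \<mu> \<phi> J" "flux_solution \<mu>' \<phi>' J'" "0 \<le> \<mu>" "\<mu> \<le> \<mu>'"
  shows "J 0 \<le> J' 0"
proof (rule flux_le_energy[OF assms(1,3)])
  note d = assms(2)[unfolded flux_solution_def]
  show "\<phi>' 1 = 1" using d by simp
  show "\<bar>\<phi>' p\<bar> \<le> 1" if "p \<ge> 1" for p
    using d flux_solution_facts(5)[OF assms(2), of p] that assms by simp
  fix N
  have "energy \<mu> \<phi>' N \<le> energy \<mu>' \<phi>' N" unfolding energy_def
    by (intro sum_mono add_mono mult_right_mono order_refl m_nonneg) (use assms in auto)
  also have "\<dots> \<le> J' 0" by (rule flux_energy_le) (use assms in auto)
  finally show "energy \<mu> \<phi>' N \<le> J' 0" .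
qed

text \<open>Two regimes at a length \<open>L\<close> of order \<open>\<mu>^(-1/2)\<close>. If \<phi>
  is still at least 1/2 at \<open>L\<close>, the mass term costs about \<open>\<mu> L^(s+1)\<close>;
  if it has dropped by 1/2 before, the resistance of order \<open>L^(1-s)\<close> up to
  \<open>L\<close> forces a flux of order \<open>L^(s-1)\<close>. This \<open>L\<close> brings both
  to \<open>\<mu>^((1-s)/2)\<close>.\<close>

lemma flux_lower_bound:
  "\<exists>k>0. \<forall>\<mu> \<phi> J. 0 < \<mu> \<longrightarrow> \<mu> \<le> 1 \<longrightarrow> flux_solution \<mu> \<phi> J \<longrightarrow> k * \<mu> powr ((1 - s) / 2) \<le> J 0"
proof -
  obtain Mm where Mm: "Mm > 0" "\<And>p. p \<ge> 1 \<Longrightarrow> real p powr s \<le> Mm * m p"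
    using powr_asymp_bounds[OF m_pos B m_asymp] by blast
  obtain MC where MC: "MC > 0" "\<And>p. p \<ge> 1 \<Longrightarrow> real p powr s \<le> MC * C p"
    using powr_asymp_bounds[OF C_pos A C_asymp] by blast
  obtain k1 where k1: "k1 > 0" "\<And>n. n \<ge> 1 \<Longrightarrow> k1 * real n powr (s + 1) \<le> (\<Sum>p=1..n. real p powr s)"
    using sum_powr_ge[OF s] by blast
  obtain M2 where M2: "M2 > 0" "\<And>n. (\<Sum>p=1..n. real p powr (- s)) \<le> M2 * real n powr (1 - s)"
    using sum_powr_le[of "- s"] s by auto
  define k where "k = min (k1 / (4 * Mm)) (1 / (2 * MC * M2 * 2 powr (1 - s)))"
  have k: "k > 0" using k1 Mm MC M2 by (simp add: k_def)
  have "k * \<mu> powr ((1 - s) / 2) \<le> J 0" if \<mu>: "0 < \<mu>" "\<mu> \<le> 1" and F: "flux_solution \<mu> \<phi> J" for \<mu> \<phi> J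
  proof -
    note d = F[unfolded flux_solution_def] and facts = flux_solution_facts[OF F less_imp_le[OF \<mu>(1)]]
    define x where "x = \<mu> powr (- 1/2)"
    have x: "x \<ge> 1" using \<mu> by (simp add: x_def powr_minus_divide powr_le1)
    define L where "L = nat \<lceil>x\<rceil>"
    have L: "L \<ge> 1" "x \<le> real L" "real L \<le> 2 * x" using x unfolding L_def by linarith+
    show ?thesis
    proof (cases "\<phi> L \<ge> 1 / 2")
      case True
      have "\<mu> / (4 * Mm) * (k1 * x powr (s + 1)) \<le> \<mu> / (4 * Mm) * (k1 * real L powr (s + 1))"
        using L x s \<mu> Mm k1 by (intro mult_left_mono powr_mono2) auto
      also have "\<dots> \<le> \<mu> / (4 * Mm) * (\<Sum>p=1..L. real p powr s)"
        using k1(2)[OF L(1)] \<mu> Mm by (intro mult_left_mono) auto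
      also have "\<dots> = (\<Sum>p=1..L. \<mu> * (real p powr s / Mm) * (1/2)\<^sup>2)"
        by (simp add: sum_distrib_left power2_eq_square mult.commute)
      also have "\<dots> \<le> energy \<mu> \<phi> L" unfolding energy_def
      proof (rule sum_mono)
        fix p assume p: "p \<in> {1..L}"
        have "\<phi> p \<ge> 1/2" using facts(4)[of p L] p True by auto
        hence "(1/2)\<^sup>2 \<le> (\<phi> p)\<^sup>2" by (intro power_mono) auto
        moreover have "real p powr s / Mm \<le> m p" using Mm p by (simp add: field_simps)
        ultimately have "\<mu> * (real p powr s / Mm) * (1/2)\<^sup>2 \<le> \<mu> * m p * (\<phi> p)\<^sup>2"
          using \<mu> m_nonneg Mm by (intro mult_mono) auto
        thus "\<mu> * (real p powr s / Mm) * (1/2)\<^sup>2 \<le> C p * (\<phi> p - \<phi> (p + 1))\<^sup>2 + \<mu> * m p * (\<phi> p)\<^sup>2"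
          using C_nonneg[of p] by (simp add: add_increasing)
      qed
      also have "\<dots> \<le> J 0" using flux_energy_le[OF F] \<mu> by simp
      finally have "\<mu> / (4 * Mm) * (k1 * x powr (s + 1)) \<le> J 0" .
      moreover have "\<mu> * x powr (s + 1) = \<mu> powr ((1 - s) / 2)"
      proof -
        have "\<mu> * x powr (s + 1) = \<mu> powr 1 * \<mu> powr (- 1/2 * (s + 1))" using \<mu> by (simp add: x_def powr_powr)
        also have "\<dots> = \<mu> powr (1 + (- 1/2 * (s + 1)))" by (simp only: powr_add)
        also have "1 + (- 1/2 * (s + 1)) = (1 - s) / 2" by (simp add: field_simps)
        finally show ?thesis .
      qed
      moreover have "\<mu> / (4 * Mm) * (k1 * x powr (s + 1)) = k1 / (4 * Mm) * (\<mu> * x powr (s + 1))" by simp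
      ultimately have "k1 / (4 * Mm) * \<mu> powr ((1 - s) / 2) \<le> J 0" by (simp only:)
      moreover have "k * \<mu> powr ((1 - s) / 2) \<le> k1 / (4 * Mm) * \<mu> powr ((1 - s) / 2)"
        by (intro mult_right_mono) (auto simp: k_def)
      ultimately show ?thesis by simp
    next
      case False
      have tel: "\<phi> 1 - \<phi> (N + 1) = (\<Sum>p=1..N. J p / C p)" for N
      proof (induction N)
        case (Suc N)
        have "J (Suc N) / C (Suc N) = \<phi> (Suc N) - \<phi> (Suc N + 1)"
          using d C_pos[of "Suc N"] by (metis nonzero_mult_div_cancel_left less_irrefl le_add1 plus_1_eq_Suc)
        with Suc show ?case by simp
      qed simp
      have J0: "J 0 \<ge> 0" by (rule facts)
      have "1/2 \<le> \<phi> 1 - \<phi> L" using False d by simp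
      also have "\<dots> = (\<Sum>p=1..L-1. J p / C p)" using tel[of "L - 1"] L by simp
      also have "\<dots> \<le> (\<Sum>p=1..L. J p / C p)"
        by (rule sum_mono2) (use facts(1) C_nonneg in auto)
      also have "\<dots> \<le> (\<Sum>p=1..L. J 0 * (MC * real p powr (- s)))"
      proof (rule sum_mono)
        fix p assume p: "p \<in> {1..L}"
        have "real p powr s \<le> MC * C p" "C p > 0" using MC(2) C_pos p by auto
        moreover have "real p powr s > 0" using p by simp
        ultimately have "1 / C p \<le> MC * real p powr (- s)" by (simp add: powr_minus field_simps)
        hence "J p * (1 / C p) \<le> J 0 * (MC * real p powr (- s))"
          using facts(2)[of p] J0 C_nonneg[of p] by (intro mult_mono) auto
        thus "J p / C p \<le> J 0 * (MC * real p powr (- s))" by simp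
      qed
      also have "\<dots> = J 0 * MC * (\<Sum>p=1..L. real p powr (- s))" by (simp add: sum_distrib_left mult.assoc)
      also have "\<dots> \<le> J 0 * MC * (M2 * real L powr (1 - s))" using M2(2)[of L] J0 MC by (intro mult_left_mono) auto
      also have "\<dots> \<le> J 0 * MC * (M2 * (2 * x) powr (1 - s))"
        using L s J0 MC M2 by (intro mult_left_mono powr_mono2) auto
      also have "(2 * x) powr (1 - s) = 2 powr (1 - s) * x powr (1 - s)" using x by (simp add: powr_mult)
      also have "x powr (1 - s) = \<mu> powr (- ((1 - s) / 2))" by (simp add: x_def powr_powr field_simps)
      also have "\<dots> = 1 / \<mu> powr ((1 - s) / 2)" by (simp add: powr_minus_divide)
      finally have "1 / (2 * MC * M2 * 2 powr (1 - s)) * \<mu> powr ((1 - s) / 2) \<le> J 0"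
        using \<mu> MC M2 by (simp add: field_simps)
      moreover have "k * \<mu> powr ((1 - s) / 2) \<le> 1 / (2 * MC * M2 * 2 powr (1 - s)) * \<mu> powr ((1 - s) / 2)"
        by (intro mult_right_mono) (auto simp: k_def)
      ultimately show ?thesis by simp
    qed
  qed
  thus ?thesis using k by blast
qed

section \<open>Stretching the minimiser by an integer factor\<close>

lemma sum_lessThan_mult: "sum f {..<l * n} = (\<Sum>k<n. \<Sum>r<l. f (l * k + r))" for f :: "nat \<Rightarrow> real"
proof (induction n)
  case (Suc n)
  have "sum f {..<a + l} = sum f {..<a} + (\<Sum>r<l. f (a + r))" for a
    by (induction l) simp_all
  from this[of "l * n"] Suc show ?case by (simp add: add.commute)
qed simp

text \<open>The competitor for \<open>\<mu> / l\<^sup>2\<close> is the minimiser for \<open>\<mu>\<close> stretched by the factor \<open>l\<close> and interpolated linearly.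
  Its energy is controlled cell by cell.\<close>

lemma flux_stretch:
  assumes \<eta>: "0 < \<eta>" "\<eta> \<le> 1"
  shows "\<exists>M>0. \<forall>l\<ge>1. \<forall>\<mu>>0. \<forall>\<phi> J \<phi>' J'. flux_solution \<mu> \<phi> J \<longrightarrow> flux_solution (\<mu> / (real l)\<^sup>2) \<phi>' J' \<longrightarrow>
    J' 0 \<le> real l powr (s - 1) * ((1 + \<eta>) * J 0 + M * ((J 0)\<^sup>2 + \<mu>))"
proof -
  obtain KC where KC: "KC \<ge> 1" "\<And>k l r. k \<ge> KC \<Longrightarrow> l \<ge> 1 \<Longrightarrow> r < l \<Longrightarrow> C (l * k + r) \<le> (1 + \<eta>) * real l powr s * C k"
    using powr_asymp_dilation[OF C_pos A C_asymp less_imp_le[OF s(2)] \<eta>] by blast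
  obtain Km where Km: "Km \<ge> 1" "\<And>k l r. k \<ge> Km \<Longrightarrow> l \<ge> 1 \<Longrightarrow> r < l \<Longrightarrow> m (l * k + r) \<le> (1 + \<eta>) * real l powr s * m k"
    using powr_asymp_dilation[OF m_pos B m_asymp less_imp_le[OF s(2)] \<eta>] by blast
  define K where "K = max KC Km"
  obtain MC where MC: "MC > 0" "\<And>p. p \<ge> 1 \<Longrightarrow> C p \<le> MC * real p powr s"
    using powr_asymp_bounds[OF C_pos A C_asymp] by blast
  obtain Mm where Mm: "Mm > 0" "\<And>p. p \<ge> 1 \<Longrightarrow> m p \<le> Mm * real p powr s"
    using powr_asymp_bounds[OF m_pos B m_asymp] by blast
  obtain MS where MS: "MS > 0" "\<And>n. (\<Sum>p=1..n. real p powr s) \<le> MS * real n powr (s + 1)"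
    using sum_powr_le[OF s(1)] by blast
  \<comment> \<open>Total resistance of the first \<open>K\<close> bonds: through
    \<open>J k / C k\<close> it bounds the increments of \<phi> there by a multiple of the
    flux.\<close>
  define D where "D = (\<Sum>k=1..K. 1 / C k)"
  have D: "1 / C k \<le> D" if "1 \<le> k" "k \<le> K" for k
    unfolding D_def by (rule member_le_sum) (use that C_nonneg in auto)
  have D0: "D \<ge> 0" unfolding D_def by (rule sum_nonneg) (use C_nonneg in auto)
  define Q where "Q = MC * real K * D\<^sup>2 + Mm * real K + Mm * MS"
  have K: "K \<ge> 1" using KC by (simp add: K_def)
  have Q_ge: "MC * real K * D\<^sup>2 \<le> Q" "Mm * real K \<le> Q" "Mm * MS \<le> Q" and Q: "Q > 0"
    using MC Mm MS K by (simp_all add: Q_def add_nonneg_pos)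
  have "J' 0 \<le> real l powr (s - 1) * ((1 + \<eta>) * J 0 + real K * Q * ((J 0)\<^sup>2 + \<mu>))"
    if l: "l \<ge> 1" and \<mu>: "\<mu> > 0" and F: "flux_solution \<mu> \<phi> J" and F': "flux_solution (\<mu> / (real l)\<^sup>2) \<phi>' J'"
    for l \<mu> \<phi> J \<phi>' J'
  proof -
    note d = F[unfolded flux_solution_def] and facts = flux_solution_facts[OF F less_imp_le[OF \<mu>]]
    have l0: "real l > 0" using l by simp
    \<comment> \<open>\<phi> lives on \<open>p \<ge> 1\<close>; the extra value
      \<open>\<phi>0 0 = 1 = \<phi> 1\<close> makes the stretched function constant on the cell 0,
      so that it equals 1 at site 1 and pays no gradient there.\<close>
    define \<phi>0 where "\<phi>0 k = (if k = 0 then 1 else \<phi> k)" for k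
    have \<phi>0: "0 \<le> \<phi>0 k" "\<phi>0 k \<le> 1" "\<phi>0 (Suc k) \<le> \<phi>0 k" for k
      using d facts(5)[of k] facts(3)[of k] by (auto simp: \<phi>0_def)
    define \<psi> where "\<psi> p = \<phi>0 (p div l) + real (p mod l) / real l * (\<phi>0 (Suc (p div l)) - \<phi>0 (p div l))" for p
    have \<psi>_at: "\<psi> (l * k + r) = \<phi>0 k + real r / real l * (\<phi>0 (Suc k) - \<phi>0 k)" if "r < l" for k r
      using that by (simp add: \<psi>_def)
    have \<psi>_Suc: "\<psi> (l * k + r + 1) = \<phi>0 k + real (r + 1) / real l * (\<phi>0 (Suc k) - \<phi>0 k)" if "r < l" for k r
    proof (cases "r + 1 < l")
      case True
      thus ?thesis using \<psi>_at[of "r + 1" k] by simp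
    next
      case False
      hence "r + 1 = l" using that by simp
      hence "l * k + r + 1 = l * Suc k + 0" by simp
      hence "\<psi> (l * k + r + 1) = \<psi> (l * Suc k + 0)" by (simp only:)
      also have "\<dots> = \<phi>0 (Suc k)" using \<psi>_at[of 0 "Suc k"] l by simp
      finally show ?thesis using \<open>r + 1 = l\<close> l0 by simp
    qed
    have \<psi>_step: "(\<psi> (l * k + r) - \<psi> (l * k + r + 1))\<^sup>2 = (\<phi>0 k - \<phi>0 (Suc k))\<^sup>2 / (real l)\<^sup>2" if "r < l" for k r
    proof -
      have "\<psi> (l * k + r) - \<psi> (l * k + r + 1) = (\<phi>0 k - \<phi>0 (Suc k)) / real l"
        unfolding \<psi>_at[OF that] \<psi>_Suc[OF that] using l0 by (simp add: field_simps)
      thus ?thesis by (simp add: power_divide)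
    qed
    have \<psi>_bd: "0 \<le> \<psi> (l * k + r)" "\<psi> (l * k + r) \<le> \<phi>0 k" if "r < l" for k r
    proof -
      define t where "t = real r / real l"
      have t: "0 \<le> t" "t \<le> 1" using that by (simp_all add: t_def)
      have e: "\<psi> (l * k + r) = (1 - t) * \<phi>0 k + t * \<phi>0 (Suc k)"
        unfolding \<psi>_at[OF that] by (simp add: t_def algebra_simps)
      show "0 \<le> \<psi> (l * k + r)" unfolding e using t \<phi>0 by simp
      have "t * \<phi>0 (Suc k) \<le> t * \<phi>0 k" using t \<phi>0 by (intro mult_left_mono)
      thus "\<psi> (l * k + r) \<le> \<phi>0 k" unfolding e by (simp add: algebra_simps)
    qed
    define g where "g p = C p * (\<psi> p - \<psi> (p + 1))\<^sup>2 + \<mu> / (real l)\<^sup>2 * m p * (\<psi> p)\<^sup>2" for p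
    have g_nonneg: "g p \<ge> 0" for p using C_nonneg m_nonneg \<mu> by (simp add: g_def)
    have g_le: "g (l * k + r) \<le> (C (l * k + r) * (\<phi>0 k - \<phi>0 (Suc k))\<^sup>2 + \<mu> * m (l * k + r) * (\<phi>0 k)\<^sup>2) / (real l)\<^sup>2"
      if "r < l" for k r
    proof -
      have "(\<psi> (l * k + r))\<^sup>2 \<le> (\<phi>0 k)\<^sup>2" using \<psi>_bd[OF that] by (intro power_mono)
      hence "\<mu> / (real l)\<^sup>2 * m (l * k + r) * (\<psi> (l * k + r))\<^sup>2 \<le> \<mu> / (real l)\<^sup>2 * m (l * k + r) * (\<phi>0 k)\<^sup>2"
        using \<mu> m_nonneg by (intro mult_left_mono) auto
      thus ?thesis unfolding g_def \<psi>_step[OF that] by (simp add: add_divide_distrib)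
    qed
    define En where "En k = C k * (\<phi> k - \<phi> (k + 1))\<^sup>2 + \<mu> * m k * (\<phi> k)\<^sup>2" for k
    have En: "En k \<ge> 0" for k using C_nonneg m_nonneg \<mu> by (simp add: En_def)
    define b where "b k = (if k = 0 then 0 else (1 + \<eta>) * En k) + (if k < K then Q * ((J 0)\<^sup>2 + \<mu>) else 0)" for k
    have pw: "real l powr s / real l = real l powr (s - 1)" "real l powr (s + 1) / (real l)\<^sup>2 = real l powr (s - 1)"
      using l0 by (simp_all add: powr_diff powr_add power2_eq_square)
    have cell: "(\<Sum>r<l. g (l * k + r)) \<le> real l powr (s - 1) * b k" for k
    proof (cases "k = 0")
      case True
      have "\<phi>0 (Suc 0) = 1" "\<phi>0 0 = 1" using d by (simp_all add: \<phi>0_def)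
      hence "(\<Sum>r<l. g (l * k + r)) \<le> (\<Sum>r<l. \<mu> * m r / (real l)\<^sup>2)"
        using g_le[of _ k] True by (intro sum_mono) fastforce
      also have "\<dots> = \<mu> / (real l)\<^sup>2 * (\<Sum>r<l. m r)" by (simp add: sum_distrib_left)
      also have "(\<Sum>r<l. m r) \<le> (\<Sum>r\<in>{1..l}. Mm * real r powr s)"
      proof -
        have "(\<Sum>r<l. m r) = (\<Sum>r\<in>{1..<l}. m r)"
          by (rule sum.mono_neutral_right) (use m_0 in \<open>auto simp: Suc_le_eq\<close>)
        also have "\<dots> \<le> (\<Sum>r\<in>{1..l}. m r)" by (rule sum_mono2) (use m_nonneg in auto)
        also have "\<dots> \<le> (\<Sum>r\<in>{1..l}. Mm * real r powr s)" by (rule sum_mono) (use Mm in auto)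
        finally show ?thesis .
      qed
      also have "\<dots> \<le> Mm * (MS * real l powr (s + 1))"
        unfolding sum_distrib_left[symmetric] using MS(2)[of l] Mm by (intro mult_left_mono) auto
      finally have "(\<Sum>r<l. g (l * k + r)) \<le> \<mu> / (real l)\<^sup>2 * (Mm * (MS * real l powr (s + 1)))"
        using \<mu> by (simp add: mult_left_mono divide_right_mono)
      also have "\<dots> = (real l powr (s + 1) / (real l)\<^sup>2) * (Mm * MS * \<mu>)" by simp
      also have "\<dots> \<le> real l powr (s - 1) * (Q * ((J 0)\<^sup>2 + \<mu>))"
        unfolding pw(2) using Q_ge(3) Q \<mu> by (intro mult_left_mono mult_mono) auto
      finally show ?thesis using True K by (simp add: b_def)
    next
      case False
      hence k: "k \<ge> 1" by simp
      have e: "\<phi>0 k = \<phi> k" "\<phi>0 (Suc k) = \<phi> (k + 1)" using k by (auto simp: \<phi>0_def)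
      have b0: "b k \<ge> (1 + \<eta>) * En k" using k Q \<mu> by (simp add: b_def)
      have "g (l * k + r) \<le> real l powr s * b k / (real l)\<^sup>2" if r: "r < l" for r
      proof (rule order.trans[OF g_le[OF r]], rule divide_right_mono)
        show "C (l * k + r) * (\<phi>0 k - \<phi>0 (Suc k))\<^sup>2 + \<mu> * m (l * k + r) * (\<phi>0 k)\<^sup>2 \<le> real l powr s * b k"
        proof (cases "k < K")
          case False
          hence kk: "k \<ge> KC" "k \<ge> Km" by (auto simp: K_def)
          have "C (l * k + r) * (\<phi>0 k - \<phi>0 (Suc k))\<^sup>2 + \<mu> * m (l * k + r) * (\<phi>0 k)\<^sup>2
             \<le> ((1 + \<eta>) * real l powr s * C k) * (\<phi>0 k - \<phi>0 (Suc k))\<^sup>2 + \<mu> * ((1 + \<eta>) * real l powr s * m k) * (\<phi>0 k)\<^sup>2"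
            using KC(2)[OF kk(1) l r] Km(2)[OF kk(2) l r] \<mu> by (intro add_mono mult_right_mono mult_left_mono) auto
          also have "\<dots> = real l powr s * ((1 + \<eta>) * En k)" by (simp add: En_def e algebra_simps)
          also have "\<dots> \<le> real l powr s * b k" using b0 by (intro mult_left_mono) auto
          finally show ?thesis .
        next
          case True
          \<comment> \<open>In an early cell the increment is controlled by the flux. This makes the
            error quadratic in the energy, hence negligible once the energy tends to 0; a linear
            error would spoil the factor \<open>1 + \<eta>\<close>.\<close>
          have "\<phi> k - \<phi> (k + 1) = J k / C k" using d k C_pos[OF k] by (simp add: field_simps)
          also have "\<dots> \<le> J 0 * D"
            using facts(1,2)[of k] D[OF k] True C_nonneg[of k] D0 mult_mono[of "J k" "J 0" "1 / C k" D] by simp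
          finally have dk: "(\<phi> k - \<phi> (k + 1))\<^sup>2 \<le> (J 0 * D)\<^sup>2"
            using facts(3)[OF k] by (intro power_mono) auto
          have "(\<phi> k)\<^sup>2 \<le> 1\<^sup>2" using facts(5)[OF k] d k by (intro power_mono) auto
          hence "C (l * k + r) * (\<phi>0 k - \<phi>0 (Suc k))\<^sup>2 + \<mu> * m (l * k + r) * (\<phi>0 k)\<^sup>2
             \<le> (MC * real K * real l powr s) * (J 0 * D)\<^sup>2 + \<mu> * (Mm * real K * real l powr s) * 1"
            unfolding e
            using powr_bound_dilation[OF MC(2) MC(1) less_imp_le[OF s(2)] k True r]
              powr_bound_dilation[OF Mm(2) Mm(1) less_imp_le[OF s(2)] k True r] dk \<mu> MC Mm
            by (intro add_mono mult_mono) (auto simp: C_nonneg m_nonneg)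
          also have "\<dots> = real l powr s * ((MC * real K * D\<^sup>2) * (J 0)\<^sup>2 + (Mm * real K) * \<mu>)"
            by (simp add: algebra_simps power_mult_distrib)
          also have "\<dots> \<le> real l powr s * (Q * (J 0)\<^sup>2 + Q * \<mu>)"
            using Q_ge \<mu> by (intro mult_left_mono add_mono mult_right_mono) auto
          also have "\<dots> \<le> real l powr s * b k"
            using True k En[of k] \<eta> by (intro mult_left_mono) (auto simp: b_def algebra_simps)
          finally show ?thesis .
        qed
      qed simp
      hence "(\<Sum>r<l. g (l * k + r)) \<le> real (card {..<l}) * (real l powr s * b k / (real l)\<^sup>2)"
        by (intro sum_bounded_above) auto
      also have "\<dots> = (real l powr s / real l) * b k" using l0 by (simp add: power2_eq_square)
      finally show ?thesis by (simp add: pw)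
    qed
    show ?thesis
    proof (rule flux_le_energy[OF F', of \<psi>])
      show "\<psi> 1 = 1"
      proof (cases "l = 1")
        case True
        thus ?thesis using d by (simp add: \<psi>_def \<phi>0_def)
      next
        case False
        thus ?thesis using d l by (simp add: \<psi>_def \<phi>0_def)
      qed
      show "\<bar>\<psi> p\<bar> \<le> 1" for p
        using \<psi>_bd[of "p mod l" "p div l"] \<phi>0(2)[of "p div l"] l by simp
      fix N
      have "energy (\<mu> / (real l)\<^sup>2) \<psi> N = (\<Sum>p=1..N. g p)" by (simp add: energy_def g_def)
      also have "\<dots> \<le> (\<Sum>p<l * Suc N. g p)"
      proof (rule sum_mono2)
        have "1 * Suc N \<le> l * Suc N" using l by (intro mult_right_mono) auto
        thus "{1..N} \<subseteq> {..<l * Suc N}" by auto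
      qed (use g_nonneg in auto)
      also have "\<dots> \<le> (\<Sum>k<Suc N. real l powr (s - 1) * b k)"
        unfolding sum_lessThan_mult by (intro sum_mono cell)
      also have "\<dots> = real l powr (s - 1) * (\<Sum>k<Suc N. b k)" by (simp only: sum_distrib_left)
      also have "(\<Sum>k<Suc N. b k) \<le> (1 + \<eta>) * J 0 + real K * Q * ((J 0)\<^sup>2 + \<mu>)"
      proof -
        have "(\<Sum>k<Suc N. b k) = (\<Sum>k<Suc N. if k = 0 then 0 else (1 + \<eta>) * En k)
            + (\<Sum>k<Suc N. if k < K then Q * ((J 0)\<^sup>2 + \<mu>) else 0)"
          unfolding b_def by (rule sum.distrib)
        also have "(\<Sum>k<Suc N. if k = 0 then 0 else (1 + \<eta>) * En k) = (\<Sum>k=1..N. (1 + \<eta>) * En k)"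
          by (rule sum.mono_neutral_cong_right) auto
        also have "\<dots> = (1 + \<eta>) * energy \<mu> \<phi> N" by (simp add: energy_def En_def sum_distrib_left)
        also have "\<dots> \<le> (1 + \<eta>) * J 0"
          using flux_energy_le[OF F] \<mu> \<eta> by (intro mult_left_mono) auto
        also have "(\<Sum>k<Suc N. if k < K then Q * ((J 0)\<^sup>2 + \<mu>) else 0) = (\<Sum>k\<in>{..<Suc N} \<inter> {..<K}. Q * ((J 0)\<^sup>2 + \<mu>))"
          by (rule sum.mono_neutral_cong_right) auto
        also have "\<dots> \<le> (\<Sum>k<K. Q * ((J 0)\<^sup>2 + \<mu>))" by (rule sum_mono2) (use Q \<mu> in auto)
        also have "\<dots> = real K * Q * ((J 0)\<^sup>2 + \<mu>)" by simp
        finally show ?thesis by simp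
      qed
      finally show "energy (\<mu> / (real l)\<^sup>2) \<psi> N \<le> real l powr (s - 1) * ((1 + \<eta>) * J 0 + real K * Q * ((J 0)\<^sup>2 + \<mu>))"
        by (simp add: mult_left_mono)
    qed (use \<mu> in simp)
  qed
  thus ?thesis using K Q by (intro exI[of _ "real K * Q"]) auto
qed

text \<open>Any small \<open>t\<close> is compared with some \<open>\<mu> / l^2\<close>,
  \<open>l\<close> an integer, for which the stretched competitor bounds \<open>e\<close> with a
  factor close to 1. So \<open>e \<mu> / \<mu>^a\<close> is almost monotone as \<mu>
  decreases.\<close>

lemma flux_asymp:
  assumes e: "\<And>\<mu>. 0 < \<mu> \<Longrightarrow> \<exists>\<phi> J. flux_solution \<mu> \<phi> J \<and> J 0 = e \<mu>"
    and e0: "(e \<longlongrightarrow> 0) (at_right 0)"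
  shows "\<exists>\<kappa>>0. ((\<lambda>\<mu>. e \<mu> / \<mu> powr ((1 - s) / 2)) \<longlongrightarrow> \<kappa>) (at_right 0)"
proof -
  define a where "a = (1 - s) / 2"
  have a: "0 < a" "a < 1" using s by (simp_all add: a_def)
  obtain k where k: "k > 0" and k_le: "\<And>\<mu>. 0 < \<mu> \<Longrightarrow> \<mu> \<le> 1 \<Longrightarrow> k * \<mu> powr a \<le> e \<mu>"
    using flux_lower_bound e unfolding a_def by metis
  have e_mono: "e \<mu> \<le> e \<mu>'" if "0 < \<mu>" "\<mu> \<le> \<mu>'" for \<mu> \<mu>'
    using e[of \<mu>] e[of \<mu>'] flux_mono[of \<mu> _ _ \<mu>'] that by fastforce
  \<comment> \<open>The errors \<open>M * (e^2 + \<mu>)\<close> are absorbed in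
    \<open>\<eta> * e\<close>: the quadratic one since \<open>e\<close> tends to 0, the linear one
    since \<open>\<mu> = \<mu>^(1-a) \<mu>^a\<close>, where \<open>a < 1\<close> and
    \<open>e\<close> is at least \<open>k \<mu>^a\<close>.\<close>
  have stretch: "\<exists>\<delta>>0. \<forall>\<mu> l. 0 < \<mu> \<longrightarrow> \<mu> < \<delta> \<longrightarrow> 1 \<le> l \<longrightarrow> e (\<mu> / (real l)\<^sup>2) \<le> (1 + 2 * \<eta>) * real l powr (- 2 * a) * e \<mu>"
    if \<eta>: "0 < \<eta>" "\<eta> \<le> 1" for \<eta>
  proof -
    have sa: "s - 1 = - 2 * a" by (simp add: a_def)
    obtain M where M: "M > 0" and M_le: "\<And>l \<mu>. l \<ge> 1 \<Longrightarrow> \<mu> > 0 \<Longrightarrow>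
        e (\<mu> / (real l)\<^sup>2) \<le> real l powr (- 2 * a) * ((1 + \<eta>) * e \<mu> + M * ((e \<mu>)\<^sup>2 + \<mu>))"
    proof -
      obtain M where M: "M > 0" "\<forall>l\<ge>1. \<forall>\<mu>>0. \<forall>\<phi> J \<phi>' J'. flux_solution \<mu> \<phi> J \<longrightarrow> flux_solution (\<mu> / (real l)\<^sup>2) \<phi>' J' \<longrightarrow>
          J' 0 \<le> real l powr (s - 1) * ((1 + \<eta>) * J 0 + M * ((J 0)\<^sup>2 + \<mu>))"
        using flux_stretch[OF \<eta>] by blast
      show thesis
      proof (rule that[OF M(1)])
        fix l :: nat and \<mu> :: real assume l: "l \<ge> 1" and \<mu>: "\<mu> > 0"
        obtain \<phi> J where 1: "flux_solution \<mu> \<phi> J" "J 0 = e \<mu>" using e[OF \<mu>] by blast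
        have "\<mu> / (real l)\<^sup>2 > 0" using l \<mu> by simp
        from e[OF this] obtain \<phi>' J' where 2: "flux_solution (\<mu> / (real l)\<^sup>2) \<phi>' J'" "J' 0 = e (\<mu> / (real l)\<^sup>2)" by blast
        show "e (\<mu> / (real l)\<^sup>2) \<le> real l powr (- 2 * a) * ((1 + \<eta>) * e \<mu> + M * ((e \<mu>)\<^sup>2 + \<mu>))"
          using M(2) l \<mu> 1 2 unfolding sa[symmetric] by metis
      qed
    qed
    have "((\<lambda>\<mu>::real. M * \<mu> powr (1 - a)) \<longlongrightarrow> M * 0) (at_right 0)"
      using a by (intro tendsto_mult_left tendsto_zero_powrI[where b = "1 - a"])
        (auto intro: eventually_mono[OF eventually_at_right_less])
    hence "\<forall>\<^sub>F \<mu> in at_right 0. M * \<mu> powr (1 - a) < \<eta> / 2 * k"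
      using \<eta> k by (intro order_tendstoD(2)[of _ "M * 0"]) auto
    moreover have "((\<lambda>\<mu>. M * e \<mu>) \<longlongrightarrow> M * 0) (at_right 0)" by (intro tendsto_intros e0)
    hence "\<forall>\<^sub>F \<mu> in at_right 0. M * e \<mu> < \<eta> / 2" using \<eta> by (intro order_tendstoD(2)[of _ "M * 0"]) auto
    moreover have "\<forall>\<^sub>F \<mu> in at_right (0::real). \<mu> < 1" by (rule eventually_at_right_real[of 0 1, THEN eventually_mono]) auto
    ultimately have "\<forall>\<^sub>F \<mu> in at_right 0. M * \<mu> powr (1 - a) < \<eta> / 2 * k \<and> M * e \<mu> < \<eta> / 2 \<and> \<mu> < 1"
      by eventually_elim auto
    then obtain \<delta> where \<delta>: "\<delta> > 0" "\<And>\<mu>. 0 < \<mu> \<Longrightarrow> \<mu> < \<delta> \<Longrightarrow> M * \<mu> powr (1 - a) < \<eta> / 2 * k \<and> M * e \<mu> < \<eta> / 2 \<and> \<mu> < 1"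
      by (auto simp: eventually_at_right_field)
    have "e (\<mu> / (real l)\<^sup>2) \<le> (1 + 2 * \<eta>) * real l powr (- 2 * a) * e \<mu>" if \<mu>: "0 < \<mu>" "\<mu> < \<delta>" and l: "l \<ge> 1" for \<mu> l
    proof -
      note 1 = \<delta>(2)[OF \<mu>]
      have ke: "k * \<mu> powr a \<le> e \<mu>" using k_le[of \<mu>] \<mu> 1 by auto
      hence epos: "e \<mu> \<ge> 0" using k by (smt (verit) mult_nonneg_nonneg powr_ge_zero)
      have "M * (e \<mu>)\<^sup>2 \<le> \<eta> / 2 * e \<mu>"
        using mult_right_mono[of "M * e \<mu>" "\<eta> / 2" "e \<mu>"] 1 epos by (simp add: power2_eq_square)
      moreover have "M * \<mu> \<le> \<eta> / 2 * e \<mu>"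
      proof -
        have "M * \<mu> = M * \<mu> powr (1 - a) * \<mu> powr a" using \<mu> by (simp add: powr_add[symmetric])
        also have "\<dots> \<le> \<eta> / 2 * k * \<mu> powr a" using 1 by (intro mult_right_mono) auto
        also have "\<dots> \<le> \<eta> / 2 * e \<mu>" using ke \<eta> by (simp add: mult.assoc)
        finally show ?thesis .
      qed
      ultimately have "(1 + \<eta>) * e \<mu> + M * ((e \<mu>)\<^sup>2 + \<mu>) \<le> (1 + 2 * \<eta>) * e \<mu>" by (simp add: algebra_simps)
      hence "real l powr (- 2 * a) * ((1 + \<eta>) * e \<mu> + M * ((e \<mu>)\<^sup>2 + \<mu>)) \<le> real l powr (- 2 * a) * ((1 + 2 * \<eta>) * e \<mu>)"
        by (intro mult_left_mono) auto
      with M_le[OF l \<mu>(1)] show ?thesis by (simp add: mult_ac)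
    qed
    thus ?thesis using \<delta>(1) by blast
  qed
  define q where "q \<mu> = e \<mu> / \<mu> powr a" for \<mu>
  have "\<exists>\<kappa>>0. (q \<longlongrightarrow> \<kappa>) (at_right 0)"
  proof (rule almost_monotone_tendsto[OF k])
    show "\<forall>\<^sub>F t in at_right 0. k \<le> q t"
      by (rule eventually_at_right_real[of 0 1, THEN eventually_mono])
        (use k_le in \<open>auto simp: q_def pos_le_divide_eq\<close>)
    fix \<eta> :: real assume \<eta>: "0 < \<eta>" "\<eta> \<le> 1"
    \<comment> \<open>The losses \<open>1 + 2 \<nu>\<close> from stretching and
      \<open>1 + \<nu>\<close> from rounding multiply to at most \<open>1 + \<eta>\<close>. For
      \<open>l \<ge> \<Lambda>\<close> the rounding loss is
      \<open>(1 + 1/l)^2 \<le> 1 + 3/l \<le> 1 + \<nu>\<close>.\<close>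
    define \<nu> where "\<nu> = \<eta> / 4"
    have \<nu>: "0 < \<nu>" "\<nu> \<le> 1" using \<eta> by (simp_all add: \<nu>_def)
    obtain \<delta> where \<delta>: "\<delta> > 0" "\<And>\<mu> l. 0 < \<mu> \<Longrightarrow> \<mu> < \<delta> \<Longrightarrow> 1 \<le> l \<Longrightarrow>
        e (\<mu> / (real l)\<^sup>2) \<le> (1 + 2 * \<nu>) * real l powr (- 2 * a) * e \<mu>"
      using stretch[OF \<nu>] by blast
    define \<Lambda> where "\<Lambda> = nat \<lceil>3 / \<nu>\<rceil>"
    have \<Lambda>: "real \<Lambda> \<ge> 3 / \<nu>" by (simp add: \<Lambda>_def of_nat_ceiling)
    have \<Lambda>1: "\<Lambda> \<ge> 1" using \<Lambda> \<nu> by (metis One_nat_def Suc_leI divide_pos_pos gr0I less_le_not_le of_nat_0 zero_less_numeral)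
    show "\<exists>\<delta>>0. \<forall>\<mu>. 0 < \<mu> \<longrightarrow> \<mu> < \<delta> \<longrightarrow> (\<forall>\<^sub>F t in at_right 0. q t \<le> (1 + \<eta>) * q \<mu>)"
    proof (intro exI[of _ "min \<delta> 1"] conjI allI impI)
      fix \<mu> assume \<mu>: "0 < \<mu>" "\<mu> < min \<delta> 1"
      have e\<mu>: "e \<mu> > 0" using k_le[of \<mu>] \<mu> k by (smt (verit) min_less_iff_conj mult_pos_pos powr_gt_zero)
      have "q t \<le> (1 + \<eta>) * q \<mu>" if t: "0 < t" "t < \<mu> / (real \<Lambda>)\<^sup>2" for t
      proof -
        \<comment> \<open>The ideal stretching factor \<open>z\<close> is rounded down to
          \<open>l\<close>, so \<open>t \<le> \<mu> / l^2\<close> and monotonicity of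
          \<open>e\<close> applies.\<close>
        define z where "z = sqrt (\<mu> / t)"
        have z2: "z\<^sup>2 = \<mu> / t" using \<mu> t by (simp add: z_def)
        have "(real \<Lambda>)\<^sup>2 \<le> \<mu> / t" using t \<Lambda>1 by (simp add: field_simps)
        hence z\<Lambda>: "z \<ge> real \<Lambda>" unfolding z_def by (rule real_le_rsqrt)
        define l where "l = nat \<lfloor>z\<rfloor>"
        have l: "l \<ge> \<Lambda>" "real l \<le> z" "z \<le> real l + 1" using z\<Lambda> unfolding l_def by linarith+
        have l1: "l \<ge> 1" using l \<Lambda>1 by simp
        have l0: "real l > 0" using l1 by simp
        have "(real l)\<^sup>2 \<le> z\<^sup>2" using l by (intro power_mono) auto
        hence "t \<le> \<mu> / (real l)\<^sup>2" unfolding z2 using t l0 by (simp add: field_simps)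
        hence "e t \<le> e (\<mu> / (real l)\<^sup>2)" using t by (intro e_mono)
        also have "\<dots> \<le> (1 + 2 * \<nu>) * real l powr (- 2 * a) * e \<mu>" using \<delta>(2)[of \<mu> l] \<mu> l1 by auto
        finally have "q t \<le> (1 + 2 * \<nu>) * real l powr (- 2 * a) * e \<mu> / t powr a"
          unfolding q_def by (simp add: divide_right_mono)
        also have "\<dots> = (1 + 2 * \<nu>) * q \<mu> * ((\<mu> / t) powr a * real l powr (- 2 * a))"
          using \<mu> t by (simp add: q_def powr_divide)
        also have "(\<mu> / t) powr a * real l powr (- 2 * a) = (z / real l) powr (2 * a)"
        proof -
          have "(\<mu> / t) powr a = (z powr 2) powr a"
            unfolding z2[symmetric] using z\<Lambda> \<Lambda>1 by simp
          also have "\<dots> = z powr (2 * a)" by (rule powr_powr)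
          finally have "(\<mu> / t) powr a = z powr (2 * a)" .
          thus ?thesis using z\<Lambda> l0 by (simp add: powr_divide powr_minus divide_simps)
        qed
        also have "\<dots> \<le> 1 + \<nu>"
        proof -
          have "1 \<le> z / real l" using l l0 by simp
          hence "(z / real l) powr (2 * a) \<le> (z / real l) powr 2" using a by (intro powr_mono) auto
          also have "\<dots> = (z / real l)\<^sup>2" using \<open>1 \<le> z / real l\<close> by simp
          also have "\<dots> \<le> (1 + 1 / real l)\<^sup>2" using l l0 \<open>1 \<le> z / real l\<close> by (intro power_mono) (auto simp: field_simps)
          also have "\<dots> \<le> 1 + 3 / real l" using l0 l1 by (simp add: power2_eq_square field_simps)
          also have "3 / real l \<le> \<nu>"
          proof -
            have "3 / \<nu> \<le> real l" using \<Lambda> l by linarith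
            thus ?thesis using \<nu> l0 by (simp add: field_simps)
          qed
          finally show ?thesis by simp
        qed
        also have "(1 + 2 * \<nu>) * q \<mu> * (1 + \<nu>) \<le> (1 + \<eta>) * q \<mu>"
        proof -
          have "\<nu> * \<nu> \<le> \<nu> * (1/4)" using \<eta> \<nu> by (intro mult_left_mono) (auto simp: \<nu>_def)
          hence "(1 + 2 * \<nu>) * (1 + \<nu>) \<le> 1 + 4 * \<nu>" using \<nu> by (simp add: algebra_simps)
          also have "4 * \<nu> = \<eta>" by (simp add: \<nu>_def)
          finally have "(1 + 2 * \<nu>) * (1 + \<nu>) \<le> 1 + \<eta>" .
          moreover have "q \<mu> \<ge> 0" using e\<mu> by (simp add: q_def)
          ultimately have "(1 + 2 * \<nu>) * (1 + \<nu>) * q \<mu> \<le> (1 + \<eta>) * q \<mu>" by (rule mult_right_mono)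
          thus ?thesis by (simp add: mult_ac)
        qed
        finally show ?thesis using mult_left_mono[of _ _ "(1 + 2 * \<nu>) * q \<mu>"] \<nu> e\<mu>
          by (simp add: q_def)
      qed
      thus "\<forall>\<^sub>F t in at_right 0. q t \<le> (1 + \<eta>) * q \<mu>"
        using \<mu> \<Lambda>1 by (auto simp: eventually_at_right_field intro!: exI[of _ "\<mu> / (real \<Lambda>)\<^sup>2"])
    qed (use \<delta> in auto)
  qed
  thus ?thesis by (simp add: q_def[abs_def] a_def)
qed

end

section \<open>Infinite resistance and vanishing flux\<close>

context power_network
begin

lemma sum_inverse_C_at_top: "filterlim (\<lambda>N. \<Sum>p=1..N. 1 / C p) at_top sequentially"
proof -
  obtain MC where MC: "MC > 0" "\<And>p. p \<ge> 1 \<Longrightarrow> C p \<le> MC * real p powr s"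
    using powr_asymp_bounds[OF C_pos A C_asymp] by blast
  obtain k where k: "k > 0" "\<And>n. n \<ge> 1 \<Longrightarrow> k * real n powr (1 - s) \<le> (\<Sum>p=1..n. real p powr (- s))"
    using sum_powr_ge[of "- s"] s by auto
  have "filterlim (\<lambda>N. k / MC * real N powr (1 - s)) at_top sequentially"
  proof (rule filterlim_tendsto_pos_mult_at_top[OF tendsto_const])
    have "1 - s > 0" using s by simp
    thus "filterlim (\<lambda>N. real N powr (1 - s)) at_top sequentially" by real_asymp
  qed (use k(1) MC(1) in simp)
  thus ?thesis
  proof (rule filterlim_at_top_mono)
    show "\<forall>\<^sub>F N in sequentially. k / MC * real N powr (1 - s) \<le> (\<Sum>p=1..N. 1 / C p)"
    proof (rule eventually_mono[OF eventually_ge_at_top[of 1]])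
      fix N :: nat assume "N \<ge> 1"
      hence "k / MC * real N powr (1 - s) \<le> 1 / MC * (\<Sum>p=1..N. real p powr (- s))"
        using k(2)[of N] MC(1) by (simp add: divide_right_mono)
      also have "\<dots> = (\<Sum>p=1..N. real p powr (- s) / MC)" by (simp add: sum_divide_distrib)
      also have "\<dots> \<le> (\<Sum>p=1..N. 1 / C p)"
      proof (rule sum_mono)
        fix p assume p: "p \<in> {1..N}"
        hence "C p \<le> MC * real p powr s" "C p > 0" "real p powr s > 0" using MC(2) C_pos by auto
        thus "real p powr (- s) / MC \<le> 1 / C p" using MC(1) by (simp add: powr_minus field_simps)
      qed
      finally show "k / MC * real N powr (1 - s) \<le> (\<Sum>p=1..N. 1 / C p)" .
    qed
  qed
qed

text \<open>Since \<open>\<Sum>p. 1 / C p\<close> diverges, a nonvanishing flux would make \<open>\<phi>\<close> unbounded.\<close>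

lemma flux_tendsto_0:
  assumes dec: "decseq J" and J: "\<And>p. p \<ge> 1 \<Longrightarrow> C p * (\<phi> p - \<phi> (p + 1)) = J p"
    and \<phi>: "\<And>p. p \<ge> 1 \<Longrightarrow> 0 \<le> \<phi> p \<and> \<phi> p \<le> k"
  shows "J \<longlonglongrightarrow> 0"
proof -
  have tel: "\<phi> q - \<phi> (q + n) = (\<Sum>p=q..<q+n. J p / C p)" if "q \<ge> 1" for q n
  proof (induction n)
    case (Suc n)
    have "J (q + n) / C (q + n) = \<phi> (q + n) - \<phi> (q + n + 1)"
      using J[of "q + n"] C_pos[of "q + n"] that by (simp add: field_simps)
    with Suc show ?case by simp
  qed simp
  have bd: "\<bar>\<Sum>p=q..<q+n. J p / C p\<bar> \<le> k" if "q \<ge> 1" for q n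
    unfolding tel[OF that, symmetric] using \<phi>[of q] \<phi>[of "q + n"] that by auto
  have div: "\<exists>n. (\<Sum>p=q..<q+n. 1 / C p) > b" if "q \<ge> 1" for q b
  proof -
    define S where "S = (\<Sum>p=1..<q. 1 / C p)"
    have "\<forall>\<^sub>F N in sequentially. (\<Sum>p=1..N. 1 / C p) > S + b"
      using sum_inverse_C_at_top by (simp add: filterlim_at_top_dense)
    with eventually_ge_at_top[of q] have "\<forall>\<^sub>F N in sequentially. N \<ge> q \<and> (\<Sum>p=1..N. 1 / C p) > S + b"
      by eventually_elim auto
    then obtain N where N: "N \<ge> q" "(\<Sum>p=1..N. 1 / C p) > S + b"
      by (auto simp: eventually_at_top_linorder)
    have "{1..N} = {1..<q} \<union> {q..<q + (N + 1 - q)}" using N(1) that by auto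
    hence "(\<Sum>p=1..N. 1 / C p) = S + (\<Sum>p=q..<q + (N + 1 - q). 1 / C p)"
      unfolding S_def by (simp only:) (subst sum.union_disjoint, auto)
    thus ?thesis using N(2) by (intro exI[of _ "N + 1 - q"]) simp
  qed
  \<comment> \<open>A negative flux stays at most \<open>J q\<close> by monotonicity, and over an
    infinite resistance it would drive \<phi> above its bound. The argument starts at
    \<open>q \<ge> 1\<close>, as \<open>J 0\<close> is not attached to a bond.\<close>
  have nonneg: "J q \<ge> 0" if "q \<ge> 1" for q
  proof (rule ccontr)
    assume "\<not> J q \<ge> 0"
    hence neg: "J q < 0" by simp
    obtain n where n: "(\<Sum>p=q..<q+n. 1 / C p) > k / - J q" using div[OF \<open>q \<ge> 1\<close>] by blast
    have "(\<Sum>p=q..<q+n. J p / C p) \<le> (\<Sum>p=q..<q+n. J q * (1 / C p))"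
    proof (rule sum_mono)
      fix p assume "p \<in> {q..<q+n}"
      hence "J p \<le> J q" using dec by (auto simp: decseq_def)
      thus "J p / C p \<le> J q * (1 / C p)" using C_nonneg[of p] by (simp add: divide_right_mono)
    qed
    also have "\<dots> = J q * (\<Sum>p=q..<q+n. 1 / C p)" by (simp add: sum_distrib_left)
    also have "\<dots> < - k" using n neg by (simp add: field_simps)
    finally show False using bd[OF \<open>q \<ge> 1\<close>, of n] by simp
  qed
  have "J q \<ge> 0" for q
    using nonneg[of "Suc q"] dec by (auto simp: decseq_Suc_iff intro: order.trans)
  then obtain L where L: "J \<longlonglongrightarrow> L" "\<And>i. L \<le> J i" using decseq_convergent[OF dec, of 0] by auto
  have "L \<ge> 0" using LIMSEQ_le_const[OF L(1), of 0] \<open>\<And>q. J q \<ge> 0\<close> by auto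
  moreover have "\<not> L > 0"
  proof
    assume "L > 0"
    obtain n where n: "(\<Sum>p=1..<1+n. 1 / C p) > k / L" using div[of 1] by auto
    have "k < L * (\<Sum>p=1..<1+n. 1 / C p)" using n \<open>L > 0\<close> by (simp add: field_simps)
    also have "\<dots> = (\<Sum>p=1..<1+n. L * (1 / C p))" by (rule sum_distrib_left)
    also have "\<dots> \<le> (\<Sum>p=1..<1+n. J p / C p)"
      by (rule sum_mono) (use L(2) C_nonneg in \<open>auto simp: divide_right_mono\<close>)
    finally show False using bd[of 1 n] by auto
  qed
  ultimately show ?thesis using L(1) by (simp add: order.order_iff_strict)
qed

end

section \<open>The subcritical Green function through the h-transform\<close>

context critical_jacobi
begin

lemma c_tendsto: "c \<longlonglongrightarrow> 1 / 2"
proof -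
  have "(\<lambda>p. c p - (1 / 2 + (1 - 4 * \<alpha>\<^sup>2) / 16 / (real p)\<^sup>2)) \<in> o(\<lambda>_. 1)"
  proof (rule landau_o.big_small_trans[OF c_asymp], rule smalloI_tendsto)
    show "((\<lambda>p. real p powr (- 2 - \<zeta>) / 1) \<longlonglongrightarrow> 0)"
      using tendsto_neg_powr[OF _ filterlim_real_sequentially, of "- 2 - \<zeta>"] \<zeta> by simp
  qed simp
  hence 1: "(\<lambda>p. c p - (1 / 2 + (1 - 4 * \<alpha>\<^sup>2) / 16 / (real p)\<^sup>2)) \<longlonglongrightarrow> 0"
    by (auto dest: smalloD_tendsto)
  have 2: "(\<lambda>p::nat. 1 / 2 + (1 - 4 * \<alpha>\<^sup>2) / 16 / (real p)\<^sup>2) \<longlonglongrightarrow> 1 / 2" by real_asymp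
  from tendsto_add[OF 1 2] show ?thesis by simp
qed

text \<open>Division by \<open>h\<close> turns the resolvent equation for \<open>g = green x\<close>
  into divergence form: conductances \<open>c p * h p * h (p + 1)\<close>, masses
  \<open>h^2\<close>, killing rate \<mu>, and as flux the Wronskian of \<open>g\<close> and
  \<open>h\<close>. With \<open>s = 1 - 2 \<alpha>\<close> the energy exponent
  \<open>(1 - s) / 2\<close> is \<alpha>.\<close>

theorem green_asymp: "\<exists>\<kappa>>0. ((\<lambda>\<mu>. (h 1 - green (1 / (1 + \<mu>)) 1) / \<mu> powr \<alpha>) \<longlongrightarrow> \<kappa>) (at_right 0)"
proof -
  obtain \<kappa> where \<kappa>: "\<kappa> > 0" "(\<lambda>p. h p / real p powr (1/2 - \<alpha>)) \<longlonglongrightarrow> \<kappa>" using h_asymp by blast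
  define C where "C p = c p * h p * h (p + 1)" for p
  define m where "m p = (h p)\<^sup>2" for p
  have sq: "real p powr (1/2 - \<alpha>) * real p powr (1/2 - \<alpha>) = real p powr (1 - 2 * \<alpha>)" for p
    by (simp add: powr_add[symmetric])
  interpret power_network C m "1/2 * \<kappa> * \<kappa>" "\<kappa> * \<kappa>" "1 - 2 * \<alpha>"
  proof
    show "C p > 0" "m p > 0" if "p \<ge> 1" for p
      using that c_pos[of p] h_pos[of p] h_pos[of "p + 1"] by (simp_all add: C_def m_def)
    have "(\<lambda>p. h p / real p powr (1/2 - \<alpha>) * (h p / real p powr (1/2 - \<alpha>))) \<longlonglongrightarrow> \<kappa> * \<kappa>"
      by (intro tendsto_mult \<kappa>)
    thus "(\<lambda>p. m p / real p powr (1 - 2 * \<alpha>)) \<longlonglongrightarrow> \<kappa> * \<kappa>"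
      by (simp add: m_def power2_eq_square sq)
    have "(\<lambda>p. h (Suc p) / real (Suc p) powr (1/2 - \<alpha>)) \<longlonglongrightarrow> \<kappa>"
      by (rule LIMSEQ_Suc[OF \<kappa>(2)])
    moreover have "(\<lambda>p. real (Suc p) powr (1/2 - \<alpha>) / real p powr (1/2 - \<alpha>)) \<longlonglongrightarrow> 1"
      by real_asymp
    ultimately have "(\<lambda>p. h (Suc p) / real (Suc p) powr (1/2 - \<alpha>) * (real (Suc p) powr (1/2 - \<alpha>) / real p powr (1/2 - \<alpha>))) \<longlonglongrightarrow> \<kappa> * 1"
      by (rule tendsto_mult)
    hence "(\<lambda>p. h (p + 1) / real p powr (1/2 - \<alpha>)) \<longlonglongrightarrow> \<kappa>"
      by (simp del: of_nat_Suc)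
    hence "(\<lambda>p. c p * (h p / real p powr (1/2 - \<alpha>)) * (h (p + 1) / real p powr (1/2 - \<alpha>))) \<longlonglongrightarrow> 1/2 * \<kappa> * \<kappa>"
      by (intro tendsto_mult \<kappa> c_tendsto)
    thus "(\<lambda>p. C p / real p powr (1 - 2 * \<alpha>)) \<longlonglongrightarrow> 1/2 * \<kappa> * \<kappa>"
      by (simp add: C_def sq)
  qed (use \<alpha> \<kappa> in \<open>auto simp: C_def m_def c_0 h_0\<close>)
  define e where "e \<mu> = (h 1 - green (1 / (1 + \<mu>)) 1) * (h 1 / green (1 / (1 + \<mu>)) 1)" for \<mu>
  have flux: "\<exists>\<phi> J. flux_solution \<mu> \<phi> J \<and> J 0 = e \<mu>" if \<mu>: "\<mu> > 0" for \<mu>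
  proof -
    define x where "x = 1 / (1 + \<mu>)"
    have x: "0 < x" "x \<le> 1" "1 / x = 1 + \<mu>" using \<mu> by (simp_all add: x_def)
    define g where "g = green x"
    have g_pos: "g p > 0" if "p \<ge> 1" for p unfolding g_def by (rule green_pos) (use x that in auto)
    have g_le: "g p \<le> h p" for p unfolding g_def by (rule green_mono) (use x in auto)
    have g_eq: "R g p = (1 + \<mu>) * g p - unit_vec 1 p" for p
      using green_eq[OF x(1,2)] x(3) by (simp add: g_def divide_inverse mult.commute)
    \<comment> \<open>Normalises \<open>\<phi> 1 = 1\<close>; since \<open>g \<le> h\<close>, the
      same \<open>k\<close> bounds \<phi>, as the vanishing of the flux requires.\<close>
    define k where "k = h 1 / g 1"
    have k: "k > 0" using h_pos[of 1] g_pos[of 1] by (simp add: k_def)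
    define \<phi> where "\<phi> p = g p / h p * k" for p
    \<comment> \<open>There is no bond at 0: \<open>J 0\<close> comes from the unit sources at 1,
      which do not cancel in the Wronskian identity because \<open>g\<close> and \<open>h\<close>
      differ there. It is \<open>h 1 - g 1\<close> times a factor \<open>k\<close> that tends to
      1.\<close>
    define J where "J p = (if p = 0 then (h 1 - g 1) * k else c p * (h (p + 1) * g p - h p * g (p + 1)) * k)" for p
    have CJ: "C p * (\<phi> p - \<phi> (p + 1)) = J p" if "p \<ge> 1" for p
      using that h_pos[of p] h_pos[of "p + 1"] by (simp add: C_def \<phi>_def J_def field_simps)
    have JJ: "J (p - 1) - J p = \<mu> * m p * \<phi> p" if "p \<ge> 1" for p
    proof -
      obtain q where q: "p = Suc q" using \<open>p \<ge> 1\<close> by (cases p) auto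
      have wr: "c q * (h p * g q - h q * g p) - c p * (h (p + 1) * g p - h p * g (p + 1)) = R g p * h p - R h p * g p"
        by (simp add: q jac_Suc algebra_simps)
      have "J (p - 1) - J p = \<mu> * h p * g p * k"
      proof (cases "q = 0")
        case True
        have "J (p - 1) - J p = (h 1 - g 1 - c 1 * (h 2 * g 1 - h 1 * g 2)) * k"
          by (simp add: J_def q True algebra_simps numeral_2_eq_2)
        also have "c 1 * (h 2 * g 1 - h 1 * g 2) = R h 1 * g 1 - R g 1 * h 1"
          using wr by (simp add: q True c_0 algebra_simps numeral_2_eq_2)
        finally show ?thesis by (simp add: g_eq h_eq q True unit_vec_def algebra_simps)
      next
        case False
        hence "J (p - 1) - J p = (R g p * h p - R h p * g p) * k"
          unfolding wr[symmetric] by (simp add: J_def q algebra_simps)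
        thus ?thesis using False by (simp add: g_eq h_eq q unit_vec_def algebra_simps)
      qed
      thus ?thesis using h_pos[OF that] by (simp add: m_def \<phi>_def power2_eq_square)
    qed
    have "decseq J"
    proof (rule decseq_SucI)
      fix n
      have "\<mu> * m (Suc n) * \<phi> (Suc n) \<ge> 0"
        using \<mu> k h_pos[of "Suc n"] g_pos[of "Suc n"] by (simp add: m_def \<phi>_def)
      thus "J (Suc n) \<le> J n" using JJ[of "Suc n"] by simp
    qed
    moreover have \<phi>: "0 \<le> \<phi> p" "\<phi> p \<le> k" if "p \<ge> 1" for p
      using g_pos[OF that] g_le[of p] h_pos[OF that] k by (simp_all add: \<phi>_def field_simps)
    ultimately have "J \<longlonglongrightarrow> 0" using CJ by (intro flux_tendsto_0[of J \<phi> k]) auto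
    moreover have "\<phi> 1 = 1" using h_pos[of 1] g_pos[of 1] by (simp add: \<phi>_def k_def)
    ultimately have "flux_solution \<mu> \<phi> J" unfolding flux_solution_def using CJ JJ \<phi> by blast
    moreover have "J 0 = e \<mu>" by (simp add: J_def e_def k_def g_def x_def)
    ultimately show ?thesis by blast
  qed
  have "filterlim (\<lambda>\<mu>::real. 1 / (1 + \<mu>)) (at_left 1) (at_right 0)"
    by real_asymp
  from filterlim_compose[OF green_tendsto_1[of 1] this]
  have g: "((\<lambda>\<mu>. green (1 / (1 + \<mu>)) 1) \<longlongrightarrow> h 1) (at_right 0)" .
  have "(e \<longlongrightarrow> (h 1 - h 1) * (h 1 / h 1)) (at_right 0)"
    unfolding e_def[abs_def] using h_pos[of 1] by (intro tendsto_intros g) auto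
  hence "(e \<longlongrightarrow> 0) (at_right 0)" by simp
  from flux_asymp[OF flux this] obtain \<kappa>' where \<kappa>': "\<kappa>' > 0" "((\<lambda>\<mu>. e \<mu> / \<mu> powr \<alpha>) \<longlongrightarrow> \<kappa>') (at_right 0)"
    by auto
  have "((\<lambda>\<mu>. e \<mu> / \<mu> powr \<alpha> * (green (1 / (1 + \<mu>)) 1 / h 1)) \<longlongrightarrow> \<kappa>' * (h 1 / h 1)) (at_right 0)"
    using h_pos[of 1] by (intro tendsto_intros \<kappa>' g) auto
  moreover have "\<forall>\<^sub>F \<mu> in at_right 0. e \<mu> / \<mu> powr \<alpha> * (green (1 / (1 + \<mu>)) 1 / h 1)
      = (h 1 - green (1 / (1 + \<mu>)) 1) / \<mu> powr \<alpha>"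
  proof (rule eventually_mono[OF eventually_at_right_less])
    fix \<mu> :: real assume "0 < \<mu>"
    hence "green (1 / (1 + \<mu>)) 1 > 0" by (intro green_pos) auto
    thus "e \<mu> / \<mu> powr \<alpha> * (green (1 / (1 + \<mu>)) 1 / h 1) = (h 1 - green (1 / (1 + \<mu>)) 1) / \<mu> powr \<alpha>"
      using h_pos[of 1] by (simp add: e_def)
  qed
  ultimately have "((\<lambda>\<mu>. (h 1 - green (1 / (1 + \<mu>)) 1) / \<mu> powr \<alpha>) \<longlongrightarrow> \<kappa>' * (h 1 / h 1)) (at_right 0)"
    by (rule Lim_transform_eventually)
  thus ?thesis using \<kappa>'(1) h_pos[of 1] by (intro exI[of _ \<kappa>']) simp
qed

end

section \<open>The generating function of loops\<close>

text \<open>By monotonicity \<open>H' y\<close> lies between the difference quotients of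
  \<open>H\<close> over \<open>[y, l y]\<close> with \<open>l > 1\<close> and over
  \<open>[l y, y]\<close> with \<open>l < 1\<close>. After scaling these tend to
  \<open>K (l^\<alpha> - 1) / (l - 1)\<close>, and letting \<open>l\<close> tend to 1 gives
  \<open>K \<alpha>\<close> from both sides.\<close>

lemma monotone_density:
  fixes H H' :: "real \<Rightarrow> real"
  assumes deriv: "\<And>y. 0 < y \<Longrightarrow> y < 1 \<Longrightarrow> (H has_real_derivative H' y) (at y)"
    and anti: "\<And>y z. 0 < y \<Longrightarrow> y \<le> z \<Longrightarrow> z < 1 \<Longrightarrow> H' z \<le> H' y"
    and K: "K > 0" and lim: "((\<lambda>y. H y / y powr \<alpha>) \<longlongrightarrow> K) (at_right 0)"
  shows "((\<lambda>y. H' y * y powr (1 - \<alpha>)) \<longlongrightarrow> K * \<alpha>) (at_right 0)"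
proof -
  have scaled: "((\<lambda>y. H (l * y) / y powr \<alpha>) \<longlongrightarrow> K * l powr \<alpha>) (at_right 0)" if "l > 0" for l
  proof -
    have "filterlim (\<lambda>y. l * y) (at_right 0) (at_right 0)"
      using that by real_asymp
    from filterlim_compose[OF lim this]
    have "((\<lambda>y. H (l * y) / (l * y) powr \<alpha> * l powr \<alpha>) \<longlongrightarrow> K * l powr \<alpha>) (at_right 0)"
      by (intro tendsto_intros)
    moreover have "\<forall>\<^sub>F y in at_right 0. H (l * y) / (l * y) powr \<alpha> * l powr \<alpha> = H (l * y) / y powr \<alpha>"
      by (rule eventually_mono[OF eventually_at_right_less]) (use that in \<open>simp add: powr_mult\<close>)
    ultimately show ?thesis by (rule Lim_transform_eventually)
  qed
  have slope: "((\<lambda>y. (H (l * y) - H y) / ((l - 1) * y powr \<alpha>)) \<longlongrightarrow> K * ((l powr \<alpha> - 1) / (l - 1))) (at_right 0)"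
    if "l > 0" "l \<noteq> 1" for l
  proof -
    have "((\<lambda>y. (H (l * y) / y powr \<alpha> - H y / y powr \<alpha>) / (l - 1)) \<longlongrightarrow> (K * l powr \<alpha> - K) / (l - 1)) (at_right 0)"
      by (intro tendsto_intros scaled lim) (use that in auto)
    thus ?thesis by (simp add: diff_divide_distrib[symmetric] right_diff_distrib mult.commute)
  qed
  have small: "\<forall>\<^sub>F y in at_right (0::real). 0 < y \<and> y < b" if "b > 0" for b
    using that unfolding eventually_at_right_field by (intro exI[of _ b]) auto
  have "((\<lambda>l. (l powr \<alpha> - 1 powr \<alpha>) / (l - 1)) \<longlongrightarrow> \<alpha> * 1 powr (\<alpha> - 1)) (at 1)"
    using DERIV_powr[of "\<lambda>x::real. x" 1 1 "\<lambda>_. \<alpha>" 0]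
    by (subst has_field_derivative_iff[symmetric]) (auto intro!: derivative_eq_intros)
  hence "((\<lambda>l. K * ((l powr \<alpha> - 1) / (l - 1))) \<longlongrightarrow> K * \<alpha>) (at 1)"
    by (intro tendsto_mult_left) simp
  hence tR: "((\<lambda>l. K * ((l powr \<alpha> - 1) / (l - 1))) \<longlongrightarrow> K * \<alpha>) (at_right 1)"
    and tL: "((\<lambda>l. K * ((l powr \<alpha> - 1) / (l - 1))) \<longlongrightarrow> K * \<alpha>) (at_left 1)"
    by (auto intro: filterlim_mono at_le)
  have mvt: "\<exists>\<xi>. y < \<xi> \<and> \<xi> < z \<and> H z - H y = (z - y) * H' \<xi>" if "0 < y" "y < z" "z < 1" for y z
    using MVT2[OF that(2), of H H'] deriv that by force
  have powr1: "y * y powr - \<alpha> = y powr (1 - \<alpha>)" if "y > 0" for y :: real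
    using that by (simp add: powr_diff powr_minus_divide)
  show ?thesis
  proof (rule order_tendstoI)
    fix a assume "a < K * \<alpha>"
    hence "\<forall>\<^sub>F l in at_right 1. a < K * ((l powr \<alpha> - 1) / (l - 1))" using order_tendstoD(1)[OF tR] by blast
    from eventually_happens'[OF _ eventually_conj[OF this eventually_at_right_less]]
    obtain l where l: "a < K * ((l powr \<alpha> - 1) / (l - 1))" "l > 1" by auto
    have "\<forall>\<^sub>F y in at_right 0. a < (H (l * y) - H y) / ((l - 1) * y powr \<alpha>)"
      using order_tendstoD(1)[OF slope l(1)] l(2) by simp
    moreover have "\<forall>\<^sub>F y in at_right 0. 0 < y \<and> y < 1 / l" using l by (intro small) simp
    ultimately show "\<forall>\<^sub>F y in at_right 0. a < H' y * y powr (1 - \<alpha>)"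
    proof (eventually_elim, goal_cases)
      case (1 y)
      hence y: "0 < y" "y < l * y" "l * y < 1" using l(2) by (auto simp: field_simps)
      obtain \<xi> where \<xi>: "y < \<xi>" "\<xi> < l * y" "H (l * y) - H y = (l * y - y) * H' \<xi>" using mvt[OF y] by blast
      have "H' \<xi> \<le> H' y" using \<xi> y by (intro anti) auto
      have "(H (l * y) - H y) / ((l - 1) * y powr \<alpha>) = H' \<xi> * y powr (1 - \<alpha>)"
        unfolding \<xi>(3) powr1[OF y(1), symmetric] using l y by (simp add: powr_minus field_simps)
      also have "\<dots> \<le> H' y * y powr (1 - \<alpha>)" using \<open>H' \<xi> \<le> H' y\<close> by (intro mult_right_mono) auto
      finally show ?case using 1 by simp
    qed
  next
    fix a assume "a > K * \<alpha>"
    hence "\<forall>\<^sub>F l in at_left 1. a > K * ((l powr \<alpha> - 1) / (l - 1))" using order_tendstoD(2)[OF tL] by blast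
    moreover have "\<forall>\<^sub>F l in at_left (1::real). 0 < l \<and> l < 1"
      unfolding eventually_at_left_field by (intro exI[of _ 0]) auto
    ultimately have "\<exists>l. a > K * ((l powr \<alpha> - 1) / (l - 1)) \<and> 0 < l \<and> l < 1"
      by (intro eventually_happens'[OF _ eventually_conj]) auto
    then obtain l where l: "a > K * ((l powr \<alpha> - 1) / (l - 1))" "0 < l" "l < 1" by auto
    have "\<forall>\<^sub>F y in at_right 0. a > (H (l * y) - H y) / ((l - 1) * y powr \<alpha>)"
      using order_tendstoD(2)[OF slope l(1)] l by simp
    moreover have "\<forall>\<^sub>F y in at_right (0::real). 0 < y \<and> y < 1" by (intro small) simp
    ultimately show "\<forall>\<^sub>F y in at_right 0. H' y * y powr (1 - \<alpha>) < a"
    proof (eventually_elim, goal_cases)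
      case (1 y)
      hence y: "0 < l * y" "l * y < y" "y < 1" using l by auto
      obtain \<xi> where \<xi>: "l * y < \<xi>" "\<xi> < y" "H y - H (l * y) = (y - l * y) * H' \<xi>" using mvt[OF y] by blast
      have le: "H' y \<le> H' \<xi>" using \<xi> y by (intro anti) auto
      have e: "H (l * y) - H y = (l - 1) * y * H' \<xi>" using \<xi>(3) by (simp add: algebra_simps)
      have "H' y * y powr (1 - \<alpha>) \<le> H' \<xi> * y powr (1 - \<alpha>)" using le by (intro mult_right_mono) auto
      also have "\<dots> = (H (l * y) - H y) / ((l - 1) * y powr \<alpha>)"
        unfolding e powr1[of y, symmetric, OF conjunct1[OF 1(2)]] using l 1 by (simp add: powr_minus field_simps)
      finally show ?case using 1 by simp
    qed
  qed
qed

context transient_jacobi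
begin

text \<open>Excursions of length \<open>n\<close> from the origin: two steps join 0 and 1, the other
  \<open>n - 2\<close> form a loop of \<open>R\<close> at 1. The weight \<open>1 / (4 b0 b1)\<close>
  of the joining steps is left out, so that the series does not involve the parameter.\<close>

definition loop_coeff :: "nat \<Rightarrow> real" where
  "loop_coeff n = (if n < 2 then 0 else (R ^^ (n - 2)) (unit_vec 1) 1)"

definition loop_gf :: "real \<Rightarrow> real" where
  "loop_gf x = (\<Sum>n. loop_coeff n * x ^ n)"

definition loop_gf' :: "real \<Rightarrow> real" where
  "loop_gf' x = (\<Sum>n. diffs loop_coeff n * x ^ n)"

lemma loop_coeff_nonneg: "loop_coeff n \<ge> 0"
  by (simp add: loop_coeff_def R_pow_nonneg)

lemma loop_gf_sums:
  assumes "0 \<le> x" "x \<le> 1"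
  shows "(\<lambda>n. loop_coeff n * x ^ n) sums (x * green x 1)"
proof -
  have "(\<lambda>n. x * ((R ^^ n) (unit_vec 1) 1 * x ^ Suc n)) sums (x * green x 1)"
    unfolding green_def by (intro sums_mult summable_sums summable_green assms)
  hence "(\<lambda>n. loop_coeff (n + 2) * x ^ (n + 2)) sums (x * green x 1)"
    by (simp add: loop_coeff_def mult_ac)
  hence "(\<lambda>n. loop_coeff n * x ^ n) sums (x * green x 1 + (\<Sum>n<2. loop_coeff n * x ^ n))"
    by (rule sums_iff_shift[THEN iffD1])
  thus ?thesis by (simp add: loop_coeff_def numeral_2_eq_2)
qed

lemma loop_gf_eq: "0 \<le> x \<Longrightarrow> x \<le> 1 \<Longrightarrow> loop_gf x = x * green x 1"
  unfolding loop_gf_def by (rule sums_unique[symmetric, OF loop_gf_sums])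

lemma summable_loop_coeff: "summable (\<lambda>n. loop_coeff n * 1 ^ n)"
  using loop_gf_sums[of 1] by (simp add: sums_iff)

lemma summable_loop_diffs: "\<bar>x\<bar> < 1 \<Longrightarrow> summable (\<lambda>n. diffs loop_coeff n * x ^ n)"
  by (rule termdiff_converges[of x 1])
    (use powser_inside[OF summable_loop_coeff] in auto)

lemma DERIV_loop_gf: "\<bar>x\<bar> < 1 \<Longrightarrow> (loop_gf has_real_derivative loop_gf' x) (at x)"
  unfolding loop_gf_def[abs_def] loop_gf'_def
  by (rule termdiffs_strong[OF summable_loop_coeff]) simp

lemma diffs_loop_coeff_nonneg: "diffs loop_coeff n \<ge> 0"
  by (simp add: diffs_def loop_coeff_nonneg)

lemma loop_gf'_mono: "0 \<le> x \<Longrightarrow> x \<le> y \<Longrightarrow> y < 1 \<Longrightarrow> loop_gf' x \<le> loop_gf' y"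
  unfolding loop_gf'_def
  by (intro suminf_le summable_loop_diffs mult_left_mono power_mono diffs_loop_coeff_nonneg) auto

lemma loop_gf'_pos: "0 < x \<Longrightarrow> x < 1 \<Longrightarrow> loop_gf' x > 0"
  unfolding loop_gf'_def
  by (rule suminf_pos2[OF summable_loop_diffs, of x 1])
    (auto simp: diffs_loop_coeff_nonneg, simp add: diffs_def loop_coeff_def unit_vec_def)

lemma continuous_on_loop_gf: "continuous_on {0..1} loop_gf"
proof -
  have "continuous_on {0..1} (\<lambda>x. x * green x 1)"
    by (intro continuous_intros continuous_on_green)
  thus ?thesis by (subst continuous_on_cong[OF refl loop_gf_eq]) auto
qed

lemma loop_gf_strict_mono: "0 \<le> x \<Longrightarrow> x < y \<Longrightarrow> y \<le> 1 \<Longrightarrow> loop_gf x < loop_gf y"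
proof (rule DERIV_pos_imp_increasing_open[of x y])
  assume xy: "0 \<le> x" "y \<le> 1"
  show "continuous_on {x..y} loop_gf"
    by (rule continuous_on_subset[OF continuous_on_loop_gf]) (use xy in auto)
  fix z assume "x < z" "z < y"
  thus "\<exists>d. (loop_gf has_real_derivative d) (at z) \<and> 0 < d"
    using xy DERIV_loop_gf[of z] loop_gf'_pos[of z] by auto
qed

end

context critical_jacobi
begin

text \<open>With \<open>y = 1 - x\<close> and \<open>\<mu> = y / (1 - y)\<close>, the difference
  \<open>loop_gf 1 - loop_gf x\<close> is \<open>h 1 - green x 1\<close> plus
  \<open>y * green x 1\<close>, and the last term is negligible against \<open>y^\<alpha>\<close>
  since \<open>\<alpha> < 1\<close>. Nonnegative coefficients make the derivative monotone; then
  \<open>y\<close> is eliminated through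
  \<open>y^(1-\<alpha>) = (y^\<alpha>)^((1-\<alpha>)/\<alpha>)\<close>.\<close>

theorem loop_gf_asymp:
  "\<exists>K>0. ((\<lambda>x. loop_gf' x * (loop_gf 1 - loop_gf x) powr ((1 - \<alpha>) / \<alpha>)) \<longlongrightarrow> K) (at_left 1)"
proof -
  obtain K where K: "K > 0" "((\<lambda>\<mu>. (h 1 - green (1 / (1 + \<mu>)) 1) / \<mu> powr \<alpha>) \<longlongrightarrow> K) (at_right 0)"
    using green_asymp by blast
  define H where "H y = loop_gf 1 - loop_gf (1 - y)" for y
  have small: "\<forall>\<^sub>F y in at_right (0::real). 0 < y \<and> y < 1"
    unfolding eventually_at_right_field by (intro exI[of _ 1]) auto
  have "filterlim (\<lambda>y::real. y / (1 - y)) (at_right 0) (at_right 0)" by real_asymp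
  from filterlim_compose[OF K(2) this]
  have 1: "((\<lambda>y. (h 1 - green (1 / (1 + y / (1 - y))) 1) / (y / (1 - y)) powr \<alpha>) \<longlongrightarrow> K) (at_right 0)" .
  have 2: "((\<lambda>y::real. (1 / (1 - y)) powr \<alpha>) \<longlongrightarrow> 1) (at_right 0)" by real_asymp
  have "1 - \<alpha> > 0" using \<alpha> by simp
  hence 3: "((\<lambda>y::real. y powr (1 - \<alpha>)) \<longlongrightarrow> 0) (at_right 0)" by real_asymp
  have "filterlim (\<lambda>y::real. 1 - y) (at_left 1) (at_right 0)" by real_asymp
  from filterlim_compose[OF green_tendsto_1[of 1] this]
  have 4: "((\<lambda>y. green (1 - y) 1) \<longlongrightarrow> h 1) (at_right 0)" .
  have "((\<lambda>y. (h 1 - green (1 / (1 + y / (1 - y))) 1) / (y / (1 - y)) powr \<alpha> * (1 / (1 - y)) powr \<alpha>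
      + y powr (1 - \<alpha>) * green (1 - y) 1) \<longlongrightarrow> K * 1 + 0 * h 1) (at_right 0)"
    by (intro tendsto_intros 1 2 3 4)
  moreover have "\<forall>\<^sub>F y in at_right 0. (h 1 - green (1 / (1 + y / (1 - y))) 1) / (y / (1 - y)) powr \<alpha> * (1 / (1 - y)) powr \<alpha>
      + y powr (1 - \<alpha>) * green (1 - y) 1 = H y / y powr \<alpha>"
    using small
  proof eventually_elim
    case (elim y)
    have e: "1 / (1 + y / (1 - y)) = 1 - y" using elim by (simp add: field_simps)
    have e2: "(y / (1 - y)) powr \<alpha> = y powr \<alpha> * (1 / (1 - y)) powr \<alpha>" using elim by (simp add: powr_mult[symmetric])
    have e3: "y powr (1 - \<alpha>) = y / y powr \<alpha>" using elim by (simp add: powr_diff)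
    have "(1 / (1 - y)) powr \<alpha> > 0" "y powr \<alpha> > 0" using elim by auto
    thus ?case using elim unfolding e e2 e3 H_def by (simp add: loop_gf_eq field_simps)
  qed
  ultimately have "((\<lambda>y. H y / y powr \<alpha>) \<longlongrightarrow> K * 1 + 0 * h 1) (at_right 0)"
    by (rule Lim_transform_eventually)
  hence Hlim: "((\<lambda>y. H y / y powr \<alpha>) \<longlongrightarrow> K) (at_right 0)" by simp
  have H': "((\<lambda>y. loop_gf' (1 - y) * y powr (1 - \<alpha>)) \<longlongrightarrow> K * \<alpha>) (at_right 0)"
  proof (rule monotone_density[OF _ _ K(1) Hlim])
    fix y :: real assume y: "0 < y" "y < 1"
    have "((\<lambda>y. loop_gf (1 - y)) has_real_derivative loop_gf' (1 - y) * (0 - 1)) (at y)"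
      by (rule DERIV_chain2[of loop_gf]) (use y in \<open>auto intro!: DERIV_loop_gf derivative_eq_intros\<close>)
    thus "(H has_real_derivative loop_gf' (1 - y)) (at y)"
      unfolding H_def[abs_def] by (auto intro!: derivative_eq_intros)
  qed (auto intro!: loop_gf'_mono)
  define \<gamma> where "\<gamma> = (1 - \<alpha>) / \<alpha>"
  have "((\<lambda>y. loop_gf' (1 - y) * y powr (1 - \<alpha>) * (H y / y powr \<alpha>) powr \<gamma>) \<longlongrightarrow> K * \<alpha> * K powr \<gamma>) (at_right 0)"
    by (intro tendsto_mult H' tendsto_powr Hlim tendsto_const) (use K in auto)
  moreover have "\<forall>\<^sub>F y in at_right 0. loop_gf' (1 - y) * y powr (1 - \<alpha>) * (H y / y powr \<alpha>) powr \<gamma>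
      = loop_gf' (1 - y) * (loop_gf 1 - loop_gf (1 - y)) powr \<gamma>"
    using small
  proof eventually_elim
    case (elim y)
    have "(y powr \<alpha>) powr \<gamma> = y powr (1 - \<alpha>)" using \<alpha> by (simp add: powr_powr \<gamma>_def)
    moreover have "H y \<ge> 0" using loop_gf_strict_mono[of "1 - y" 1] elim by (simp add: H_def)
    ultimately show ?case using elim by (simp add: powr_divide H_def)
  qed
  ultimately have "((\<lambda>y. loop_gf' (1 - y) * (loop_gf 1 - loop_gf (1 - y)) powr \<gamma>) \<longlongrightarrow> K * \<alpha> * K powr \<gamma>) (at_right 0)"
    by (rule Lim_transform_eventually)
  moreover have "filterlim (\<lambda>x::real. 1 - x) (at_right 0) (at_left 1)" by real_asymp
  ultimately have "((\<lambda>x. loop_gf' (1 - (1 - x)) * (loop_gf 1 - loop_gf (1 - (1 - x))) powr \<gamma>) \<longlongrightarrow> K * \<alpha> * K powr \<gamma>) (at_left 1)"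
    by (rule filterlim_compose)
  moreover have "K * \<alpha> * K powr \<gamma> > 0" using K \<alpha> by simp
  ultimately show ?thesis by (intro exI[of _ "K * \<alpha> * K powr \<gamma>"]) (simp add: \<gamma>_def)
qed

end

section \<open>Partition functions of the SOS model\<close>

lemma sos_paths_nth_le:
  assumes "X \<in> sos_paths N" "i \<le> N"
  shows "X ! i \<le> i"
  using assms(2)
proof (induction i)
  case 0
  thus ?case using assms by (simp add: sos_paths_def)
next
  case (Suc i)
  have "\<bar>int (X ! Suc i) - int (X ! i)\<bar> = 1" using assms Suc.prems by (simp add: sos_paths_def)
  thus ?case using Suc by linarith
qed

lemma finite_sos_paths: "finite (sos_paths N)"
proof (rule finite_subset)
  show "sos_paths N \<subseteq> {X. set X \<subseteq> {..N} \<and> length X = Suc N}"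
  proof
    fix X assume X: "X \<in> sos_paths N"
    hence "length X = Suc N" by (simp add: sos_paths_def)
    moreover have "set X \<subseteq> {..N}"
    proof
      fix y assume "y \<in> set X"
      then obtain i where "y = X ! i" "i \<le> N" using \<open>length X = Suc N\<close> by (auto simp: in_set_conv_nth)
      thus "y \<in> {..N}" using sos_paths_nth_le[OF X, of i] by simp
    qed
    ultimately show "X \<in> {X. set X \<subseteq> {..N} \<and> length X = Suc N}" by simp
  qed
  show "finite {X. set X \<subseteq> {..N} \<and> length X = Suc N}" by (rule finite_lists_length_eq) simp
qed

definition paths_to :: "nat \<Rightarrow> nat \<Rightarrow> nat list set" where
  "paths_to N x = {X \<in> sos_paths N. X ! N = x}"

lemma finite_paths_to: "finite (paths_to N x)"
  unfolding paths_to_def using finite_sos_paths by simp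

lemma paths_to_Suc:
  "paths_to (Suc N) x = (\<lambda>Y. Y @ [x]) ` (paths_to N (Suc x) \<union> (case x of 0 \<Rightarrow> {} | Suc y \<Rightarrow> paths_to N y))"
proof (intro equalityI subsetI)
  fix X assume X: "X \<in> paths_to (Suc N) x"
  hence len: "length X = Suc (Suc N)" and x: "X ! Suc N = x" and X0: "X ! 0 = 0"
    and st: "\<And>i. i < Suc N \<Longrightarrow> \<bar>int (X ! Suc i) - int (X ! i)\<bar> = 1"
    by (auto simp: paths_to_def sos_paths_def)
  define Y where "Y = take (Suc N) X"
  have "X = take (Suc (Suc N)) X" using len by simp
  also have "\<dots> = take (Suc N) X @ [X ! Suc N]"
    by (rule take_Suc_conv_app_nth) (use len in simp)
  finally have XY: "X = Y @ [x]" unfolding x Y_def .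
  have Y: "Y \<in> sos_paths N" "Y ! N = X ! N"
    using len X0 st by (auto simp: Y_def sos_paths_def)
  have "\<bar>int x - int (Y ! N)\<bar> = 1" using st[of N] x Y by simp
  hence "Y ! N = Suc x \<or> (x > 0 \<and> Y ! N = x - 1)" by linarith
  hence "Y \<in> paths_to N (Suc x) \<union> (case x of 0 \<Rightarrow> {} | Suc y \<Rightarrow> paths_to N y)"
    using Y by (auto simp: paths_to_def split: nat.splits)
  thus "X \<in> (\<lambda>Y. Y @ [x]) ` (paths_to N (Suc x) \<union> (case x of 0 \<Rightarrow> {} | Suc y \<Rightarrow> paths_to N y))"
    using XY by blast
next
  fix X assume "X \<in> (\<lambda>Y. Y @ [x]) ` (paths_to N (Suc x) \<union> (case x of 0 \<Rightarrow> {} | Suc y \<Rightarrow> paths_to N y))"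
  then obtain Y where XY: "X = Y @ [x]" and Y: "Y \<in> paths_to N (Suc x) \<union> (case x of 0 \<Rightarrow> {} | Suc y \<Rightarrow> paths_to N y)"
    by blast
  hence "Y \<in> sos_paths N" "\<bar>int x - int (Y ! N)\<bar> = 1"
    by (auto simp: paths_to_def split: nat.splits)
  thus "X \<in> paths_to (Suc N) x"
    by (auto simp: XY paths_to_def sos_paths_def nth_append less_Suc_eq)
qed

lemma sos_weight_snoc:
  assumes "length Y = Suc N"
  shows "sos_weight b (Suc N) (Y @ [x]) = sos_weight b N Y / (2 * b x)"
proof -
  have "(\<Prod>n=0..N. inverse (b ((Y @ [x]) ! n))) = (\<Prod>n=0..N. inverse (b (Y ! n)))"
    by (rule prod.cong) (use assms in \<open>auto simp: nth_append\<close>)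
  moreover have "(Y @ [x]) ! Suc N = x" using assms by (metis nth_append_length)
  ultimately have "(\<Prod>n=0..Suc N. inverse (b ((Y @ [x]) ! n))) = (\<Prod>n=0..N. inverse (b (Y ! n))) * inverse (b x)"
    unfolding prod.atLeast0_atMost_Suc by (simp only:)
  moreover have "1 / 2 * a * (p * inverse y) = a * p / (2 * y)" for a p y :: real
    by (simp add: field_simps)
  ultimately show ?thesis unfolding sos_weight_def by (simp only: power_Suc)
qed

section \<open>Transfer operator and growth of the partition functions\<close>

locale sos =
  fixes b :: "nat \<Rightarrow> real"
  assumes b_pos: "b n > 0"
begin

definition hop :: "nat \<Rightarrow> real" where
  "hop p = 1 / (2 * sqrt (b p * b (Suc p)))"

lemma hop_pos: "hop p > 0"
  using b_pos by (simp add: hop_def)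

lemma hop_nonneg: "hop p \<ge> 0"
  using hop_pos less_imp_le by blast

abbreviation A where "A \<equiv> jac hop"

definition Zto :: "nat \<Rightarrow> nat \<Rightarrow> real" where
  "Zto N x = (\<Sum>X\<in>paths_to N x. sos_weight b N X)"

lemma sos_weight_pos: "sos_weight b N X > 0"
  using b_pos by (auto simp: sos_weight_def intro!: mult_pos_pos prod_pos)

lemma Zto_Suc: "Zto (Suc N) x = (Zto N (Suc x) + (case x of 0 \<Rightarrow> 0 | Suc y \<Rightarrow> Zto N y)) / (2 * b x)"
proof -
  define S where "S = (case x of 0 \<Rightarrow> {} | Suc y \<Rightarrow> paths_to N y)"
  have fin: "finite S" by (auto simp: S_def finite_paths_to split: nat.split)
  have disj: "paths_to N (Suc x) \<inter> S = {}" by (auto simp: S_def paths_to_def split: nat.splits)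
  have len: "length Y = Suc N" if "Y \<in> paths_to N (Suc x) \<union> S" for Y
    using that by (auto simp: S_def paths_to_def sos_paths_def split: nat.splits)
  have "Zto (Suc N) x = (\<Sum>Y\<in>paths_to N (Suc x) \<union> S. sos_weight b (Suc N) (Y @ [x]))"
    unfolding Zto_def paths_to_Suc S_def[symmetric] by (subst sum.reindex) (auto simp: inj_on_def)
  also have "\<dots> = (\<Sum>Y\<in>paths_to N (Suc x) \<union> S. sos_weight b N Y / (2 * b x))"
    by (rule sum.cong) (simp_all add: sos_weight_snoc len)
  also have "\<dots> = (Zto N (Suc x) + (\<Sum>Y\<in>S. sos_weight b N Y)) / (2 * b x)"
    unfolding sum_divide_distrib[symmetric]
    by (subst sum.union_disjoint) (use fin disj in \<open>auto simp: finite_paths_to Zto_def\<close>)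
  also have "(\<Sum>Y\<in>S. sos_weight b N Y) = (case x of 0 \<Rightarrow> 0 | Suc y \<Rightarrow> Zto N y)"
    by (simp add: S_def Zto_def split: nat.split)
  finally show ?thesis .
qed

text \<open>The step weight \<open>1 / (2 b x)\<close> is not symmetric; conjugation by
  \<open>sqrt b\<close> gives the symmetric hopping \<open>1 / (2 sqrt (b x * b y))\<close> and
  leaves \<open>1 / sqrt (b 0 * b x)\<close> at the end points.\<close>

lemma Zto_eq_jac: "Zto N x = (A ^^ N) (unit_vec 0) x / sqrt (b 0 * b x)"
proof (induction N arbitrary: x)
  case 0
  have "paths_to 0 x = (if x = 0 then {[0]} else {})"
    by (auto simp: paths_to_def sos_paths_def length_Suc_conv)
  thus ?case using b_pos[of 0] by (simp add: Zto_def sos_weight_def unit_vec_def inverse_eq_divide)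
next
  case (Suc N)
  have e1: "u / sqrt (b 0 * b y) / (2 * b x) = 1 / (2 * sqrt (b x * b y)) * u / sqrt (b 0 * b x)" for u y
  proof -
    have "u / (p * q) / (2 * (s * s)) = 1 / (2 * (s * q)) * u / (p * s)" for p q s :: real by simp
    from this[of "sqrt (b 0)" "sqrt (b y)" "sqrt (b x)"] show ?thesis
      using b_pos[of x] by (simp add: real_sqrt_mult)
  qed
  show ?case
  proof (cases x)
    case 0
    have "Zto (Suc N) x = (A ^^ N) (unit_vec 0) 1 / sqrt (b 0 * b 1) / (2 * b x)"
      unfolding Zto_Suc using Suc.IH by (simp add: 0)
    also have "\<dots> = hop x * (A ^^ N) (unit_vec 0) 1 / sqrt (b 0 * b x)"
      unfolding e1 by (simp only: hop_def 0 One_nat_def)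
    finally show ?thesis by (simp add: 0 jac_0)
  next
    case (Suc y)
    have "Zto (Suc N) x = (A ^^ N) (unit_vec 0) (Suc x) / sqrt (b 0 * b (Suc x)) / (2 * b x)
       + (A ^^ N) (unit_vec 0) y / sqrt (b 0 * b y) / (2 * b x)"
      unfolding Zto_Suc using Suc.IH by (simp add: Suc add_divide_distrib)
    also have "\<dots> = (hop x * (A ^^ N) (unit_vec 0) (Suc x) + hop y * (A ^^ N) (unit_vec 0) y) / sqrt (b 0 * b x)"
      unfolding e1 by (simp add: hop_def Suc add_divide_distrib mult.commute)
    finally show ?thesis by (simp add: Suc jac_Suc)
  qed
qed

lemma sos_Z_eq: "sos_Z b N = (\<Sum>x\<le>N. Zto N x)"
proof -
  have "sos_paths N = (\<Union>x\<in>{..N}. paths_to N x)"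
    using sos_paths_nth_le[of _ N N] by (auto simp: paths_to_def)
  thus ?thesis unfolding sos_Z_def Zto_def
    by (simp only:) (rule sum.UNION_disjoint, auto simp: finite_paths_to, auto simp: paths_to_def)
qed

lemma Zto_nonneg: "Zto N x \<ge> 0"
  unfolding Zto_def by (intro sum_nonneg less_imp_le sos_weight_pos)

end

text \<open>Only the exponential growth rate is at stake, so polynomial control suffices:
  \<open>W\<close> grows at most linearly and \<open>b\<close> is bounded below. One constant
  \<open>M\<close> serves for both.\<close>

locale sos_eigen = sos +
  fixes \<rho> M :: real and W :: "nat \<Rightarrow> real"
  assumes \<rho>: "\<rho> > 0" and W_pos: "W p > 0" and eigen: "jac hop W p = \<rho> * W p"
    and W_le: "W p \<le> M * real (p + 1)" and b_ge: "1 / M \<le> sqrt (b p)"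
begin

lemma W_nonneg: "W p \<ge> 0"
  using W_pos less_imp_le by blast

lemma M_pos: "M > 0"
proof -
  have "0 < M * real (0 + 1)" using W_pos[of 0] W_le[of 0] by linarith
  thus ?thesis by simp
qed

text \<open>\<open>unit_vec 0 \<le> W / W 0\<close> pointwise, and positivity of the operator
  propagates this to the bound \<open>\<rho>^N * W / W 0\<close>.\<close>

lemma sos_Z_upper: "sos_Z b N \<le> M\<^sup>2 / (W 0 * sqrt (b 0)) * \<rho> ^ N * (real (N + 1))\<^sup>2"
proof -
  have pow: "(jac hop ^^ n) W p = \<rho> ^ n * W p" for n p
  proof (induction n arbitrary: p)
    case (Suc n)
    hence "(jac hop ^^ n) W = (\<lambda>p. \<rho> ^ n * W p)" by blast
    thus ?case by (simp add: jac_scale eigen)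
  qed simp
  have "Zto N x \<le> M\<^sup>2 / (W 0 * sqrt (b 0)) * \<rho> ^ N * real (N + 1)" if "x \<le> N" for x
  proof -
    have "(A ^^ N) (unit_vec 0) x \<le> (A ^^ N) (\<lambda>p. 1 / W 0 * W p) x"
      by (rule jac_pow_mono) (use W_pos[of 0] in \<open>auto simp: unit_vec_def hop_nonneg W_nonneg\<close>)
    also have "\<dots> = \<rho> ^ N * (W x / W 0)" by (simp only: jac_pow_scale pow) simp
    also have "\<dots> \<le> \<rho> ^ N * (M * real (N + 1) / W 0)"
    proof (intro mult_left_mono divide_right_mono)
      have "W x \<le> M * real (x + 1)" by (rule W_le)
      also have "\<dots> \<le> M * real (N + 1)" using that M_pos by simp
      finally show "W x \<le> M * real (N + 1)" .
    qed (use \<rho> W_pos[of 0] in auto)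
    finally have 1: "(A ^^ N) (unit_vec 0) x \<le> \<rho> ^ N * (M * real (N + 1) / W 0)" .
    have "1 / sqrt (b x) \<le> M" using b_ge[of x] M_pos b_pos[of x] by (simp add: field_simps)
    hence "(A ^^ N) (unit_vec 0) x * (1 / sqrt (b x)) \<le> \<rho> ^ N * (M * real (N + 1) / W 0) * M"
      using 1 jac_pow_unit_nonneg[of hop N 0 x] hop_pos less_imp_le b_pos[of x] M_pos \<rho> W_pos[of 0]
      by (intro mult_mono) auto
    hence "(A ^^ N) (unit_vec 0) x * (1 / sqrt (b x)) / sqrt (b 0) \<le> \<rho> ^ N * (M * real (N + 1) / W 0) * M / sqrt (b 0)"
      using b_pos[of 0] by (intro divide_right_mono) auto
    thus ?thesis by (simp add: Zto_eq_jac real_sqrt_mult power2_eq_square mult_ac)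
  qed
  hence "sos_Z b N \<le> real (card {..N}) * (M\<^sup>2 / (W 0 * sqrt (b 0)) * \<rho> ^ N * real (N + 1))"
    unfolding sos_Z_eq by (intro sum_bounded_above) auto
  thus ?thesis by (simp add: power2_eq_square mult_ac)
qed

text \<open>Cauchy--Schwarz against the eigenvector on the reachable sites \<open>p \<le> N\<close>,
  whose squared norm there is at most cubic in \<open>N\<close> by linear growth.\<close>

lemma Zto_0_lower: "Zto (2 * N) 0 \<ge> (W 0)\<^sup>2 / (b 0 * M\<^sup>2) * \<rho> ^ (2 * N) / (real (N + 1)) ^ 3"
proof -
  have "(\<Sum>p\<le>0 + N. (W p)\<^sup>2) \<le> real (card {..N}) * (M * real (N + 1))\<^sup>2"
  proof (simp only: add_0, rule sum_bounded_above)
    fix p assume "p \<in> {..N}"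
    have "W p \<le> M * real (p + 1)" by (rule W_le)
    also have "\<dots> \<le> M * real (N + 1)" using \<open>p \<in> {..N}\<close> M_pos by simp
    finally show "(W p)\<^sup>2 \<le> (M * real (N + 1))\<^sup>2" using W_pos[of p] by (intro power_mono) auto
  qed
  also have "\<dots> = M\<^sup>2 * real (N + 1) ^ 3" by (simp add: power2_eq_square power3_eq_cube)
  finally have S: "(\<Sum>p\<le>0 + N. (W p)\<^sup>2) \<le> M\<^sup>2 * real (N + 1) ^ 3" .
  have "(\<rho> ^ N * W 0)\<^sup>2 \<le> (A ^^ (2 * N)) (unit_vec 0) 0 * (\<Sum>p\<le>0 + N. (W p)\<^sup>2)"
    by (rule jac_pow_diag_lower) (use \<rho> in \<open>auto simp: hop_nonneg W_nonneg eigen\<close>)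
  also have "\<dots> \<le> (A ^^ (2 * N)) (unit_vec 0) 0 * (M\<^sup>2 * real (N + 1) ^ 3)"
    by (intro mult_left_mono S jac_pow_unit_nonneg) (simp add: hop_pos less_imp_le)
  finally have "(\<rho> ^ N * W 0)\<^sup>2 / (M\<^sup>2 * real (N + 1) ^ 3) / b 0 \<le> (A ^^ (2 * N)) (unit_vec 0) 0 / b 0"
    using M_pos b_pos[of 0] by (intro divide_right_mono) (simp_all add: pos_divide_le_eq del: of_nat_add of_nat_Suc)
  thus ?thesis using b_pos[of 0] by (simp add: Zto_eq_jac power_mult_distrib power_mult power2_eq_square mult_ac)
qed

lemma sos_Z_lower: "\<exists>k>0. \<forall>N. sos_Z b N \<ge> k * \<rho> ^ N / real (N + 1) ^ 3"
proof -
  define k0 where "k0 = (W 0)\<^sup>2 / (b 0 * M\<^sup>2)"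
  have k0: "k0 > 0" using W_pos[of 0] b_pos[of 0] M_pos by (simp add: k0_def)
  define k where "k = min k0 (k0 / (2 * b 1 * \<rho>))"
  have k: "k > 0" using k0 b_pos[of 1] \<rho> by (simp add: k_def)
  have "sos_Z b N \<ge> k * \<rho> ^ N / real (N + 1) ^ 3" for N
  proof (cases "even N")
    case True
    then obtain n where N: "N = 2 * n" by blast
    have "k * \<rho> ^ N / real (N + 1) ^ 3 \<le> k0 * \<rho> ^ N / real (n + 1) ^ 3"
      using k k0 \<rho> by (intro frac_le mult_mono power_mono) (auto simp: k_def N)
    also have "\<dots> \<le> Zto N 0" using Zto_0_lower[of n] by (simp add: N k0_def)
    also have "\<dots> \<le> sos_Z b N" unfolding sos_Z_eq by (rule member_le_sum) (auto simp: Zto_nonneg)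
    finally show ?thesis .
  next
    case False
    then obtain n where N: "N = Suc (2 * n)" using oddE by fastforce
    \<comment> \<open>A path of odd length cannot end at 0, so one more step from 0 to 1 is added to
      an even one, at weight \<open>1 / (2 b 1)\<close>.\<close>
    have "k * \<rho> ^ N / real (N + 1) ^ 3 \<le> k0 / (2 * b 1 * \<rho>) * \<rho> ^ N / real (n + 1) ^ 3"
      using k k0 \<rho> b_pos[of 1] by (intro frac_le mult_mono power_mono) (auto simp: k_def N)
    also have "\<dots> = k0 * \<rho> ^ (2 * n) / real (n + 1) ^ 3 / (2 * b 1)" using \<rho> by (simp add: N)
    also have "\<dots> \<le> Zto (2 * n) 0 / (2 * b 1)"
      using Zto_0_lower[of n] b_pos[of 1] by (intro divide_right_mono) (auto simp: k0_def)
    also have "\<dots> \<le> Zto N 1" unfolding N Zto_Suc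
      using b_pos[of 1] Zto_nonneg by (intro divide_right_mono) auto
    also have "\<dots> \<le> sos_Z b N" unfolding sos_Z_eq by (rule member_le_sum) (auto simp: Zto_nonneg N)
    finally show ?thesis .
  qed
  thus ?thesis using k by blast
qed

lemma ln_sandwich:
  fixes Z :: "nat \<Rightarrow> real"
  assumes k: "k > 0" "K > 0" and low: "\<And>N. k * \<rho> ^ N / real (N + 1) ^ 3 \<le> Z N" and up: "\<And>N. Z N \<le> K * \<rho> ^ N * (real (N + 1))\<^sup>2"
  shows "(\<lambda>N. ln (Z N) / real N) \<longlonglongrightarrow> ln \<rho>"
proof (rule tendsto_sandwich)
  show "(\<lambda>N. ln k / real N + ln \<rho> - 3 * (ln (real (N + 1)) / real N)) \<longlonglongrightarrow> ln \<rho>"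
  proof -
    have "(\<lambda>N. ln (real (N + 1)) / real N) \<longlonglongrightarrow> 0" by real_asymp
    moreover have "(\<lambda>N. ln k / real N) \<longlonglongrightarrow> 0" by real_asymp
    ultimately have "(\<lambda>N. ln k / real N + ln \<rho> - 3 * (ln (real (N + 1)) / real N)) \<longlonglongrightarrow> 0 + ln \<rho> - 3 * 0"
      by (intro tendsto_intros)
    thus ?thesis by simp
  qed
  show "(\<lambda>N. ln K / real N + ln \<rho> + 2 * (ln (real (N + 1)) / real N)) \<longlonglongrightarrow> ln \<rho>"
  proof -
    have "(\<lambda>N. ln (real (N + 1)) / real N) \<longlonglongrightarrow> 0" by real_asymp
    moreover have "(\<lambda>N. ln K / real N) \<longlonglongrightarrow> 0" by real_asymp
    ultimately have "(\<lambda>N. ln K / real N + ln \<rho> + 2 * (ln (real (N + 1)) / real N)) \<longlonglongrightarrow> 0 + ln \<rho> + 2 * 0"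
      by (intro tendsto_intros)
    thus ?thesis by simp
  qed
  have Z: "Z N > 0" for N
  proof -
    have "k * \<rho> ^ N / real (N + 1) ^ 3 > 0" using k \<rho> by simp
    thus ?thesis using low[of N] by linarith
  qed
  show "\<forall>\<^sub>F N in sequentially. ln k / real N + ln \<rho> - 3 * (ln (real (N + 1)) / real N) \<le> ln (Z N) / real N"
  proof (rule eventually_mono[OF eventually_gt_at_top[of 0]])
    fix N :: nat assume N: "N > 0"
    have "ln (k * \<rho> ^ N / real (N + 1) ^ 3) \<le> ln (Z N)" using low[of N] Z k \<rho> by (subst ln_le_cancel_iff) auto
    moreover have "ln (k * \<rho> ^ N / real (N + 1) ^ 3) = ln k + real N * ln \<rho> - 3 * ln (real (N + 1))"
      using k \<rho> by (simp add: ln_mult ln_div ln_realpow del: of_nat_add of_nat_Suc)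
    ultimately have "(ln k + real N * ln \<rho> - 3 * ln (real (N + 1))) / real N \<le> ln (Z N) / real N"
      by (intro divide_right_mono) auto
    thus "ln k / real N + ln \<rho> - 3 * (ln (real (N + 1)) / real N) \<le> ln (Z N) / real N"
      using N by (simp add: add_divide_distrib diff_divide_distrib)
  qed
  show "\<forall>\<^sub>F N in sequentially. ln (Z N) / real N \<le> ln K / real N + ln \<rho> + 2 * (ln (real (N + 1)) / real N)"
  proof (rule eventually_mono[OF eventually_gt_at_top[of 0]])
    fix N :: nat assume N: "N > 0"
    have "ln (Z N) \<le> ln (K * \<rho> ^ N * (real (N + 1))\<^sup>2)" using up[of N] Z k \<rho> by (subst ln_le_cancel_iff) auto
    moreover have "ln (K * \<rho> ^ N * (real (N + 1))\<^sup>2) = ln K + real N * ln \<rho> + 2 * ln (real (N + 1))"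
      using k \<rho> by (simp add: ln_mult ln_realpow del: of_nat_add of_nat_Suc)
    ultimately have "ln (Z N) / real N \<le> (ln K + real N * ln \<rho> + 2 * ln (real (N + 1))) / real N"
      by (intro divide_right_mono) auto
    thus "ln (Z N) / real N \<le> ln K / real N + ln \<rho> + 2 * (ln (real (N + 1)) / real N)"
      using N by (simp add: add_divide_distrib)
  qed
qed

theorem ln_sos_Z: "(\<lambda>N. ln (sos_Z b N) / real N) \<longlonglongrightarrow> ln \<rho>"
proof -
  obtain k where "k > 0" "\<And>N. k * \<rho> ^ N / real (N + 1) ^ 3 \<le> sos_Z b N" using sos_Z_lower by blast
  moreover have "M\<^sup>2 / (W 0 * sqrt (b 0)) > 0" using M_pos W_pos[of 0] b_pos[of 0] by simp
  ultimately show ?thesis using ln_sandwich[of k "M\<^sup>2 / (W 0 * sqrt (b 0))"] sos_Z_upper by blast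
qed

theorem ln_Zto_0: "(\<lambda>N. ln (Zto (2 * N) 0) / real (2 * N)) \<longlonglongrightarrow> ln \<rho>"
proof -
  define k where "k = (W 0)\<^sup>2 / (b 0 * M\<^sup>2)"
  have k: "k > 0" using W_pos[of 0] b_pos[of 0] M_pos by (simp add: k_def)
  define K where "K = max (M\<^sup>2 / (W 0 * sqrt (b 0))) k"
  \<comment> \<open>There are no pinned paths of odd length; a dummy value of the right exponential
    order makes the two-sided bound hold for all \<open>N\<close>, and only even indices are kept at
    the end.\<close>
  define Z where "Z n = (if even n then Zto n 0 else k * \<rho> ^ n)" for n
  have "(\<lambda>N. ln (Z N) / real N) \<longlonglongrightarrow> ln \<rho>"
  proof (rule ln_sandwich[OF k, of K])
    fix N
    show "k * \<rho> ^ N / real (N + 1) ^ 3 \<le> Z N"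
    proof (cases "even N")
      case True
      then obtain n where N: "N = 2 * n" by blast
      have "k * \<rho> ^ N / real (N + 1) ^ 3 \<le> k * \<rho> ^ N / real (n + 1) ^ 3"
        using k \<rho> by (intro frac_le power_mono) (auto simp: N)
      also have "\<dots> \<le> Z N" using Zto_0_lower[of n] by (simp add: N Z_def k_def)
      finally show ?thesis .
    next
      case False
      have "1 \<le> real (N + 1) ^ 3" by (intro one_le_power) auto
      thus ?thesis using False k \<rho> by (simp add: Z_def divide_le_eq mult_left_le del: of_nat_add of_nat_Suc)
    qed
    show "Z N \<le> K * \<rho> ^ N * (real (N + 1))\<^sup>2"
    proof (cases "even N")
      case True
      have "Zto N 0 \<le> sos_Z b N" unfolding sos_Z_eq by (rule member_le_sum) (auto simp: Zto_nonneg)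
      also have "\<dots> \<le> M\<^sup>2 / (W 0 * sqrt (b 0)) * \<rho> ^ N * (real (N + 1))\<^sup>2" by (rule sos_Z_upper)
      also have "\<dots> \<le> K * \<rho> ^ N * (real (N + 1))\<^sup>2" using \<rho> by (intro mult_right_mono) (auto simp: K_def)
      finally show ?thesis using True by (simp add: Z_def)
    next
      case False
      have "k * \<rho> ^ N * 1 \<le> K * \<rho> ^ N * (real (N + 1))\<^sup>2"
        using k \<rho> by (intro mult_mono mult_right_mono one_le_power) (auto simp: K_def max_def)
      thus ?thesis using False by (simp add: Z_def)
    qed
  qed (use k in \<open>auto simp: K_def\<close>)
  moreover have "filterlim (\<lambda>N::nat. 2 * N) at_top sequentially" by real_asymp
  ultimately have "(\<lambda>N. ln (Z (2 * N)) / real (2 * N)) \<longlonglongrightarrow> ln \<rho>"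
    by (rule filterlim_compose)
  thus ?thesis by (simp add: Z_def)
qed

end

section \<open>The density of returns\<close>

text \<open>The end points are counted too: the start always contributes, and so does the end of a
  pinned path. This is the origin of the corrections 1 and 2 in the return frequencies.\<close>

definition zeros :: "nat \<Rightarrow> nat list \<Rightarrow> nat" where
  "zeros N X = card {n \<in> {0..N}. X ! n = 0}"

lemma sos_weight_change_origin:
  assumes "\<beta> > 0" "\<beta>' > 0"
  shows "sos_weight (b(0 := \<beta>')) N X = sos_weight (b(0 := \<beta>)) N X * (\<beta> / \<beta>') ^ zeros N X"
proof -
  have "(\<Prod>n=0..N. inverse ((b(0 := \<beta>')) (X ! n)))
      = (\<Prod>n=0..N. inverse ((b(0 := \<beta>)) (X ! n)) * (if X ! n = 0 then \<beta> / \<beta>' else 1))"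
    by (rule prod.cong) (use assms in \<open>auto simp: field_simps\<close>)
  also have "\<dots> = (\<Prod>n=0..N. inverse ((b(0 := \<beta>)) (X ! n))) * (\<Prod>n=0..N. if X ! n = 0 then \<beta> / \<beta>' else 1)"
    by (rule prod.distrib)
  also have "(\<Prod>n=0..N. if X ! n = 0 then \<beta> / \<beta>' else 1) = (\<Prod>n\<in>{n \<in> {0..N}. X ! n = 0}. \<beta> / \<beta>')"
    by (rule prod.inter_filter[symmetric]) simp
  also have "\<dots> = (\<beta> / \<beta>') ^ zeros N X" by (simp add: zeros_def)
  finally show ?thesis by (simp add: sos_weight_def)
qed

definition mean_zeros :: "(nat \<Rightarrow> real) \<Rightarrow> nat \<Rightarrow> nat list set \<Rightarrow> real" where
  "mean_zeros b N S = (\<Sum>X\<in>S. sos_weight b N X * real (zeros N X)) / (\<Sum>X\<in>S. sos_weight b N X)"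

text \<open>Jensen's inequality: \<open>ln Z\<close> is a convex function of \<open>- ln \<beta>\<close>, and \<open>mean_zeros\<close> is its derivative.\<close>

lemma ln_partition_tangent:
  assumes b: "\<And>n. n \<ge> 1 \<Longrightarrow> b n > 0" and \<beta>: "\<beta> > 0" "\<beta>' > 0" and S: "finite S" "S \<noteq> {}"
  shows "ln (\<Sum>X\<in>S. sos_weight (b(0 := \<beta>')) N X) - ln (\<Sum>X\<in>S. sos_weight (b(0 := \<beta>)) N X)
     \<ge> (ln \<beta> - ln \<beta>') * mean_zeros (b(0 := \<beta>)) N S"
proof -
  interpret sos "b(0 := \<beta>)" by standard (use b \<beta> in \<open>auto simp: Suc_le_eq\<close>)
  interpret b': sos "b(0 := \<beta>')" by standard (use b \<beta> in \<open>auto simp: Suc_le_eq\<close>)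
  define w z where "w X = sos_weight (b(0 := \<beta>)) N X" and "z X = real (zeros N X)" for X
  define Z where "Z = (\<Sum>X\<in>S. w X)"
  define m where "m = (\<Sum>X\<in>S. w X * z X) / Z"
  define t where "t = ln (\<beta> / \<beta>')"
  have w: "w X > 0" for X unfolding w_def by (rule sos_weight_pos)
  have Z: "Z > 0" unfolding Z_def by (rule sum_pos) (use S w in auto)
  \<comment> \<open>The inserted term \<open>Z * m - m * Z\<close> is zero. Rewritten as a weighted
    sum of \<open>z X - m\<close>, it lets \<open>1 + u \<le> exp u\<close> act termwise.\<close>
  have "Z * exp (t * m) = exp (t * m) * (Z + t * (Z * m - m * Z))" by simp
  also have "Z * m = (\<Sum>X\<in>S. w X * z X)" using Z by (simp add: m_def)
  also have "Z + t * ((\<Sum>X\<in>S. w X * z X) - m * Z) = (\<Sum>X\<in>S. w X * (1 + t * (z X - m)))"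
    by (simp add: Z_def algebra_simps sum.distrib sum_subtractf sum_distrib_left)
  also have "exp (t * m) * \<dots> \<le> exp (t * m) * (\<Sum>X\<in>S. w X * exp (t * (z X - m)))"
    by (intro mult_left_mono sum_mono exp_ge_add_one_self less_imp_le[OF w]) auto
  also have "\<dots> = (\<Sum>X\<in>S. w X * exp (t * z X))"
    by (simp add: sum_distrib_left right_diff_distrib exp_diff)
  also have "\<dots> = (\<Sum>X\<in>S. sos_weight (b(0 := \<beta>')) N X)"
  proof (rule sum.cong)
    fix X
    have "exp (t * z X) = (\<beta> / \<beta>') ^ zeros N X"
      using \<beta> by (simp add: t_def z_def mult.commute[of "ln _"] exp_of_nat_mult)
    thus "w X * exp (t * z X) = sos_weight (b(0 := \<beta>')) N X"
      by (simp add: w_def sos_weight_change_origin[OF \<beta>])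
  qed simp
  finally have "Z * exp (t * m) \<le> (\<Sum>X\<in>S. sos_weight (b(0 := \<beta>')) N X)" .
  hence "ln (Z * exp (t * m)) \<le> ln (\<Sum>X\<in>S. sos_weight (b(0 := \<beta>')) N X)"
    using Z b'.sos_weight_pos by (subst ln_le_cancel_iff) (auto intro!: sum_pos S)
  moreover have "ln (Z * exp (t * m)) = ln Z + t * m" using Z by (simp add: ln_mult)
  moreover have "t = ln \<beta> - ln \<beta>'" using \<beta> by (simp add: t_def ln_div)
  moreover have "m = mean_zeros (b(0 := \<beta>)) N S" by (simp add: m_def mean_zeros_def Z_def w_def z_def)
  ultimately show ?thesis by (simp add: Z_def w_def)
qed

text \<open>If functions with given supporting lines at a point converge to a limit that is
  differentiable there, the slopes converge to its derivative; comparison points on the two sides of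
  \<open>x\<close> give the two bounds. The variable is \<open>- ln (\<phi> y)\<close> and the limit
  function \<open>- ln y\<close>, whose slope is \<open>\<phi> x / (x * \<phi>')\<close>.\<close>

lemma limit_of_tangent_slopes:
  fixes F :: "nat \<Rightarrow> real \<Rightarrow> real" and E d :: "nat \<Rightarrow> real"
  assumes x: "0 < x" "x < 1" and \<phi>_pos: "\<And>y. 0 < y \<Longrightarrow> y < 1 \<Longrightarrow> \<phi> y > 0"
    and \<phi>_mono: "\<And>y z. 0 < y \<Longrightarrow> y < z \<Longrightarrow> z < 1 \<Longrightarrow> \<phi> y < \<phi> z"
    and \<phi>': "(\<phi> has_real_derivative \<phi>') (at x)" "\<phi>' > 0"
    and lim: "\<And>y. 0 < y \<Longrightarrow> y < 1 \<Longrightarrow> (\<lambda>N. F N y / d N) \<longlonglongrightarrow> - ln y"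
    and tangent: "\<And>y N. 0 < y \<Longrightarrow> y < 1 \<Longrightarrow> N \<ge> 1 \<Longrightarrow> F N y - F N x \<ge> (ln (\<phi> x) - ln (\<phi> y)) * E N"
    and d: "\<And>N. N \<ge> 1 \<Longrightarrow> d N > 0"
  shows "(\<lambda>N. E N / d N) \<longlonglongrightarrow> \<phi> x / (x * \<phi>')"
proof -
  define s where "s y = (ln y - ln x) / (ln (\<phi> y) - ln (\<phi> x))" for y
  have "((\<lambda>y. (ln y - ln x) / (y - x)) \<longlongrightarrow> 1 / x) (at x)"
    using x by (subst has_field_derivative_iff[symmetric]) (auto intro!: derivative_eq_intros)
  moreover have "((\<lambda>y. (ln (\<phi> y) - ln (\<phi> x)) / (y - x)) \<longlongrightarrow> \<phi>' / \<phi> x) (at x)"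
    using \<phi>_pos[OF x] by (subst has_field_derivative_iff[symmetric]) (auto intro!: derivative_eq_intros \<phi>')
  ultimately have "((\<lambda>y. ((ln y - ln x) / (y - x)) / ((ln (\<phi> y) - ln (\<phi> x)) / (y - x))) \<longlongrightarrow> (1 / x) / (\<phi>' / \<phi> x)) (at x)"
    by (rule tendsto_divide) (use \<phi>'(2) \<phi>_pos[OF x] in auto)
  moreover have "\<forall>\<^sub>F y in at x. ((ln y - ln x) / (y - x)) / ((ln (\<phi> y) - ln (\<phi> x)) / (y - x)) = s y"
    by (rule eventually_mono[OF eventually_neq_at_within[of x]]) (auto simp: s_def)
  ultimately have "(s \<longlongrightarrow> (1 / x) / (\<phi>' / \<phi> x)) (at x)"
    by (rule Lim_transform_eventually)
  hence s: "(s \<longlongrightarrow> \<phi> x / (x * \<phi>')) (at x)" by simp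
  hence sR: "(s \<longlongrightarrow> \<phi> x / (x * \<phi>')) (at_right x)" and sL: "(s \<longlongrightarrow> \<phi> x / (x * \<phi>')) (at_left x)"
    by (auto intro: filterlim_mono at_le)
  have slope: "(\<lambda>N. (F N x / d N - F N y / d N) / (ln (\<phi> y) - ln (\<phi> x))) \<longlonglongrightarrow> s y" if "0 < y" "y < 1" "y \<noteq> x" for y
  proof -
    have "\<phi> y \<noteq> \<phi> x" using \<phi>_mono[of x y] \<phi>_mono[of y x] that x by (cases "x < y") auto
    hence ne: "ln (\<phi> y) - ln (\<phi> x) \<noteq> 0" using \<phi>_pos[OF x] \<phi>_pos[of y] that by simp
    have "(\<lambda>N. (F N x / d N - F N y / d N) / (ln (\<phi> y) - ln (\<phi> x))) \<longlonglongrightarrow> (- ln x - - ln y) / (ln (\<phi> y) - ln (\<phi> x))"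
      by (intro tendsto_intros lim) (use that x ne in auto)
    thus ?thesis by (simp add: s_def)
  qed
  have ineq: "(ln (\<phi> x) - ln (\<phi> y)) * (E N / d N) \<le> F N y / d N - F N x / d N" if "0 < y" "y < 1" "N \<ge> 1" for y N
    using divide_right_mono[OF tangent[OF that] less_imp_le[OF d[OF that(3)]]] by (simp add: diff_divide_distrib)
  show ?thesis
  proof (rule order_tendstoI)
    fix a assume "a < \<phi> x / (x * \<phi>')"
    hence "\<forall>\<^sub>F y in at_right x. a < s y" using order_tendstoD(1)[OF sR] by blast
    moreover have "\<forall>\<^sub>F y in at_right x. x < y \<and> y < 1"
      unfolding eventually_at_right_field using x by (intro exI[of _ 1]) auto
    ultimately have "\<exists>y. a < s y \<and> x < y \<and> y < 1"
      by (intro eventually_happens'[OF _ eventually_conj]) auto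
    then obtain y where y: "a < s y" "x < y" "y < 1" by blast
    have lnpos: "ln (\<phi> y) - ln (\<phi> x) > 0" using \<phi>_mono[of x y] \<phi>_pos[OF x] y x by simp
    have "\<forall>\<^sub>F N in sequentially. a < (F N x / d N - F N y / d N) / (ln (\<phi> y) - ln (\<phi> x))"
      using order_tendstoD(1)[OF slope y(1)] y x by simp
    thus "\<forall>\<^sub>F N in sequentially. a < E N / d N"
      using eventually_ge_at_top[of 1]
    proof eventually_elim
      case (elim N)
      have "(F N x / d N - F N y / d N) \<le> (E N / d N) * (ln (\<phi> y) - ln (\<phi> x))"
        using ineq[of y N] y x elim by (simp add: algebra_simps)
      hence "(F N x / d N - F N y / d N) / (ln (\<phi> y) - ln (\<phi> x)) \<le> E N / d N"
        using lnpos by (simp only: pos_divide_le_eq)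
      thus ?case using elim by linarith
    qed
  next
    fix a assume "a > \<phi> x / (x * \<phi>')"
    hence "\<forall>\<^sub>F y in at_left x. a > s y" using order_tendstoD(2)[OF sL] by blast
    moreover have "\<forall>\<^sub>F y in at_left x. 0 < y \<and> y < x"
      unfolding eventually_at_left_field using x by (intro exI[of _ 0]) auto
    ultimately have "\<exists>y. a > s y \<and> 0 < y \<and> y < x"
      by (intro eventually_happens'[OF _ eventually_conj]) auto
    then obtain y where y: "a > s y" "0 < y" "y < x" by blast
    have lnneg: "ln (\<phi> x) - ln (\<phi> y) > 0" using \<phi>_mono[of y x] \<phi>_pos[of y] y x by simp
    have "\<forall>\<^sub>F N in sequentially. a > (F N x / d N - F N y / d N) / (ln (\<phi> y) - ln (\<phi> x))"
      using order_tendstoD(2)[OF slope y(1)] y x by simp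
    thus "\<forall>\<^sub>F N in sequentially. E N / d N < a"
      using eventually_ge_at_top[of 1]
    proof eventually_elim
      case (elim N)
      have "(E N / d N) * (ln (\<phi> x) - ln (\<phi> y)) \<le> F N y / d N - F N x / d N"
        using ineq[of y N] y x elim by (simp add: algebra_simps)
      hence "E N / d N \<le> (F N y / d N - F N x / d N) / (ln (\<phi> x) - ln (\<phi> y))"
        using lnneg by (simp only: pos_le_divide_eq)
      also have "\<dots> = (F N x / d N - F N y / d N) / (ln (\<phi> y) - ln (\<phi> x))"
        using minus_divide_divide[of "F N x / d N - F N y / d N" "ln (\<phi> y) - ln (\<phi> x)"] by simp
      finally show ?case using elim by linarith
    qed
  qed
qed

section \<open>Return frequencies as mean numbers of zeros\<close>

context sos
begin

lemma prob_sos: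
  assumes "sos_Z b N > 0"
  shows "\<P>(X in sos_measure b N. P X) = (\<Sum>X\<in>{X \<in> sos_paths N. P X}. sos_weight b N X) / sos_Z b N"
proof -
  have nn: "sos_weight b N X / sos_Z b N \<ge> 0" for X using sos_weight_pos[of N X] assms by (simp add: less_imp_le)
  have "emeasure (sos_measure b N) {X \<in> sos_paths N. P X} = (\<Sum>X\<in>{X \<in> sos_paths N. P X}. ennreal (sos_weight b N X / sos_Z b N))"
    unfolding sos_measure_def by (rule emeasure_point_measure_finite) (use finite_sos_paths in auto)
  also have "\<dots> = ennreal (\<Sum>X\<in>{X \<in> sos_paths N. P X}. sos_weight b N X / sos_Z b N)"
    by (rule sum_ennreal) (use nn in auto)
  finally have "measure (sos_measure b N) {X \<in> sos_paths N. P X} = (\<Sum>X\<in>{X \<in> sos_paths N. P X}. sos_weight b N X / sos_Z b N)"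
    by (rule measure_eq_emeasure_eq_ennreal[rotated]) (intro sum_nonneg nn)
  thus ?thesis by (simp add: sos_measure_def space_point_measure sum_divide_distrib)
qed

lemma sum_visits:
  assumes "finite S"
  shows "(\<Sum>l=i..j. \<Sum>X\<in>{X \<in> S. X ! l = 0}. sos_weight b N X)
     = (\<Sum>X\<in>S. sos_weight b N X * real (card {l \<in> {i..j}. X ! l = 0}))"
proof -
  have "(\<Sum>l=i..j. \<Sum>X\<in>{X \<in> S. X ! l = 0}. sos_weight b N X) = (\<Sum>l=i..j. \<Sum>X\<in>S. if X ! l = 0 then sos_weight b N X else 0)"
    by (intro sum.cong refl sum.inter_filter assms)
  also have "\<dots> = (\<Sum>X\<in>S. \<Sum>l=i..j. if X ! l = 0 then sos_weight b N X else 0)" by (rule sum.swap)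
  also have "\<dots> = (\<Sum>X\<in>S. \<Sum>l\<in>{l \<in> {i..j}. X ! l = 0}. sos_weight b N X)"
    by (intro sum.cong refl sum.inter_filter[symmetric]) simp
  finally show ?thesis by (simp add: mult.commute)
qed

lemma free_return_freq_eq:
  assumes Z: "sos_Z b N > 0"
  shows "free_return_freq b N = (mean_zeros b N (sos_paths N) - 1) / real N"
proof -
  have z: "zeros N X = Suc (card {l \<in> {1..N}. X ! l = 0})" if "X \<in> sos_paths N" for X
  proof -
    have "{n \<in> {0..N}. X ! n = 0} = insert 0 {l \<in> {1..N}. X ! l = 0}"
      using that by (auto simp: sos_paths_def Suc_le_eq)
    moreover have "card (insert 0 {l \<in> {1..N}. X ! l = 0}) = Suc (card {l \<in> {1..N}. X ! l = 0})"
      by (rule card_insert_disjoint) auto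
    ultimately show ?thesis by (simp only: zeros_def)
  qed
  have "(\<Sum>l=1..N. \<P>(X in sos_measure b N. X ! l = 0))
     = (\<Sum>X\<in>sos_paths N. sos_weight b N X * real (card {l \<in> {1..N}. X ! l = 0})) / sos_Z b N"
    unfolding prob_sos[OF Z] sum_divide_distrib[symmetric] by (simp only: sum_visits[OF finite_sos_paths])
  also have "(\<Sum>X\<in>sos_paths N. sos_weight b N X * real (card {l \<in> {1..N}. X ! l = 0}))
     = (\<Sum>X\<in>sos_paths N. sos_weight b N X * real (zeros N X)) - sos_Z b N"
    unfolding sos_Z_def sum_subtractf[symmetric] by (rule sum.cong) (auto simp: z algebra_simps)
  also have "\<dots> / sos_Z b N = mean_zeros b N (sos_paths N) - 1"
    using Z by (simp add: mean_zeros_def sos_Z_def diff_divide_distrib)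
  finally show ?thesis by (simp add: free_return_freq_def)
qed

lemma pinned_return_freq_eq:
  assumes Z: "Zto (2 * N) 0 > 0" and N: "N \<ge> 1"
  shows "pinned_return_freq b N = (mean_zeros b (2 * N) (paths_to (2 * N) 0) - 2) / real (2 * N - 1)"
proof -
  have Z': "sos_Z b (2 * N) > 0"
  proof -
    have "Zto (2 * N) 0 \<le> sos_Z b (2 * N)" unfolding sos_Z_eq by (rule member_le_sum) (auto simp: Zto_nonneg)
    thus ?thesis using Z by linarith
  qed
  have z: "zeros (2 * N) X = Suc (Suc (card {l \<in> {1..2 * N - 1}. X ! l = 0}))" if "X \<in> paths_to (2 * N) 0" for X
  proof -
    have "{n \<in> {0..2 * N}. X ! n = 0} = insert 0 (insert (2 * N) {l \<in> {1..2 * N - 1}. X ! l = 0})"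
      using that by (auto simp: paths_to_def sos_paths_def Suc_le_eq)
    moreover have "card (insert 0 (insert (2 * N) {l \<in> {1..2 * N - 1}. X ! l = 0})) = Suc (card (insert (2 * N) {l \<in> {1..2 * N - 1}. X ! l = 0}))"
      by (rule card_insert_disjoint) (use N in auto)
    moreover have "card (insert (2 * N) {l \<in> {1..2 * N - 1}. X ! l = 0}) = Suc (card {l \<in> {1..2 * N - 1}. X ! l = 0})"
      by (rule card_insert_disjoint) (use N in auto)
    ultimately show ?thesis by (simp only: zeros_def)
  qed
  have cond: "\<P>(X in sos_measure b (2 * N). X ! l = 0 \<bar> X ! (2 * N) = 0)
      = (\<Sum>X\<in>{X \<in> paths_to (2 * N) 0. X ! l = 0}. sos_weight b (2 * N) X) / Zto (2 * N) 0" for l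
  proof -
    have "{X \<in> sos_paths (2 * N). X ! l = 0 \<and> X ! (2 * N) = 0} = {X \<in> paths_to (2 * N) 0. X ! l = 0}"
      by (auto simp: paths_to_def)
    thus ?thesis using Z' by (simp add: cond_prob_def prob_sos Zto_def paths_to_def)
  qed
  have "(\<Sum>l=1..2 * N - 1. \<P>(X in sos_measure b (2 * N). X ! l = 0 \<bar> X ! (2 * N) = 0))
     = (\<Sum>X\<in>paths_to (2 * N) 0. sos_weight b (2 * N) X * real (card {l \<in> {1..2 * N - 1}. X ! l = 0})) / Zto (2 * N) 0"
    unfolding cond sum_divide_distrib[symmetric] by (simp only: sum_visits[OF finite_paths_to])
  also have "(\<Sum>X\<in>paths_to (2 * N) 0. sos_weight b (2 * N) X * real (card {l \<in> {1..2 * N - 1}. X ! l = 0}))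
     = (\<Sum>X\<in>paths_to (2 * N) 0. sos_weight b (2 * N) X * real (zeros (2 * N) X)) - 2 * Zto (2 * N) 0"
    unfolding Zto_def sum_distrib_left sum_subtractf[symmetric]
    by (rule sum.cong[OF refl], subst z, assumption) (simp add: distrib_left)
  also have "\<dots> / Zto (2 * N) 0 = mean_zeros b (2 * N) (paths_to (2 * N) 0) - 2"
    using Z by (simp add: mean_zeros_def Zto_def diff_divide_distrib)
  finally show ?thesis by (simp add: pinned_return_freq_def)
qed

end

section \<open>The density of returns along the parametrised curve\<close>

locale critical_sos = critical_jacobi "\<lambda>p. if p = 0 then 0 else 1 / (2 * sqrt (b p * b (Suc p)))" \<alpha> \<zeta>
  for b :: "nat \<Rightarrow> real" and \<alpha> \<zeta> :: real +
  assumes b_pos: "n \<ge> 1 \<Longrightarrow> b n > 0" and b_lim: "b \<longlonglongrightarrow> 1"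
begin

text \<open>The renewal equation solved for the parameter: the generating function of weighted
  excursions, \<open>loop_gf x / (4 b1 b0)\<close>, equals 1 at \<open>b0 = b_of x\<close>.\<close>

definition b_of :: "real \<Rightarrow> real" where
  "b_of x = loop_gf x / (4 * b 1)"

lemma loop_gf_pos: "0 < x \<Longrightarrow> x \<le> 1 \<Longrightarrow> loop_gf x > 0"
  using green_pos[of x 1] by (simp add: loop_gf_eq)

lemma b_of_pos: "0 < x \<Longrightarrow> x \<le> 1 \<Longrightarrow> b_of x > 0"
  using loop_gf_pos b_pos[of 1] by (simp add: b_of_def)

text \<open>The value \<open>W 0\<close> is chosen so that \<open>hop 0 * W 0 = 1\<close>
  compensates the source at site 1; the equation at site 0 then amounts to
  \<open>\<beta> = b_of x\<close>. Linear growth follows from \<open>green x \<le> h\<close> and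
  \<open>1/2 - \<alpha> < 1\<close>.\<close>

lemma eigenvector:
  assumes x: "0 < x" "x < 1"
  shows "\<exists>M W. sos_eigen (b(0 := b_of x)) (1 / x) M W"
proof -
  define \<beta> where "\<beta> = b_of x"
  have \<beta>: "\<beta> > 0" "4 * b 1 * \<beta> = x * green x 1"
    using b_of_pos[of x] x b_pos[of 1] by (simp_all add: \<beta>_def b_of_def loop_gf_eq)
  interpret s: sos "b(0 := \<beta>)" by standard (use \<beta> b_pos in \<open>auto simp: Suc_le_eq\<close>)
  define W where "W p = (if p = 0 then 2 * sqrt (\<beta> * b 1) else green x p)" for p
  have W_pos: "W p > 0" for p
    using \<beta> b_pos[of 1] green_pos[of x p] x by (simp add: W_def)
  obtain \<kappa> where \<kappa>: "\<kappa> > 0" "(\<lambda>p. h p / real p powr (1/2 - \<alpha>)) \<longlonglongrightarrow> \<kappa>" using h_asymp by blast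
  obtain M1 where M1: "M1 > 0" "\<And>p. p \<ge> 1 \<Longrightarrow> h p \<le> M1 * real p powr (1/2 - \<alpha>)"
    using powr_asymp_bounds[OF h_pos \<kappa>] by blast
  have "(\<lambda>p. inverse (sqrt (b p))) \<longlonglongrightarrow> inverse (sqrt 1)" by (intro tendsto_intros b_lim) auto
  from convergent_imp_Bseq[OF convergentI[OF this]] obtain M2
    where M2: "M2 > 0" "\<And>p. \<bar>inverse (sqrt (b p))\<bar> \<le> M2" by (auto simp: Bseq_def)
  define M where "M = M1 + M2 + W 0 + inverse (sqrt \<beta>)"
  have inv: "inverse (sqrt \<beta>) > 0" using \<beta> by simp
  have M: "M1 \<le> M" "M2 \<le> M" "W 0 \<le> M" "inverse (sqrt \<beta>) \<le> M" "M > 0"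
    using M1(1) M2(1) W_pos[of 0] inv unfolding M_def by linarith+
  have "sos_eigen (b(0 := \<beta>)) (1 / x) M W"
  proof
    show "1 / x > 0" using x by simp
    show "W p > 0" for p by (rule W_pos)
    show "jac s.hop W p = 1 / x * W p" for p
    proof (cases p)
      case 0
      have "s.hop 0 * green x 1 = 4 * b 1 * \<beta> / x / (2 * sqrt (\<beta> * b 1))"
        unfolding \<beta>(2) using x by (simp add: s.hop_def)
      also have "4 * b 1 * \<beta> = (2 * sqrt (\<beta> * b 1)) * (2 * sqrt (\<beta> * b 1))"
        using \<beta>(1) b_pos[of 1] by simp
      also have "(2 * sqrt (\<beta> * b 1)) * (2 * sqrt (\<beta> * b 1)) / x / (2 * sqrt (\<beta> * b 1)) = 1 / x * (2 * sqrt (\<beta> * b 1))"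
      proof -
        have "u * u / x / u = 1 / x * u" if "u > 0" for u :: real using that by simp
        moreover have "2 * sqrt (\<beta> * b 1) > 0" using W_pos[of 0] by (simp add: W_def)
        ultimately show ?thesis .
      qed
      finally have "s.hop 0 * green x 1 = 1 / x * (2 * sqrt (\<beta> * b 1))" .
      moreover have "W 0 = 2 * sqrt (\<beta> * b 1)" "W 1 = green x 1" by (simp_all add: W_def)
      ultimately show ?thesis by (simp only: 0 jac_0)
    next
      case (Suc q)
      have R: "R (green x) p = green x p / x - unit_vec 1 p" by (rule green_eq) (use x in auto)
      show ?thesis
      proof (cases "q = 0")
        case True
        have "s.hop 0 * W 0 = 1" using \<beta>(1) b_pos[of 1] by (simp add: s.hop_def W_def)
        thus ?thesis using R by (simp add: Suc True jac_Suc W_def s.hop_def unit_vec_def)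
      next
        case False
        thus ?thesis using R by (simp add: Suc jac_Suc W_def s.hop_def unit_vec_def)
      qed
    qed
    show "W p \<le> M * real (p + 1)" for p
    proof (cases "p = 0")
      case False
      have "W p \<le> h p" using False green_mono[of x 1 p] x by (simp add: W_def)
      also have "\<dots> \<le> M1 * real p powr (1/2 - \<alpha>)" using M1 False by simp
      also have "\<dots> \<le> M * real p powr 1"
        using M False \<alpha> by (intro mult_mono powr_mono) auto
      also have "\<dots> \<le> M * real (p + 1)" using M by simp
      finally show ?thesis .
    qed (use M in simp)
    show "1 / M \<le> sqrt ((b(0 := \<beta>)) p)" for p
    proof -
      have "sqrt ((b(0 := \<beta>)) p) > 0" using s.b_pos by simp
      moreover have "inverse (sqrt ((b(0 := \<beta>)) p)) \<le> M"
        using M M2(2)[of p] b_pos[of p] by (cases "p = 0") auto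
      ultimately show ?thesis using M(5) by (simp add: field_simps)
    qed
  qed
  thus ?thesis unfolding \<beta>_def by blast
qed

text \<open>Up to vanishing corrections both frequencies are \<open>mean_zeros\<close> divided by
  the length, hence slopes of log partition functions that share the limit \<open>- ln x\<close>. So
  the pinned and the free density coincide, and the description by \<open>THE\<close> is
  meaningful.\<close>

theorem return_density_eq:
  assumes x: "0 < x" "x < 1"
  shows "return_density b (b_of x) = loop_gf x / (x * loop_gf' x)"
proof -
  define m where "m = b_of x / (x * (loop_gf' x / (4 * b 1)))"
  have m: "m = loop_gf x / (x * loop_gf' x)"
    using b_pos[of 1] by (simp add: m_def b_of_def)
  have b_of_mono: "b_of y < b_of z" if "0 < y" "y < z" "z < 1" for y z
    using loop_gf_strict_mono[of y z] that b_pos[of 1] by (simp add: b_of_def divide_strict_right_mono)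
  have b_of_deriv: "(b_of has_real_derivative loop_gf' x / (4 * b 1)) (at x)"
    unfolding b_of_def[abs_def] using x by (intro DERIV_cdivide DERIV_loop_gf) auto
  have b_of_deriv_pos: "loop_gf' x / (4 * b 1) > 0" using loop_gf'_pos[OF x] b_pos[of 1] by simp
  have bp: "b_of y > 0" if "0 < y" "y < 1" for y using b_of_pos that by simp
  note tangent = ln_partition_tangent[of b, OF b_pos bp bp]
  have Zfree: "sos_Z (b(0 := b_of y)) N > 0" and Zpin: "sos.Zto (b(0 := b_of y)) (2 * N) 0 > 0"
    and lnfree: "(\<lambda>N. ln (sos_Z (b(0 := b_of y)) N) / real N) \<longlonglongrightarrow> - ln y"
    and lnpin: "(\<lambda>N. ln (sos.Zto (b(0 := b_of y)) (2 * N) 0) / real (2 * N)) \<longlonglongrightarrow> - ln y"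
    and ne: "sos_paths N \<noteq> {}" "paths_to (2 * N) 0 \<noteq> {}"
    if y: "0 < y" "y < 1" for y N
  proof -
    obtain M W where "sos_eigen (b(0 := b_of y)) (1 / y) M W" using eigenvector[OF y] by blast
    then interpret sos_eigen "b(0 := b_of y)" "1 / y" M W .
    have ln: "ln (1 / y) = - ln y" using y by (simp add: ln_div)
    show "(\<lambda>N. ln (sos_Z (b(0 := b_of y)) N) / real N) \<longlonglongrightarrow> - ln y" using ln_sos_Z by (simp add: ln)
    show "(\<lambda>N. ln (Zto (2 * N) 0) / real (2 * N)) \<longlonglongrightarrow> - ln y" using ln_Zto_0 by (simp add: ln)
    have "0 < (W 0)\<^sup>2 / (b_of y * M\<^sup>2) * (1 / y) ^ (2 * N) / (real (N + 1)) ^ 3"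
      using W_pos[of 0] M_pos bp[OF y] y by simp
    thus Z: "Zto (2 * N) 0 > 0" using Zto_0_lower[of N] by simp
    obtain k where "k > 0" "sos_Z (b(0 := b_of y)) N \<ge> k * (1 / y) ^ N / real (N + 1) ^ 3"
      using sos_Z_lower by blast
    moreover have "k * (1 / y) ^ N / real (N + 1) ^ 3 > 0" using \<open>k > 0\<close> y by simp
    ultimately show Z': "sos_Z (b(0 := b_of y)) N > 0" by linarith
    show "sos_paths N \<noteq> {}" using Z' by (auto simp: sos_Z_def)
    show "paths_to (2 * N) 0 \<noteq> {}" using Z by (auto simp: Zto_def)
  qed
  interpret s: sos "b(0 := b_of x)"
    by standard (use bp[OF x] b_pos in \<open>auto simp: Suc_le_eq\<close>)
  have sos_y: "sos (b(0 := b_of y))" if "0 < y" "y < 1" for y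
    by standard (use bp[OF that] b_pos in \<open>auto simp: Suc_le_eq\<close>)
  have free: "free_return_freq (b(0 := b_of x)) \<longlonglongrightarrow> m"
  proof -
    have "(\<lambda>N. mean_zeros (b(0 := b_of x)) N (sos_paths N) / real N) \<longlonglongrightarrow> m"
      unfolding m_def
      by (rule limit_of_tangent_slopes[where F = "\<lambda>N y. ln (sos_Z (b(0 := b_of y)) N)"])
        (use x bp b_of_mono b_of_deriv b_of_deriv_pos lnfree tangent[OF _ _ _ _ _ finite_sos_paths ne(1)[OF x]] in \<open>auto simp: sos_Z_def\<close>)
    moreover have "(\<lambda>N. 1 / real N) \<longlonglongrightarrow> 0" by real_asymp
    ultimately have "(\<lambda>N. mean_zeros (b(0 := b_of x)) N (sos_paths N) / real N - 1 / real N) \<longlonglongrightarrow> m - 0"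
      by (rule tendsto_diff)
    moreover have "free_return_freq (b(0 := b_of x)) = (\<lambda>N. mean_zeros (b(0 := b_of x)) N (sos_paths N) / real N - 1 / real N)"
      by (rule ext) (simp add: s.free_return_freq_eq[OF Zfree[OF x]] diff_divide_distrib)
    ultimately show ?thesis by simp
  qed
  have pinned: "pinned_return_freq (b(0 := b_of x)) \<longlonglongrightarrow> m"
  proof -
    have Zto_alt: "sos.Zto (b(0 := b_of y)) N z = (\<Sum>X\<in>paths_to N z. sos_weight (b(0 := b_of y)) N X)"
      if "0 < y" "y < 1" for y N z
      by (rule sos.Zto_def[OF sos_y[OF that]])
    have "(\<lambda>N. mean_zeros (b(0 := b_of x)) (2 * N) (paths_to (2 * N) 0) / real (2 * N)) \<longlonglongrightarrow> m"
      unfolding m_def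
      by (rule limit_of_tangent_slopes[where F = "\<lambda>N y. ln (sos.Zto (b(0 := b_of y)) (2 * N) 0)"])
        (use x bp b_of_mono b_of_deriv b_of_deriv_pos lnpin tangent[OF _ _ _ _ _ finite_paths_to ne(2)[OF x]] in \<open>auto simp: Zto_alt\<close>)
    moreover have "(\<lambda>N::nat. real (2 * N) / real (2 * N - 1)) \<longlonglongrightarrow> 1" by real_asymp
    moreover have "(\<lambda>N::nat. 2 / real (2 * N - 1)) \<longlonglongrightarrow> 0" by real_asymp
    ultimately have "(\<lambda>N. mean_zeros (b(0 := b_of x)) (2 * N) (paths_to (2 * N) 0) / real (2 * N) * (real (2 * N) / real (2 * N - 1))
        - 2 / real (2 * N - 1)) \<longlonglongrightarrow> m * 1 - 0"
      by (intro tendsto_intros)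
    moreover have "\<forall>\<^sub>F N in sequentially. mean_zeros (b(0 := b_of x)) (2 * N) (paths_to (2 * N) 0) / real (2 * N) * (real (2 * N) / real (2 * N - 1))
        - 2 / real (2 * N - 1) = pinned_return_freq (b(0 := b_of x)) N"
    proof (rule eventually_mono[OF eventually_ge_at_top[of 1]])
      fix N :: nat assume N: "N \<ge> 1"
      show "mean_zeros (b(0 := b_of x)) (2 * N) (paths_to (2 * N) 0) / real (2 * N) * (real (2 * N) / real (2 * N - 1))
        - 2 / real (2 * N - 1) = pinned_return_freq (b(0 := b_of x)) N"
        unfolding s.pinned_return_freq_eq[OF Zpin[OF x] N] using N by (simp add: diff_divide_distrib)
    qed
    ultimately show ?thesis by (auto dest: Lim_transform_eventually)
  qed
  have "return_density b (b_of x) = m" unfolding return_density_def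
    by (rule the_equality) (use free pinned LIMSEQ_unique in blast)+
  thus ?thesis by (simp add: m)
qed

end

section \<open>Spectral radius and critical point\<close>

context critical_sos
begin

abbreviation c where "c \<equiv> \<lambda>p. if p = 0 then 0 else 1 / (2 * sqrt (b p * b (Suc p)))"

lemma R_pow_entry_eq: "R_pow_entry b n i j = (R ^^ n) (unit_vec j) i"
  by (rule R_pow_entry_eq_jac)

text \<open>Since \<open>R h \<le> h\<close>, the powers of \<open>R\<close> applied to
  \<open>unit_vec j\<close>, which is at most \<open>h / h j\<close>, stay below that multiple of
  \<open>h\<close>. This bounds the spectral radius by 1.\<close>

lemma R_pow_upper:
  assumes "i \<ge> 1" "j \<ge> 1"
  shows "(R ^^ n) (unit_vec j) i \<le> h i / h j"
  using assms(1)
proof (induction n arbitrary: i)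
  case 0
  thus ?case using h_pos[OF assms(2)] h_pos[of i] by (simp add: unit_vec_def)
next
  case (Suc n)
  have "R ((R ^^ n) (unit_vec j)) i \<le> R (\<lambda>p. 1 / h j * h p) i"
    by (rule R_mono) (use Suc.IH in simp)
  also have "\<dots> = 1 / h j * (h i - unit_vec 1 i)" by (simp only: jac_scale h_eq)
  also have "\<dots> \<le> h i / h j" using h_pos[OF assms(2)] by (simp add: unit_vec_def divide_right_mono)
  finally show ?case by simp
qed

text \<open>On a long interval far from the origin a truncated parabola is a subsolution for any \<open>l < 1\<close>.\<close>

lemma R_pow_lower:
  assumes ij: "i \<ge> 1" "j \<ge> 1" "even (i + j)" and l: "0 < l" "l < 1"
  shows "\<exists>k>0. \<forall>\<^sub>F n in sequentially. k * l ^ (2 * n) \<le> (R ^^ (2 * n)) (unit_vec j) i"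
proof -
  \<comment> \<open>\<open>l = 1 - 2 \<delta>\<close> is below \<open>(1 - \<delta>)^2\<close>: one
    factor \<open>1 - \<delta>\<close> is lost to \<open>c\<close> being only close to 1/2, the
    other to the concavity of the parabola.\<close>
  define \<delta> where "\<delta> = (1 - l) / 2"
  have "2 * \<delta> = 1 - l" by (simp add: \<delta>_def)
  with l have \<delta>: "0 < \<delta>" "\<delta> < 1" and l_eq: "l = 1 - 2 * \<delta>" by linarith+
  have "\<forall>\<^sub>F q in sequentially. (1 - \<delta>) / 2 < c q"
    by (rule order_tendstoD(1)[OF c_tendsto]) (use \<delta> in simp)
  then obtain P0 where P0: "\<And>q. q \<ge> P0 \<Longrightarrow> (1 - \<delta>) / 2 < c q" by (auto simp: eventually_at_top_linorder)
  define P where "P = P0 + i + j"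
  \<comment> \<open>For the parabola \<open>t (2 L - t)\<close> the mean of the two neighbours is
    the value minus 1, and the smallest interior value is \<open>2 L - 1\<close>. With
    \<open>\<delta> (2 L - 1) \<ge> 1\<close> the loss of 1 is at most the fraction
    \<delta>.\<close>
  define L where "L = nat \<lceil>1 / \<delta>\<rceil> + 1"
  have L: "real L \<ge> 1 / \<delta> + 1" by (simp add: L_def of_nat_ceiling)
  hence L': "\<delta> * (2 * real L - 1) \<ge> 1" "real L \<ge> 1" using \<delta> by (auto simp: field_simps L_def)
  define v where "v q = (if P < q \<and> q < P + 2 * L then (real q - real P) * (real P + 2 * real L - real q) else 0)" for q
  have v_in: "v q = (real q - real P) * (real P + 2 * real L - real q)" if "P \<le> q" "q \<le> P + 2 * L" for q
    using that by (auto simp: v_def)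
  have v_nonneg: "v q \<ge> 0" for q by (auto simp: v_def)
  have sub: "R v q \<ge> l * v q" for q
  proof (cases "P < q \<and> q < P + 2 * L")
    case False
    hence "v q = 0" by (auto simp: v_def)
    moreover have "R v q \<ge> 0" using jac_pow_nonneg[of c v 1 q] c_nonneg v_nonneg by simp
    ultimately show ?thesis by simp
  next
    case True
    then obtain q' where q': "q = Suc q'" "P \<le> q'" by (cases q) auto
    define t where "t = real q - real P"
    have t: "1 \<le> t" "t \<le> 2 * real L - 1" using True by (auto simp: t_def)
    have vq: "v q = t * (2 * real L - t)" using v_in[of q] True by (simp add: t_def algebra_simps)
    have v1: "v (Suc q) = (t + 1) * (2 * real L - t - 1)" using v_in[of "Suc q"] True by (simp add: t_def algebra_simps)
    have v2: "v q' = (t - 1) * (2 * real L - t + 1)" using v_in[of q'] True q' by (simp add: t_def algebra_simps)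
    have "0 \<le> (t - 1) * (2 * real L - 1 - t)" using t by simp
    hence "2 * real L - 1 \<le> v q" unfolding vq by (simp add: algebra_simps)
    hence "\<delta> * (2 * real L - 1) \<le> \<delta> * v q" using \<delta> by (intro mult_left_mono) auto
    hence 1: "(1 - \<delta>) * v q \<le> v q - 1" using L' by (simp add: algebra_simps)
    have "l * v q \<le> (1 - \<delta>) * ((1 - \<delta>) * v q)"
    proof -
      have "l \<le> (1 - \<delta>) * (1 - \<delta>)" unfolding l_eq by (simp add: algebra_simps)
      from mult_right_mono[OF this v_nonneg[of q]] show ?thesis by (simp only: mult.assoc)
    qed
    also have "\<dots> \<le> (1 - \<delta>) * (v q - 1)" using 1 \<delta> by (intro mult_left_mono) auto
    also have "\<dots> = (1 - \<delta>) / 2 * v (Suc q) + (1 - \<delta>) / 2 * v q'"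
      unfolding v1 v2 vq by (simp add: algebra_simps)
    also have "\<dots> \<le> c q * v (Suc q) + c q' * v q'"
    proof (intro add_mono mult_right_mono v_nonneg)
      show "(1 - \<delta>) / 2 \<le> c q" "(1 - \<delta>) / 2 \<le> c q'"
        using P0[of q] P0[of q'] q' unfolding P_def by (simp_all only:) linarith+
    qed
    also have "\<dots> = R v q" by (simp add: q' jac_Suc)
    finally show ?thesis .
  qed
  define k0 where "k0 = P + L"
  have vk: "v k0 = real L * real L" using v_in[of k0] by (simp add: k0_def)
  define V where "V = (\<Sum>p\<le>P + 2 * L. (v p)\<^sup>2)"
  have "V \<ge> (v k0)\<^sup>2" unfolding V_def by (rule member_le_sum) (auto simp: k0_def)
  moreover have "v k0 > 0" using L' by (simp add: vk)
  ultimately have V: "V > 0" by (smt (verit) zero_less_power)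
  have diag: "(R ^^ (2 * n)) (unit_vec k0) k0 \<ge> (v k0)\<^sup>2 / V * l ^ (2 * n)" for n
  proof -
    have "(\<Sum>p\<le>k0 + n. (v p)\<^sup>2) = (\<Sum>p\<in>{..k0 + n} \<inter> {..P + 2 * L}. (v p)\<^sup>2)"
      by (rule sum.mono_neutral_right) (auto simp: v_def)
    also have "\<dots> \<le> V" unfolding V_def by (rule sum_mono2) auto
    finally have S: "(\<Sum>p\<le>k0 + n. (v p)\<^sup>2) \<le> V" .
    have "(l ^ n * v k0)\<^sup>2 \<le> (R ^^ (2 * n)) (unit_vec k0) k0 * (\<Sum>p\<le>k0 + n. (v p)\<^sup>2)"
      by (rule jac_pow_diag_lower) (use l sub v_nonneg c_nonneg in auto)
    also have "\<dots> \<le> (R ^^ (2 * n)) (unit_vec k0) k0 * V" by (intro mult_left_mono S R_pow_nonneg)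
    finally show ?thesis using V by (simp add: field_simps power_mult_distrib power_mult)
  qed
  \<comment> \<open>\<open>i\<close> and \<open>j\<close> are joined to the centre \<open>k0\<close>
    by straight paths of lengths \<open>a\<close> and \<open>a'\<close>. Their sum is even because
    \<open>i + j\<close> is, so that an even number of steps remains for the loop at
    \<open>k0\<close>.\<close>
  define a a' where "a = k0 - i" and "a' = k0 - j"
  have ik: "i \<le> k0" "j \<le> k0" by (simp_all add: k0_def P_def)
  have "even (a + a')" using ij ik by (simp add: a_def a'_def)
  then obtain d where d: "a + a' = 2 * d" by blast
  define A where "A = (R ^^ a) (unit_vec k0) i"
  define A' where "A' = (R ^^ a') (unit_vec j) k0"
  have A: "A > 0" unfolding A_def a_def by (rule jac_pow_unit_pos'(1)) (use c_nonneg c_pos ij ik in auto)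
  have A': "A' > 0" unfolding A'_def a'_def by (rule jac_pow_unit_pos'(2)) (use c_nonneg c_pos ij ik in auto)
  define k where "k = A * ((v k0)\<^sup>2 / V) * A'"
  have k: "k > 0" using A A' V \<open>v k0 > 0\<close> by (simp add: k_def)
  have "k * l ^ (2 * n) \<le> (R ^^ (2 * n)) (unit_vec j) i" if "n \<ge> d" for n
  proof -
    have n: "2 * n = (a + 2 * (n - d)) + a'" using d that by simp
    have "k * l ^ (2 * n) \<le> k * l ^ (2 * (n - d))"
      using k l by (intro mult_left_mono power_decreasing) auto
    also have "\<dots> = A * ((v k0)\<^sup>2 / V * l ^ (2 * (n - d))) * A'" by (simp add: k_def)
    also have "\<dots> \<le> A * (R ^^ (2 * (n - d))) (unit_vec k0) k0 * A'"
      using diag A A' by (intro mult_right_mono mult_left_mono) auto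
    also have "A * (R ^^ (2 * (n - d))) (unit_vec k0) k0 \<le> (R ^^ (a + 2 * (n - d))) (unit_vec k0) i"
      unfolding A_def by (rule jac_pow_compose_lower[OF c_nonneg])
    also have "(R ^^ (a + 2 * (n - d))) (unit_vec k0) i * A' \<le> (R ^^ (2 * n)) (unit_vec j) i"
      unfolding A'_def n by (rule jac_pow_compose_lower[OF c_nonneg])
    finally show ?thesis using A' by (simp add: mult_right_mono)
  qed
  thus ?thesis using k by (intro exI[of _ k]) (auto simp: eventually_at_top_linorder)
qed

lemma R_pow_root_tendsto:
  assumes ij: "i \<ge> 1" "j \<ge> 1" "even (i + j)"
  shows "(\<lambda>n. R_pow_entry b (2 * n) i j powr (1 / real (2 * n))) \<longlonglongrightarrow> 1"
  unfolding R_pow_entry_eq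
proof (rule order_tendstoI)
  fix a :: real assume "a < 1"
  define l where "l = max (1/2) ((a + 1) / 2)"
  have "(a + 1) / 2 \<le> l" "1 / 2 \<le> l" "l < 1" using \<open>a < 1\<close> by (simp_all add: l_def)
  hence l: "0 < l" "l < 1" "a < l" using \<open>a < 1\<close> by simp_all
  obtain k where k: "k > 0" "\<forall>\<^sub>F n in sequentially. k * l ^ (2 * n) \<le> (R ^^ (2 * n)) (unit_vec j) i"
    using R_pow_lower[OF ij l(1,2)] by blast
  have "(\<lambda>n. k powr (1 / real (2 * n)) * l) \<longlonglongrightarrow> 1 * l"
    by (intro tendsto_intros) (use k(1) in real_asymp)
  hence "\<forall>\<^sub>F n in sequentially. a < k powr (1 / real (2 * n)) * l"
    using l(3) by (intro order_tendstoD(1)[of _ "1 * l"]) auto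
  with k(2) eventually_gt_at_top[of 0] show "\<forall>\<^sub>F n in sequentially. a < (R ^^ (2 * n)) (unit_vec j) i powr (1 / real (2 * n))"
  proof eventually_elim
    case (elim n)
    have "l = (l ^ (2 * n)) powr (1 / real (2 * n))"
      using l elim by (simp only: powr_realpow[symmetric] powr_powr) simp
    hence "k powr (1 / real (2 * n)) * l = (k * l ^ (2 * n)) powr (1 / real (2 * n))"
      using k l by (simp add: powr_mult)
    also have "\<dots> \<le> (R ^^ (2 * n)) (unit_vec j) i powr (1 / real (2 * n))"
      using elim k l by (intro powr_mono2) auto
    finally show ?case using elim by simp
  qed
next
  fix a :: real assume "a > 1"
  define K where "K = h i / h j"
  have K: "K > 0" using h_pos ij by (simp add: K_def)
  have "(\<lambda>n. K powr (1 / real (2 * n))) \<longlonglongrightarrow> 1" using K by real_asymp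
  hence "\<forall>\<^sub>F n in sequentially. K powr (1 / real (2 * n)) < a" using \<open>a > 1\<close> by (rule order_tendstoD)
  thus "\<forall>\<^sub>F n in sequentially. (R ^^ (2 * n)) (unit_vec j) i powr (1 / real (2 * n)) < a"
  proof eventually_elim
    case (elim n)
    have "(R ^^ (2 * n)) (unit_vec j) i powr (1 / real (2 * n)) \<le> K powr (1 / real (2 * n))"
      unfolding K_def using R_pow_upper ij R_pow_nonneg by (intro powr_mono2) auto
    thus ?case using elim by simp
  qed
qed

lemma rho_star_eq: "rho_star b = 1"
  unfolding rho_star_def
proof (rule the_equality)
  show "\<forall>i\<ge>1. \<forall>j\<ge>1. even (i + j) \<longrightarrow> (\<lambda>n. R_pow_entry b (2 * n) i j powr (1 / real (2 * n))) \<longlonglongrightarrow> 1"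
    using R_pow_root_tendsto by blast
  fix \<rho> assume "\<forall>i\<ge>1. \<forall>j\<ge>1. even (i + j) \<longrightarrow> (\<lambda>n. R_pow_entry b (2 * n) i j powr (1 / real (2 * n))) \<longlonglongrightarrow> \<rho>"
  hence "(\<lambda>n. R_pow_entry b (2 * n) 1 1 powr (1 / real (2 * n))) \<longlonglongrightarrow> \<rho>" by simp
  moreover have "(\<lambda>n. R_pow_entry b (2 * n) 1 1 powr (1 / real (2 * n))) \<longlonglongrightarrow> 1" by (rule R_pow_root_tendsto) auto
  ultimately show "\<rho> = 1" by (rule LIMSEQ_unique)
qed

text \<open>The Green function is itself a solution and lies below all others, so the infimum is
  attained.\<close>

lemma w1_inf_eq:
  assumes "\<rho> > 1"
  shows "w1_inf b \<rho> = ereal (green (1 / \<rho>) 1)"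
proof -
  have x: "0 < 1 / \<rho>" "1 / \<rho> \<le> 1" using assms by auto
  have sol: "positive_resolvent_solution b \<rho> (green (1 / \<rho>))"
    unfolding positive_resolvent_solution_def R_op_eq_jac
    using green_pos[OF x] green_eq[OF x] by (auto simp: unit_vec_def mult.commute)
  have le: "green (1 / \<rho>) 1 \<le> v 1" if "positive_resolvent_solution b \<rho> v" for v
  proof (rule green_le_supersolution)
    fix p :: nat assume "p \<ge> 1"
    with that have v: "v p > 0" "R v p = \<rho> * v p - unit_vec 1 p"
      by (auto simp: positive_resolvent_solution_def R_op_eq_jac unit_vec_def)
    show "v p \<ge> 0" using v by simp
    show "1 / \<rho> * (R v p + unit_vec 1 p) \<le> v p" using v assms by simp
  qed (use x in auto)
  show ?thesis unfolding w1_inf_def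
    by (rule antisym[OF Inf_lower Inf_greatest]) (use sol le in auto)
qed

section \<open>Identification of the critical point and transfer of limits to the parameter\<close>

lemma b_of_tendsto: "(b_of \<longlongrightarrow> b_of 1) (at_left 1)"
proof -
  have "((\<lambda>x. x * green x 1) \<longlongrightarrow> 1 * green 1 1) (at_left 1)"
    by (intro tendsto_mult green_tendsto_1 tendsto_ident_at)
  moreover have "\<forall>\<^sub>F x in at_left 1. x * green x 1 = loop_gf x"
    unfolding eventually_at_left_field by (intro exI[of _ 0]) (auto simp: loop_gf_eq)
  ultimately have "(loop_gf \<longlongrightarrow> loop_gf 1) (at_left 1)"
    by (auto simp: loop_gf_eq dest: Lim_transform_eventually)
  thus ?thesis unfolding b_of_def[abs_def] using b_pos[of 1] by (intro tendsto_divide tendsto_const) auto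
qed

lemma b0_crit_eq: "b0_crit b = ereal (b_of 1)"
  unfolding b0_crit_def rho_star_eq
proof (rule tendsto_Lim)
  have "filterlim (\<lambda>\<rho>::real. 1 / \<rho>) (at_left 1) (at_right 1)" by real_asymp
  from filterlim_compose[OF b_of_tendsto this]
  have "((\<lambda>\<rho>. ereal (b_of (1 / \<rho>))) \<longlongrightarrow> ereal (b_of 1)) (at_right 1)" by simp
  moreover have "\<forall>\<^sub>F \<rho> in at_right 1. ereal (b_of (1 / \<rho>)) = w1_inf b \<rho> / ereal (4 * b 1 * \<rho>)"
  proof (rule eventually_mono[OF eventually_at_right_less])
    fix \<rho> :: real assume "1 < \<rho>"
    thus "ereal (b_of (1 / \<rho>)) = w1_inf b \<rho> / ereal (4 * b 1 * \<rho>)"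
      using b_pos[of 1] by (simp add: w1_inf_eq b_of_def loop_gf_eq mult_ac)
  qed
  ultimately show "((\<lambda>\<rho>. w1_inf b \<rho> / ereal (4 * b 1 * \<rho>)) \<longlongrightarrow> ereal (b_of 1)) (at_right 1)"
    by (rule Lim_transform_eventually)
qed simp

text \<open>Continuity of \<open>b_of\<close> up to 1 and the intermediate value theorem show that
  every parameter slightly below \<open>b_of 1\<close> is some \<open>b_of x\<close> with
  \<open>x\<close> close to 1, so a limit along the curve is a limit in the parameter.\<close>

lemma tendsto_at_critical:
  assumes "((\<lambda>x. f (b_of x)) \<longlongrightarrow> y) (at_left 1)"
  shows "(f \<longlongrightarrow> y) (at_left (b_of 1))"
proof (rule topological_tendstoI)
  fix U assume "open U" "y \<in> U"
  from topological_tendstoD[OF assms this] obtain x1 where x1: "x1 < 1" "\<And>x. x1 < x \<Longrightarrow> x < 1 \<Longrightarrow> f (b_of x) \<in> U"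
    by (auto simp: eventually_at_left_field)
  define x0 where "x0 = max x1 0"
  have x0: "0 \<le> x0" "x0 < 1" "x1 \<le> x0" using x1 by (auto simp: x0_def)
  have cont: "continuous_on {x0..1} b_of"
    unfolding b_of_def[abs_def] using b_pos[of 1] x0
    by (intro continuous_intros continuous_on_subset[OF continuous_on_loop_gf]) auto
  have lt: "b_of x0 < b_of 1"
    using loop_gf_strict_mono[of x0 1] x0 b_pos[of 1] by (simp add: b_of_def divide_strict_right_mono)
  show "\<forall>\<^sub>F \<beta> in at_left (b_of 1). f \<beta> \<in> U"
    unfolding eventually_at_left_field
  proof (intro exI[of _ "b_of x0"] conjI allI impI lt)
    fix \<beta> assume \<beta>: "b_of x0 < \<beta>" "\<beta> < b_of 1"
    obtain x where x: "x0 \<le> x" "x \<le> 1" "b_of x = \<beta>"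
      using IVT'[of b_of x0 \<beta> 1] cont \<beta> x0 by auto
    have "x \<noteq> x0" "x \<noteq> 1" using x \<beta> by auto
    thus "f \<beta> \<in> U" using x1(2)[of x] x x0 by auto
  qed
qed

text \<open>In \<open>loop_gf x / (x * loop_gf' x)\<close> the numerator has a positive limit, and
  \<open>loop_gf'\<close> behaves like the power \<open>-\<gamma>\<close> of
  \<open>loop_gf 1 - loop_gf x\<close>. The factor \<open>(4 b1)^\<gamma>\<close> converts distances
  in \<open>loop_gf\<close> to distances in the parameter.\<close>

theorem return_density_asymp:
  "approx_const (return_density b) (\<lambda>b0. (real_of_ereal (b0_crit b) - b0) powr ((1 - \<alpha>) / \<alpha>))
     (at_left (real_of_ereal (b0_crit b)))"
proof -
  define \<gamma> where "\<gamma> = (1 - \<alpha>) / \<alpha>"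
  obtain K where K: "K > 0" "((\<lambda>x. loop_gf' x * (loop_gf 1 - loop_gf x) powr \<gamma>) \<longlongrightarrow> K) (at_left 1)"
    using loop_gf_asymp unfolding \<gamma>_def by blast
  have b1: "b 1 > 0" by (rule b_pos) simp
  have "((\<lambda>x. b_of x * (4 * b 1) / x) \<longlongrightarrow> b_of 1 * (4 * b 1) / 1) (at_left 1)"
    by (intro tendsto_intros b_of_tendsto) simp
  from tendsto_divide[OF this K(2)]
  have "((\<lambda>x. (b_of x * (4 * b 1) / x) / (loop_gf' x * (loop_gf 1 - loop_gf x) powr \<gamma>) * (4 * b 1) powr \<gamma>)
      \<longlongrightarrow> b_of 1 * (4 * b 1) / 1 / K * (4 * b 1) powr \<gamma>) (at_left 1)"
    using K by (intro tendsto_mult_right) auto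
  moreover have "\<forall>\<^sub>F x in at_left 1. (b_of x * (4 * b 1) / x) / (loop_gf' x * (loop_gf 1 - loop_gf x) powr \<gamma>) * (4 * b 1) powr \<gamma>
      = return_density b (b_of x) / (b_of 1 - b_of x) powr \<gamma>"
  proof -
    have "\<forall>\<^sub>F x in at_left (1::real). 0 < x \<and> x < 1"
      unfolding eventually_at_left_field by (intro exI[of _ 0]) auto
    thus ?thesis
    proof eventually_elim
      case (elim x)
      have d: "loop_gf 1 - loop_gf x > 0" using loop_gf_strict_mono[of x 1] elim by simp
      have "(b_of 1 - b_of x) powr \<gamma> = ((loop_gf 1 - loop_gf x) / (4 * b 1)) powr \<gamma>"
        by (simp add: b_of_def diff_divide_distrib)
      also have "\<dots> = (loop_gf 1 - loop_gf x) powr \<gamma> / (4 * b 1) powr \<gamma>"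
        using d b1 by (simp add: powr_divide)
      finally have e: "(b_of 1 - b_of x) powr \<gamma> = (loop_gf 1 - loop_gf x) powr \<gamma> / (4 * b 1) powr \<gamma>" .
      have "b_of x * (4 * b 1) = loop_gf x" using b1 by (simp add: b_of_def)
      thus ?case unfolding e using return_density_eq[of x] elim by simp
    qed
  qed
  ultimately have "((\<lambda>x. return_density b (b_of x) / (b_of 1 - b_of x) powr \<gamma>)
      \<longlongrightarrow> b_of 1 * (4 * b 1) / 1 / K * (4 * b 1) powr \<gamma>) (at_left 1)"
    by (rule Lim_transform_eventually)
  from tendsto_at_critical[of "\<lambda>\<beta>. return_density b \<beta> / (b_of 1 - \<beta>) powr \<gamma>", OF this]
  have "((\<lambda>\<beta>. return_density b \<beta> / (b_of 1 - \<beta>) powr \<gamma>)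
      \<longlongrightarrow> b_of 1 * (4 * b 1) / 1 / K * (4 * b 1) powr \<gamma>) (at_left (b_of 1))" .
  moreover have "b_of 1 * (4 * b 1) / 1 / K * (4 * b 1) powr \<gamma> \<noteq> 0"
    using b_of_pos[of 1] b1 K by simp
  ultimately show ?thesis unfolding approx_const_def b0_crit_eq \<gamma>_def[symmetric] real_of_ereal.simps by blast
qed

end

section \<open>From the given sequence to the hopping coefficients\<close>

lemma inverse_sqrt_expansion:
  fixes b :: "nat \<Rightarrow> real" and w \<zeta> :: real
  assumes \<zeta>: "0 < \<zeta>" "\<zeta> \<le> 1"
    and b: "(\<lambda>n. b n - (1 - w / (real n)\<^sup>2)) \<in> O(\<lambda>n. real n powr (- 2 - \<zeta>))"
  shows "b \<longlonglongrightarrow> 1"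
    and "(\<lambda>p. 1 / (2 * sqrt (b p * b (Suc p))) - (1 / 2 + w / 2 / (real p)\<^sup>2)) \<in> O(\<lambda>p. real p powr (- 2 - \<zeta>))"
proof -
  let ?u = "\<lambda>p. real p powr (- 2 - \<zeta>)"
  note le = powr_minus_3_bigo[OF \<zeta>(2)]
  have "(\<lambda>n. b n - (1 - w / (real n)\<^sup>2)) \<in> o(\<lambda>_. 1)"
  proof (rule landau_o.big_small_trans[OF b], rule smalloI_tendsto)
    show "((\<lambda>p. real p powr (- 2 - \<zeta>) / 1) \<longlonglongrightarrow> 0)"
      using tendsto_neg_powr[OF _ filterlim_real_sequentially, of "- 2 - \<zeta>"] \<zeta> by simp
  qed simp
  hence 1: "(\<lambda>n. b n - (1 - w / (real n)\<^sup>2)) \<longlonglongrightarrow> 0" by (auto dest: smalloD_tendsto)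
  have 2: "(\<lambda>n::nat. 1 - w / (real n)\<^sup>2) \<longlonglongrightarrow> 1" by real_asymp
  from tendsto_add[OF 1 2] show lim: "b \<longlonglongrightarrow> 1" by simp
  define e where "e n = b n - (1 - w / (real n)\<^sup>2)" for n
  \<comment> \<open>\<open>y\<close> is \<open>2 w / p^2\<close> up to the allowed error, so that
    \<open>1 / (2 sqrt (1 - y)) = 1/2 + y/4 + O(y^2)\<close> yields the coefficient
    \<open>w / 2\<close>.\<close>
  define y where "y p = 1 - b p * b (Suc p)" for p
  have e: "e \<in> O(?u)" using b by (simp add: e_def[abs_def])
  have "(\<lambda>p. e (Suc p)) \<in> O(\<lambda>p. real (Suc p) powr (- 2 - \<zeta>))"
    using landau_o.big.compose[OF e filterlim_Suc] .
  also have "(\<lambda>p::nat. real (Suc p) powr (- 2 - \<zeta>)) \<in> O(?u)" by real_asymp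
  finally have e': "(\<lambda>p. e (Suc p)) \<in> O(?u)" .
  have "(\<lambda>p::nat. 2 * w / (real p)\<^sup>2 - (1 - (1 - w / (real p)\<^sup>2) * (1 - w / (real (Suc p))\<^sup>2))) \<in> O(\<lambda>p. real p powr - 3)"
    by real_asymp
  note main = landau_o.big_trans[OF this le]
  have b1: "b \<in> O(\<lambda>_. 1)" using lim by (intro bigoI_tendsto[of _ _ 1]) auto
  have "(\<lambda>p::nat. 1 - w / (real (Suc p))\<^sup>2) \<in> O(\<lambda>_. 1)" by real_asymp
  from landau_o.big.mult[OF e this] landau_o.big.mult[OF b1 e']
  have "(\<lambda>p. e p * (1 - w / (real (Suc p))\<^sup>2) + b p * e (Suc p)) \<in> O(?u)"
    by (intro sum_in_bigo) simp_all
  from sum_in_bigo(1)[OF main this]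
  have "(\<lambda>p. 2 * w / (real p)\<^sup>2 - (1 - (1 - w / (real p)\<^sup>2) * (1 - w / (real (Suc p))\<^sup>2))
       + (e p * (1 - w / (real (Suc p))\<^sup>2) + b p * e (Suc p))) \<in> O(?u)" .
  also have "(\<lambda>p. 2 * w / (real p)\<^sup>2 - (1 - (1 - w / (real p)\<^sup>2) * (1 - w / (real (Suc p))\<^sup>2))
       + (e p * (1 - w / (real (Suc p))\<^sup>2) + b p * e (Suc p))) = (\<lambda>p. 2 * w / (real p)\<^sup>2 - y p)"
  proof (rule ext)
    fix p
    have "t - (1 - (1 - u) * (1 - v)) + ((x - (1 - u)) * (1 - v) + x * (z - (1 - v))) = t - (1 - x * z)"
      for t u v x z :: real by (simp add: algebra_simps)
    thus "2 * w / (real p)\<^sup>2 - (1 - (1 - w / (real p)\<^sup>2) * (1 - w / (real (Suc p))\<^sup>2))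
       + (e p * (1 - w / (real (Suc p))\<^sup>2) + b p * e (Suc p)) = 2 * w / (real p)\<^sup>2 - y p"
      by (simp only: e_def y_def)
  qed
  finally have y1: "(\<lambda>p. 2 * w / (real p)\<^sup>2 - y p) \<in> O(?u)" .
  have "(\<lambda>p. b p * b (Suc p)) \<longlonglongrightarrow> 1 * 1" by (intro tendsto_mult lim LIMSEQ_Suc)
  from tendsto_diff[OF tendsto_const[of 1] this] have y0: "y \<longlonglongrightarrow> 0" by (simp add: y_def[abs_def])
  have "?u \<in> O(\<lambda>p. real p powr - 2)"
    by (rule landau_o.big_mono, rule eventually_mono[OF eventually_ge_at_top[of 1]])
      (use \<zeta> in \<open>auto intro!: powr_mono\<close>)
  from landau_o.big_trans[OF y1 this]
  have "(\<lambda>p. 2 * w / (real p)\<^sup>2 - y p) \<in> O(\<lambda>p. real p powr - 2)" .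
  moreover have "(\<lambda>p::nat. 2 * w / (real p)\<^sup>2) \<in> O(\<lambda>p. real p powr - 2)" by real_asymp
  ultimately have "(\<lambda>p. 2 * w / (real p)\<^sup>2 - (2 * w / (real p)\<^sup>2 - y p)) \<in> O(\<lambda>p. real p powr - 2)"
    by (rule sum_in_bigo(2)[rotated])
  hence "y \<in> O(\<lambda>p. real p powr - 2)" by simp
  from landau_o.big.mult[OF this this]
  have "(\<lambda>p. (y p)\<^sup>2) \<in> O(\<lambda>p. real p powr - 2 * real p powr - 2)" by (simp add: power2_eq_square)
  also have "(\<lambda>p::nat. real p powr - 2 * real p powr - 2) \<in> O(\<lambda>p. real p powr - 3)" by real_asymp
  also note le
  finally have y2: "(\<lambda>p. (y p)\<^sup>2) \<in> O(?u)" .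
  define r where "r t = 1 / sqrt (1 - t) - 1 - t / 2" for t :: real
  have "r \<in> O[at 0](\<lambda>t. t\<^sup>2)" unfolding r_def[abs_def] by real_asymp
  then obtain C where C: "\<forall>\<^sub>F t in at 0. norm (r t) \<le> C * norm (t\<^sup>2)" by (auto elim: landau_o.bigE)
  \<comment> \<open>\<open>y p\<close> may vanish, so the bound is extended from the punctured
    neighbourhood to the point 0, where \<open>r 0 = 0\<close>.\<close>
  hence "\<forall>\<^sub>F t in nhds 0. norm (r t) \<le> C * norm (t\<^sup>2)"
    unfolding eventually_at_filter by eventually_elim (auto simp: r_def)
  from eventually_compose_filterlim[OF this y0]
  have "(\<lambda>p. r (y p)) \<in> O(\<lambda>p. (y p)\<^sup>2)" by (rule bigoI)
  from landau_o.big_trans[OF this y2] have r: "(\<lambda>p. r (y p)) \<in> O(?u)" .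
  have "(\<lambda>p. 1 / 2 * r (y p) - 1 / 4 * (2 * w / (real p)\<^sup>2 - y p)) \<in> O(?u)"
    using r y1 by (intro sum_in_bigo) simp_all
  also have "(\<lambda>p. 1 / 2 * r (y p) - 1 / 4 * (2 * w / (real p)\<^sup>2 - y p))
      = (\<lambda>p. 1 / (2 * sqrt (b p * b (Suc p))) - (1 / 2 + w / 2 / (real p)\<^sup>2))"
  proof (rule ext)
    fix p
    have "1 / 2 * (1 / sqrt (1 - (1 - x)) - 1 - (1 - x) / 2) - 1 / 4 * (2 * w / t - (1 - x)) = 1 / (2 * sqrt x) - (1 / 2 + w / 2 / t)"
      for x t :: real by (simp add: diff_divide_distrib add_divide_distrib)
    thus "1 / 2 * r (y p) - 1 / 4 * (2 * w / (real p)\<^sup>2 - y p) = 1 / (2 * sqrt (b p * b (Suc p))) - (1 / 2 + w / 2 / (real p)\<^sup>2)"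
      by (simp only: r_def y_def)
  qed
  finally show "(\<lambda>p. 1 / (2 * sqrt (b p * b (Suc p))) - (1 / 2 + w / 2 / (real p)\<^sup>2)) \<in> O(?u)" .
qed

theorem corollary1:
  fixes b :: "nat \<Rightarrow> real" and w \<zeta> \<theta> :: real
  assumes "\<forall>n\<ge>1. b n > 0"
    and "0 < \<zeta>" and "\<zeta> \<le> 1"
    and "(\<lambda>n. b n - (1 - w / (real n)^2)) \<in> O(\<lambda>n. real n powr (- 2 - \<zeta>))"
    and "- 3 / 8 < w" and "w < 1 / 8"
    and "one_transient b"
    and "\<theta> = 1 - sqrt (1 - 8 * w) / 2"
  shows "approx_const (return_density b)
           (\<lambda>b0. (real_of_ereal (b0_crit b) - b0) powr (\<theta> / (1 - \<theta>)))
           (at_left (real_of_ereal (b0_crit b)))"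
proof -
  define \<alpha> where "\<alpha> = sqrt (1 - 8 * w) / 2"
  have "\<alpha>\<^sup>2 = (1 - 8 * w) / 4" using assms(6) by (simp add: \<alpha>_def power_divide)
  hence sq: "(1 - 4 * \<alpha>\<^sup>2) / 16 = w / 2" by simp
  have "sqrt (1 - 8 * w) < sqrt 4" using assms(5) by (intro real_sqrt_less_mono) simp
  hence \<alpha>: "0 < \<alpha>" "\<alpha> < 1" using assms(6) by (auto simp: \<alpha>_def)
  interpret critical_sos b \<alpha> \<zeta>
  proof
    show "\<exists>v. (\<forall>p\<ge>1. 0 < v p) \<and> (\<forall>p\<ge>1. jac (\<lambda>p. if p = 0 then 0 else 1 / (2 * sqrt (b p * b (Suc p)))) v p = v p - unit_vec 1 p)"
      using assms(7) by (auto simp: one_transient_def positive_resolvent_solution_def R_op_eq_jac unit_vec_def)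
    show "(\<lambda>p. (if p = 0 then 0 else 1 / (2 * sqrt (b p * b (Suc p)))) - (1 / 2 + (1 - 4 * \<alpha>\<^sup>2) / 16 / (real p)\<^sup>2))
      \<in> O(\<lambda>p. real p powr (- 2 - \<zeta>))"
    proof (rule landau_o.big.in_cong[THEN iffD1, OF _ inverse_sqrt_expansion(2)[OF assms(2,3,4)]])
      show "\<forall>\<^sub>F p in sequentially. 1 / (2 * sqrt (b p * b (Suc p))) - (1 / 2 + w / 2 / (real p)\<^sup>2)
        = (if p = 0 then 0 else 1 / (2 * sqrt (b p * b (Suc p)))) - (1 / 2 + (1 - 4 * \<alpha>\<^sup>2) / 16 / (real p)\<^sup>2)"
        by (rule eventually_mono[OF eventually_gt_at_top[of 0]]) (simp add: sq)
    qed
    show "b \<longlonglongrightarrow> 1" by (rule inverse_sqrt_expansion(1)[OF assms(2,3,4)])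
  qed (use assms \<alpha> in auto)
  have "\<theta> / (1 - \<theta>) = (1 - \<alpha>) / \<alpha>" by (simp add: assms(8) \<alpha>_def)
  thus ?thesis using return_density_asymp by simp
qed

end
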